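(* Let $d\ge 3$ and let $\mathbb{T}_d$ be the infinite tree in which every vertex has degree $d$. There exists $\lambda_0=\lambda_0(d)>1$ such that for every $\lambda\in(0,\lambda_0)$, if $\rho>0$ is small enough, then in the two-type competition model with conversion on $\mathbb{T}_d$ with parameters $\lambda$ and $\rho$, type 1 survives with positive probability.
   Context: The two-type competition model with conversion on an infinite connected graph $G$ with parameters $\lambda,\rho>0$ is defined as follows. Each site (vertex) is at each time vacant, occupied by type 1, or occupied by type 2. At time $0$ a single distinguished site is occupied by type 1 and all other sites are vacant. A site occupied by type 1 attempts to occupy each neighbouring site at rate $1$ (through each edge, after an independent exponential time of rate $1$); the attempt succeeds only if the neighbouring site is vacant. To each site $x$ is assigned a conversion time $\mathcal{I}_x$, where $\{\mathcal{I}_x\}_x$ are i.i.d. exponential random variables of rate $\rho$, independent of everything else; once $x$ is occupied by type 1, after a further time $\mathcal{I}_x$ it converts to type 2 (if it is not already type 2). A site occupied by type 2 spreads type 2 through each incident edge at rate $\lambda$ to neighbouring sites that are vacant or occupied by type 1. A site occupied by type 2 stays type 2 forever. Equivalently, it is the continuous-time Markov process in which a vacant site becomes type 1 at rate (number of type 1 neighbours), a vacant site becomes type 2 at rate $\lambda\cdot$(number of type 2 neighbours), and a type 1 site becomes type 2 at rate $\rho+\lambda\cdot$(number of type 2 neighbours). Type 1 survives if the set of sites occupied by type 1 is non-empty at all times; otherwise type 1 dies out. *)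

theory Defs
  imports "HOL-Probability.Probability"
begin

(* A graph is given by its adjacency relation; the vertex set is the whole type. *)

definition is_cycle :: "('v \<Rightarrow> 'v \<Rightarrow> bool) \<Rightarrow> 'v list \<Rightarrow> bool" where
  "is_cycle adj xs \<longleftrightarrow>
     length xs \<ge> 3 \<and> distinct xs \<and> successively adj xs \<and> adj (last xs) (hd xs)"

definition regular_tree :: "nat \<Rightarrow> ('v \<Rightarrow> 'v \<Rightarrow> bool) \<Rightarrow> bool" where
  "regular_tree d adj \<longleftrightarrow>
     symp adj \<and> irreflp adj \<and>
     (\<forall>x y. adj\<^sup>*\<^sup>* x y) \<and>
     (\<nexists>xs. is_cycle adj xs) \<and>
     (\<forall>x. finite {y. adj x y} \<and> card {y. adj x y} = d)"

(* The random clocks: Convert x is the conversion time of x, and Spread1 x y and Spread2 x y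
   are the delays after which x, once of the respective type, attempts to pass that type on
   to y.  For non-adjacent x and y the clocks exist but are never consulted.  One delay per
   ordered pair and type suffices: a failed type 1 attempt finds a site that will never be
   vacant again, and after a type 2 attempt the target has type 2 forever. *)

datatype 'v clock = Convert 'v | Spread1 'v 'v | Spread2 'v 'v

fun clock_rate :: "real \<Rightarrow> real \<Rightarrow> 'v clock \<Rightarrow> real" where
  "clock_rate lam \<rho> (Convert x) = \<rho>"
| "clock_rate lam \<rho> (Spread1 x y) = 1"
| "clock_rate lam \<rho> (Spread2 x y) = lam"

(* Completed, since the evolution below is only meaningful off a null set
   (positive clocks, no ties, no explosion). *)

definition clock_space :: "real \<Rightarrow> real \<Rightarrow> ('v clock \<Rightarrow> real) measure" where
  "clock_space lam \<rho> =
     completion (PiM UNIV (\<lambda>c. density lborel (exponential_density (clock_rate lam \<rho> c))))"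

(* The history of the process up to some event: time1 x and time2 x are the times at which x
   became type 1 and type 2, with value \<infinity> if this has not happened (yet).  A site that
   goes directly from vacant to type 2 keeps time1 x = \<infinity>. *)

record 'v history =
  time1 :: "'v \<Rightarrow> ereal"
  time2 :: "'v \<Rightarrow> ereal"

definition initial_history :: "'v \<Rightarrow> 'v history" where
  "initial_history v0 = \<lparr>time1 = (\<lambda>x. if x = v0 then 0 else \<infinity>), time2 = (\<lambda>x. \<infinity>)\<rparr>"

(* The earliest pending transitions of y to type 1 and to type 2.  Only a vacant y can become
   type 1, and only through a neighbour that is still of type 1; a y that is not yet of type 2
   becomes type 2 by its own conversion or through a neighbour of type 2. *)

definition pending1 ::
  "('v \<Rightarrow> 'v \<Rightarrow> bool) \<Rightarrow> ('v clock \<Rightarrow> real) \<Rightarrow> 'v history \<Rightarrow> 'v \<Rightarrow> ereal" where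
  "pending1 adj \<omega> h y =
     (if time1 h y = \<infinity> \<and> time2 h y = \<infinity>
      then INF x \<in> {x. adj x y \<and> time2 h x = \<infinity>}. time1 h x + ereal (\<omega> (Spread1 x y))
      else \<infinity>)"

definition pending2 ::
  "('v \<Rightarrow> 'v \<Rightarrow> bool) \<Rightarrow> ('v clock \<Rightarrow> real) \<Rightarrow> 'v history \<Rightarrow> 'v \<Rightarrow> ereal" where
  "pending2 adj \<omega> h y =
     (if time2 h y = \<infinity>
      then min (time1 h y + ereal (\<omega> (Convert y)))
               (INF x \<in> {x. adj x y}. time2 h x + ereal (\<omega> (Spread2 x y)))
      else \<infinity>)"

definition next_event ::
  "('v \<Rightarrow> 'v \<Rightarrow> bool) \<Rightarrow> ('v clock \<Rightarrow> real) \<Rightarrow> 'v history \<Rightarrow> ereal" where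
  "next_event adj \<omega> h = (INF y. min (pending1 adj \<omega> h y) (pending2 adj \<omega> h y))"

(* Everything pending at the time of the next event takes place.  Ties, which almost surely do
   not occur, are resolved in favour of type 2. *)

definition step ::
  "('v \<Rightarrow> 'v \<Rightarrow> bool) \<Rightarrow> ('v clock \<Rightarrow> real) \<Rightarrow> 'v history \<Rightarrow> 'v history" where
  "step adj \<omega> h =
     \<lparr>time1 = (\<lambda>y. if pending1 adj \<omega> h y = next_event adj \<omega> h \<and>
                      pending1 adj \<omega> h y < pending2 adj \<omega> h y
                   then next_event adj \<omega> h else time1 h y),
      time2 = (\<lambda>y. if pending2 adj \<omega> h y = next_event adj \<omega> h \<and>
                      pending2 adj \<omega> h y < \<infinity>
                   then next_event adj \<omega> h else time2 h y)\<rparr>"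

definition history ::
  "('v \<Rightarrow> 'v \<Rightarrow> bool) \<Rightarrow> 'v \<Rightarrow> ('v clock \<Rightarrow> real) \<Rightarrow> nat \<Rightarrow> 'v history" where
  "history adj v0 \<omega> n = (step adj \<omega> ^^ n) (initial_history v0)"

(* Each entry of the history changes at most once, from \<infinity> to its final value,
   so the infimum over all events is that final value. *)

definition type1_time ::
  "('v \<Rightarrow> 'v \<Rightarrow> bool) \<Rightarrow> 'v \<Rightarrow> ('v clock \<Rightarrow> real) \<Rightarrow> 'v \<Rightarrow> ereal" where
  "type1_time adj v0 \<omega> x = (INF n. time1 (history adj v0 \<omega> n) x)"

definition type2_time ::
  "('v \<Rightarrow> 'v \<Rightarrow> bool) \<Rightarrow> 'v \<Rightarrow> ('v clock \<Rightarrow> real) \<Rightarrow> 'v \<Rightarrow> ereal" where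
  "type2_time adj v0 \<omega> x = (INF n. time2 (history adj v0 \<omega> n) x)"

datatype site_state = Vacant | Type1 | Type2

definition site_at ::
  "('v \<Rightarrow> 'v \<Rightarrow> bool) \<Rightarrow> 'v \<Rightarrow> ('v clock \<Rightarrow> real) \<Rightarrow> real \<Rightarrow> 'v \<Rightarrow> site_state" where
  "site_at adj v0 \<omega> t x =
     (if type2_time adj v0 \<omega> x \<le> ereal t then Type2
      else if type1_time adj v0 \<omega> x \<le> ereal t then Type1
      else Vacant)"

definition type1_survives ::
  "('v \<Rightarrow> 'v \<Rightarrow> bool) \<Rightarrow> 'v \<Rightarrow> ('v clock \<Rightarrow> real) \<Rightarrow> bool" where
  "type1_survives adj v0 \<omega> \<longleftrightarrow> (\<forall>t\<ge>0. {x. site_at adj v0 \<omega> t x = Type1} \<noteq> {})"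

end

theory Submission
  imports Defs
begin

text \<open>
  Suppose a vertex \<open>x\<close> becomes type 1 at time \<open>t\<close>. Whatever happened before, nothing is worse for the
  subtree below \<open>x\<close> than its parent being of type 2 from time \<open>t\<close> on. As long as no site of that
  subtree converts, type 1 spreads to a descendant exactly if it wins a race along the
  connecting path against type 2 starting one edge behind. Cut the path into pairs of steps and ask
  type 1 to win each pair separately: for \<open>\<lambda> = 1\<close> a pair is won with probability
  \<open>P(b\<^sub>0 > a\<^sub>1 + a\<^sub>2) + \<dots> > 1/4\<close>, and a vertex has at least \<open>4\<close> grandchildren, so for
  \<open>\<lambda>\<close> slightly above \<open>1\<close> the expected number of winning paths of length \<open>2n\<close> still grows
  exponentially in \<open>n\<close>.

  To decouple the subtrees of the \<open>2n\<close>-th generation, only keep the endpoints that are reached during a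
  time window \<open>[t + M - 1, t + M)\<close> and whose clock for type 2 back to the parent exceeds \<open>1\<close>; this
  costs a factor linear in \<open>n\<close> only. Then nothing below a kept endpoint influences the
  other paths before time \<open>t + M\<close>. The remaining risk, a conversion outside the
  kept subtrees before time \<open>t + M\<close>, is small for small \<open>\<rho>\<close> by an exponential moment and a union bound
  over all descendants. So the kept endpoints dominate a supercritical branching process,
  and on its survival type 1 sites are born at arbitrarily late times.
\<close>

section \<open>Rooted trees\<close>

text \<open>The tree is rooted at a neighbour of the starting vertex, not at the starting vertex.
  The start then has a parent like every other relevant vertex and exactly \<open>d - 1\<close>
  children, so one statement serves all generations. Why pairs of steps: at rate 1 a single step
  against type 2 one edge behind is won with probability 1/2, so for \<open>d = 3\<close>, with two
  children, single steps are exactly critical. A pair may also carry a lead from the first step into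
  the second; this strict gain survives a slight increase of the rate. Since only the lower bound 4
  on the number of grandchildren enters the threshold, one threshold serves every \<open>d\<close>.
  The history may explode. If some type 1 site is never recorded as type 2, type 1 survives at once;
  otherwise every attempt below can be located in the history. Progress in real time comes from the
  lower bound \<open>1 / N\<close> on passage times. Supercriticality becomes a bound
  \<open>q\<close> on the probability of \<open>j\<close> successful generations, uniform in
  \<open>j\<close> and in the vertex, by induction on \<open>j\<close>. The window \<open>M\<close>
  is chosen for each vertex separately.\<close>

locale rooted_tree =
  fixes adj :: "'v \<Rightarrow> 'v \<Rightarrow> bool" and root :: 'v
    and par :: "'v \<Rightarrow> 'v" and level :: "'v \<Rightarrow> nat" and m :: nat
  assumes adj_iff: "adj x y \<longleftrightarrow> x \<noteq> root \<and> y = par x \<or> y \<noteq> root \<and> x = par y"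
    and level_root: "level root = 0"
    and level_par: "x \<noteq> root \<Longrightarrow> level x = Suc (level (par x))"
    and finite_children: "finite {y. y \<noteq> root \<and> par y = x}"
    and card_children: "x \<noteq> root \<Longrightarrow> card {y. y \<noteq> root \<and> par y = x} = m"
    and two_le_m: "2 \<le> m"
begin

definition desc :: "nat \<Rightarrow> 'v \<Rightarrow> 'v set" where
  "desc k x = {w. level w = level x + k \<and> (par ^^ k) w = x}"

definition below :: "'v \<Rightarrow> 'v set" where
  "below x = (\<Union>k. desc k x)"

definition psum :: "('v \<Rightarrow> real) \<Rightarrow> nat \<Rightarrow> 'v \<Rightarrow> real" where
  "psum f k w = (\<Sum>j<k. f ((par ^^ j) w))"

lemma psum_0 [simp]: "psum f 0 w = 0"
  by (simp add: psum_def)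

lemma psum_Suc: "psum f (Suc k) w = f w + psum f k (par w)"
  unfolding psum_def sum.lessThan_Suc_shift by (simp add: funpow_swap1)

lemma level_eq_0_iff: "level x = 0 \<longleftrightarrow> x = root"
  using level_root level_par by fastforce

lemma desc_0 [simp]: "desc 0 x = {w. w = x}"
  by (auto simp: desc_def)

lemma desc_Suc: "w \<in> desc (Suc k) x \<longleftrightarrow> w \<noteq> root \<and> par w \<in> desc k x"
proof (cases "w = root")
  case False
  then show ?thesis
    using level_par[OF False] by (auto simp: desc_def funpow_swap1)
qed (simp add: desc_def level_root)

lemma desc_trans: "\<lbrakk>w \<in> desc j y; y \<in> desc k x\<rbrakk> \<Longrightarrow> w \<in> desc (j + k) x"
  by (induction j arbitrary: w) (auto simp: desc_Suc)

lemma par_funpow_desc: "\<lbrakk>w \<in> desc k x; j \<le> k\<rbrakk> \<Longrightarrow> (par ^^ j) w \<in> desc (k - j) x"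
proof (induction j arbitrary: w k)
  case (Suc j)
  then obtain k' where k: "k = Suc k'" by (cases k) auto
  with Suc show ?case
    by (auto simp: desc_Suc funpow_swap1)
qed simp

lemma desc_below: "w \<in> desc k x \<Longrightarrow> w \<in> below x"
  by (auto simp: below_def)

lemma self_below: "x \<in> below x"
  using desc_below[of x 0 x] by simp

lemma below_trans: "\<lbrakk>w \<in> below y; y \<in> below x\<rbrakk> \<Longrightarrow> w \<in> below x"
  unfolding below_def using desc_trans by blast

lemma below_child: "\<lbrakk>par u \<in> below x; u \<noteq> root\<rbrakk> \<Longrightarrow> u \<in> below x"
  unfolding below_def using desc_Suc by blast

lemma par_below: "\<lbrakk>w \<in> below x; w \<noteq> x\<rbrakk> \<Longrightarrow> w \<noteq> root \<and> par w \<in> below x"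
proof -
  assume "w \<in> below x" "w \<noteq> x"
  then obtain k where k: "w \<in> desc k x" by (auto simp: below_def)
  with \<open>w \<noteq> x\<close> obtain k' where "k = Suc k'" by (cases k) auto
  with k show ?thesis by (auto simp: desc_Suc desc_below)
qed

lemma level_below: "w \<in> below x \<Longrightarrow> level x \<le> level w"
  by (auto simp: below_def desc_def)

lemma below_not_root: "\<lbrakk>w \<in> below x; x \<noteq> root\<rbrakk> \<Longrightarrow> w \<noteq> root"
  using level_below[of w x] level_eq_0_iff[of x] level_root by auto

lemma desc_not_root: "\<lbrakk>w \<in> desc k x; x \<noteq> root\<rbrakk> \<Longrightarrow> w \<noteq> root"
  using below_not_root desc_below by blast

lemma child_not_below: "u \<noteq> root \<Longrightarrow> par u \<notin> below u"
  using level_below level_par by fastforce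

lemma below_unique:
  "\<lbrakk>w \<in> below y; w \<in> below y'; y \<in> desc k x; y' \<in> desc k x\<rbrakk> \<Longrightarrow> y = y'"
  by (auto simp: below_def desc_def)

lemma finite_desc: "finite (desc k x)"
proof (induction k)
  case (Suc k)
  have "desc (Suc k) x = (\<Union>y\<in>desc k x. {w. w \<noteq> root \<and> par w = y})"
    by (auto simp: desc_Suc)
  with Suc finite_children show ?case by simp
qed simp

lemma card_desc: "x \<noteq> root \<Longrightarrow> card (desc k x) = m ^ k"
proof (induction k)
  case (Suc k)
  have "desc (Suc k) x = (\<Union>y\<in>desc k x. {w. w \<noteq> root \<and> par w = y})"
    by (auto simp: desc_Suc)
  also have "card \<dots> = (\<Sum>y\<in>desc k x. card {w. w \<noteq> root \<and> par w = y})"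
    by (rule card_UN_disjoint) (auto simp: finite_desc finite_children)
  also have "\<dots> = (\<Sum>y\<in>desc k x. m)"
    using desc_not_root Suc.prems by (intro sum.cong card_children) auto
  finally show ?case using Suc by simp
qed simp

lemma finite_neighbours: "finite {x. adj x y}"
proof -
  have "{x. adj x y} \<subseteq> insert (par y) {x. x \<noteq> root \<and> par x = y}"
    by (auto simp: adj_iff)
  then show ?thesis using finite_children finite_subset by blast
qed

lemma desc_root: "w \<in> desc (level w) root"
proof (induction "level w" arbitrary: w)
  case 0
  then show ?case using level_eq_0_iff[of w] by simp
next
  case (Suc n)
  then have "w \<noteq> root" using level_root by auto
  with Suc level_par[of w] show ?case
    by (metis desc_Suc nat.inject)
qed

lemma countable_vertices: "countable (UNIV :: 'v set)"
proof -
  have "(UNIV :: 'v set) = (\<Union>k. desc k root)"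
    using desc_root by auto
  then show ?thesis
    by (metis countable_UN countable_finite finite_desc countableI_type)
qed

end

section \<open>Rooting a regular tree at an arbitrary vertex\<close>

lemma successively_append_single:
  "successively P (xs @ [y]) \<longleftrightarrow> successively P xs \<and> (xs = [] \<or> P (last xs) y)"
  by (auto simp: successively_append_iff)

text \<open>The level is the graph distance from the root. An edge inside a level, or a second
  neighbour one level up, would close a simple path through lower levels to a cycle; so every edge
  joins a vertex to its unique parent.\<close>

lemma regular_tree_rooted:
  fixes adj :: "'v \<Rightarrow> 'v \<Rightarrow> bool" and root :: 'v
  assumes tree: "regular_tree d adj" and d: "d \<ge> 3"
  shows "\<exists>par level. rooted_tree adj root par level (d - 1)"
proof -
  have sym: "\<And>x y. adj x y \<Longrightarrow> adj y x" and irr: "\<And>x. \<not> adj x x"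
    and con: "\<And>x y. adj\<^sup>*\<^sup>* x y" and acyc: "\<And>xs. \<not> is_cycle adj xs"
    and fin: "\<And>x. finite {y. adj x y}" and card: "\<And>x. card {y. adj x y} = d"
    using tree by (auto simp: regular_tree_def symp_def irreflp_def)
  define level where "level x = (LEAST n. (adj ^^ n) root x)" for x
  have ex: "\<exists>n. (adj ^^ n) root x" for x
    using con[of root x] rtranclp_imp_relpowp by metis
  have lev: "(adj ^^ level x) root x" for x
    unfolding level_def using ex LeastI_ex by metis
  have lev_le: "(adj ^^ n) root x \<Longrightarrow> level x \<le> n" for x n
    unfolding level_def by (rule Least_le)
  have lev_adj: "level y \<le> Suc (level x)" if "adj x y" for x y
    using lev_le[of "Suc (level x)" y] lev[of x] that by auto
  have lev0: "level root = 0"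
    using lev_le[of 0 root] by auto
  have lev0': "x = root" if "level x = 0" for x
    using lev[of x] that by auto
  have ex_par: "\<exists>y. adj x y \<and> level x = Suc (level y)" if nr: "x \<noteq> root" for x
  proof -
    obtain n where n: "level x = Suc n"
      using nr lev0'[of x] by (cases "level x") auto
    then obtain y where y: "(adj ^^ n) root y" "adj y x"
      using lev[of x] by auto
    have "level y = n"
      using lev_le[OF y(1)] lev_adj[OF y(2)] n by simp
    with y n sym show ?thesis by auto
  qed
  define par where "par x = (SOME y. adj x y \<and> level x = Suc (level y))" for x
  have par: "adj x (par x)" "level x = Suc (level (par x))" if "x \<noteq> root" for x
    using someI_ex[OF ex_par[OF that]] unfolding par_def by auto
  \<comment> \<open>Climb from both ends to the parents until these coincide. The level bound keeps
    the old end points off the path built between the parents, and later keeps the common child off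
    the whole path.\<close>
  have path: "\<exists>xs. length xs \<ge> 3 \<and> distinct xs \<and> successively adj xs \<and> hd xs = x \<and> last xs = y
      \<and> (\<forall>z\<in>set xs. level z \<le> n)" if "x \<noteq> y" "level x = n" "level y = n" for x y n
    using that
  proof (induction n arbitrary: x y)
    case 0
    then show ?case using lev0' by metis
  next
    case (Suc n)
    then have nr: "x \<noteq> root" "y \<noteq> root" using lev0 by auto
    note px = par[OF nr(1)] and py = par[OF nr(2)]
    have py': "adj (par y) y" by (rule sym[OF py(1)])
    show ?case
    proof (cases "par x = par y")
      case True
      have "distinct [x, par x, y]" using Suc.prems(1) px(1) py(1) irr[of x] irr[of y] True by auto
      moreover have "successively adj [x, par x, y]" using px(1) py' True by simp
      ultimately show ?thesis
        using Suc.prems px(2) by (intro exI[of _ "[x, par x, y]"]) simp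
    next
      case False
      moreover have "level (par x) = n" "level (par y) = n"
        using px(2) py(2) Suc.prems by auto
      ultimately obtain xs where xs:
        "length xs \<ge> 3" "distinct xs" "successively adj xs" "hd xs = par x" "last xs = par y"
        "\<forall>z\<in>set xs. level z \<le> n"
        using Suc.IH[of "par x" "par y"] by blast
      have ne: "xs \<noteq> []" using xs(1) by auto
      have "distinct (x # xs @ [y])"
        using xs(2,6) Suc.prems by auto
      moreover have "successively adj (x # xs @ [y])"
        using xs ne px(1) py' by (auto simp: successively_Cons successively_append_single)
      ultimately show ?thesis
        using xs(1,6) Suc.prems by (intro exI[of _ "x # xs @ [y]"]) auto
    qed
  qed
  have no_level: False if "adj x y" "level x = level y" for x y
  proof -
    have "x \<noteq> y" using that irr[of x] by auto
    from path[OF this that(2) refl] obtain xs where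
      "length xs \<ge> 3" "distinct xs" "successively adj xs" "hd xs = x" "last xs = y" by auto
    then have "is_cycle adj xs"
      using sym[OF that(1)] by (auto simp: is_cycle_def)
    with acyc show False by blast
  qed
  have uniq: "y = par x" if "adj x y" "level x = Suc (level y)" for x y
  proof (rule ccontr)
    assume ne: "y \<noteq> par x"
    have "x \<noteq> root" using that lev0 by auto
    note p = par[OF this]
    have "level (par x) = level y" using p that by simp
    from path[OF ne refl this] obtain xs where xs:
      "length xs \<ge> 3" "distinct xs" "successively adj xs" "hd xs = y" "last xs = par x"
      "\<forall>z\<in>set xs. level z \<le> level y" by auto
    have "is_cycle adj (x # xs)"
      unfolding is_cycle_def using xs that p(2) sym[OF p(1)] by (auto simp: successively_Cons)
    with acyc show False by blast
  qed
  have adj_par: "x \<noteq> root \<and> y = par x \<or> y \<noteq> root \<and> x = par y" if a: "adj x y" for x y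
  proof -
    have "level x \<noteq> level y" using no_level a by blast
    then consider "level x = Suc (level y)" | "level y = Suc (level x)"
      using lev_adj[OF a] lev_adj[OF sym[OF a]] by linarith
    then show ?thesis
    proof cases
      case 1
      then show ?thesis using uniq[OF a] lev0 by auto
    next
      case 2
      then show ?thesis using uniq[OF sym[OF a]] lev0 by auto
    qed
  qed
  have adj_iff: "adj x y \<longleftrightarrow> x \<noteq> root \<and> y = par x \<or> y \<noteq> root \<and> x = par y" for x y
    using adj_par par sym by blast
  have ch: "{y. y \<noteq> root \<and> par y = x} \<subseteq> {y. adj x y}" for x
    using adj_iff by blast
  have "card {y. y \<noteq> root \<and> par y = x} = d - 1" if "x \<noteq> root" for x
  proof -
    have "par x \<notin> {y. y \<noteq> root \<and> par y = x}"
      using par(2)[OF that] par(2)[of "par x"] by auto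
    moreover have "{y. adj x y} = insert (par x) {y. y \<noteq> root \<and> par y = x}"
      using adj_iff that by auto
    moreover have "finite {y. y \<noteq> root \<and> par y = x}"
      using ch fin finite_subset by blast
    ultimately have "card {y. adj x y} = Suc (card {y. y \<noteq> root \<and> par y = x})"
      by simp
    then show ?thesis using card[of x] by simp
  qed
  then have "rooted_tree adj root par level (d - 1)"
    using adj_iff lev0 par(2) d finite_subset[OF ch fin] by unfold_locales auto
  then show ?thesis by blast
qed

section \<open>Deterministic evolution for positive clocks\<close>

locale positive_clocks =
  fixes adj :: "'v \<Rightarrow> 'v \<Rightarrow> bool" and v0 :: 'v and \<omega> :: "'v clock \<Rightarrow> real"
  assumes pos: "\<And>c. 0 < \<omega> c"
    and finite_nbrs: "\<And>y. finite {x. adj x y}"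
begin

abbreviation t1 :: "nat \<Rightarrow> 'v \<Rightarrow> ereal" where "t1 n \<equiv> time1 (history adj v0 \<omega> n)"
abbreviation t2 :: "nat \<Rightarrow> 'v \<Rightarrow> ereal" where "t2 n \<equiv> time2 (history adj v0 \<omega> n)"
abbreviation ev :: "nat \<Rightarrow> ereal" where "ev n \<equiv> next_event adj \<omega> (history adj v0 \<omega> n)"
abbreviation T1 :: "'v \<Rightarrow> ereal" where "T1 \<equiv> type1_time adj v0 \<omega>"
abbreviation T2 :: "'v \<Rightarrow> ereal" where "T2 \<equiv> type2_time adj v0 \<omega>"

lemma t1_0: "t1 0 x = (if x = v0 then 0 else \<infinity>)"
  and t2_0: "t2 0 x = \<infinity>"
  by (simp_all add: history_def initial_history_def)

lemma history_Suc: "history adj v0 \<omega> (Suc n) = step adj \<omega> (history adj v0 \<omega> n)"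
  by (simp add: history_def)

lemma ev_le1:
  assumes "t1 n y = \<infinity>" "t2 n y = \<infinity>" "adj u y" "t2 n u = \<infinity>"
  shows "ev n \<le> t1 n u + \<omega> (Spread1 u y)"
proof -
  have "ev n \<le> pending1 adj \<omega> (history adj v0 \<omega> n) y"
    unfolding next_event_def by (rule INF_lower2[of y]) auto
  also have "\<dots> \<le> t1 n u + \<omega> (Spread1 u y)"
    unfolding pending1_def using assms by (auto intro!: INF_lower)
  finally show ?thesis .
qed

lemma ev_le_pending2: "ev n \<le> pending2 adj \<omega> (history adj v0 \<omega> n) y"
  unfolding next_event_def by (rule INF_lower2[of y]) auto

lemma ev_le_conversion:
  assumes "t2 n y = \<infinity>"
  shows "ev n \<le> t1 n y + \<omega> (Convert y)"
  using ev_le_pending2[of n y] assms by (auto simp: pending2_def)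

lemma ev_le2:
  assumes "t2 n y = \<infinity>" "adj u y"
  shows "ev n \<le> t2 n u + \<omega> (Spread2 u y)"
proof -
  have "(INF x\<in>{x. adj x y}. t2 n x + ereal (\<omega> (Spread2 x y))) \<le> t2 n u + \<omega> (Spread2 u y)"
    using assms(2) by (auto intro!: INF_lower)
  with ev_le_pending2[of n y] assms(1) show ?thesis
    by (auto simp: pending2_def intro: order_trans)
qed

lemma INF_attained:
  fixes f :: "'a \<Rightarrow> ereal"
  assumes "finite A" "(INF x\<in>A. f x) < \<infinity>"
  obtains x where "x \<in> A" "(INF x\<in>A. f x) = f x"
proof -
  have "A \<noteq> {}" using assms(2) by (auto simp: top_ereal_def)
  then have "Min (f ` A) = Inf (f ` A)" "Min (f ` A) \<in> f ` A"
    using assms(1) by (auto intro!: Min_Inf Min_in simp del: Min_in)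
  with that show ?thesis by auto
qed

text \<open>Finite degree makes the infimum in \<open>pending1\<close> a minimum, so every new type
  1 site has an actual infector \<open>u\<close>.\<close>

lemma t1_Suc_cases:
  obtains "t1 (Suc n) y = t1 n y"
  | u where "t1 n y = \<infinity>" "t2 n y = \<infinity>" "t1 (Suc n) y = ev n" "ev n < \<infinity>"
      "adj u y" "t2 n u = \<infinity>" "t1 n u < \<infinity>" "ev n = t1 n u + \<omega> (Spread1 u y)"
proof (cases "t1 (Suc n) y = t1 n y")
  case False
  let ?h = "history adj v0 \<omega> n"
  have p: "pending1 adj \<omega> ?h y = ev n" "pending1 adj \<omega> ?h y < pending2 adj \<omega> ?h y"
    "t1 (Suc n) y = ev n"
    using False unfolding history_Suc by (auto simp: step_def split: if_splits)
  then have fin: "pending1 adj \<omega> ?h y < \<infinity>"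
    using less_le_trans[OF p(2), of \<infinity>] by simp
  then have vac: "t1 n y = \<infinity>" "t2 n y = \<infinity>"
    by (auto simp: pending1_def split: if_splits)
  let ?A = "{x. adj x y \<and> t2 n x = \<infinity>}"
  have eq: "pending1 adj \<omega> ?h y = (INF x\<in>?A. t1 n x + ereal (\<omega> (Spread1 x y)))"
    using vac by (simp add: pending1_def)
  have "finite ?A" using finite_nbrs[of y] by (rule rev_finite_subset) auto
  from INF_attained[OF this fin[unfolded eq]] obtain u where
    u: "u \<in> ?A" "(INF x\<in>?A. t1 n x + ereal (\<omega> (Spread1 x y))) = t1 n u + ereal (\<omega> (Spread1 u y))" .
  then have eqn: "ev n = t1 n u + \<omega> (Spread1 u y)" using eq p(1) by simp
  have "ev n < \<infinity>" using fin p(1) by simp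
  then have "t1 n u < \<infinity>" using eqn by (cases "t1 n u") auto
  with that(2)[of u] u vac p(3) eqn \<open>ev n < \<infinity>\<close> show ?thesis by auto
qed (use that in blast)

lemma t2_Suc_cases:
  obtains "t2 (Suc n) y = t2 n y"
  | "t2 n y = \<infinity>" "t2 (Suc n) y = ev n" "ev n < \<infinity>" "t1 n y < \<infinity>"
      "ev n = t1 n y + \<omega> (Convert y)"
  | u where "t2 n y = \<infinity>" "t2 (Suc n) y = ev n" "ev n < \<infinity>"
      "adj u y" "t2 n u < \<infinity>" "ev n = t2 n u + \<omega> (Spread2 u y)"
proof (cases "t2 (Suc n) y = t2 n y")
  case False
  let ?h = "history adj v0 \<omega> n"
  have p: "pending2 adj \<omega> ?h y = ev n" "pending2 adj \<omega> ?h y < \<infinity>" "t2 (Suc n) y = ev n"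
    using False unfolding history_Suc by (auto simp: step_def split: if_splits)
  then have vac: "t2 n y = \<infinity>"
    by (auto simp: pending2_def split: if_splits)
  let ?I = "INF x\<in>{x. adj x y}. t2 n x + ereal (\<omega> (Spread2 x y))"
  have eq: "ev n = min (t1 n y + ereal (\<omega> (Convert y))) ?I"
    using vac p(1) by (simp add: pending2_def)
  have fin: "ev n < \<infinity>" using p by simp
  show ?thesis
  proof (cases "t1 n y + ereal (\<omega> (Convert y)) \<le> ?I")
    case True
    then have e: "ev n = t1 n y + \<omega> (Convert y)" using eq by (simp add: min_def)
    with fin have "t1 n y < \<infinity>" by (cases "t1 n y") auto
    with that(2) vac p(3) fin e show ?thesis by blast
  next
    case False
    then have e: "ev n = ?I" using eq by (simp add: min_def)
    from INF_attained[OF finite_nbrs fin[unfolded e]] obtain u where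
      u: "u \<in> {x. adj x y}" "?I = t2 n u + ereal (\<omega> (Spread2 u y))" .
    then have "t2 n u < \<infinity>" using fin e by (cases "t2 n u") auto
    with that(3)[of u] vac p(3) fin e u show ?thesis by auto
  qed
qed (use that in blast)

lemma t1_nonneg: "0 \<le> t1 n x"
proof (induction n arbitrary: x)
  case (Suc n)
  show ?case
  proof (cases rule: t1_Suc_cases[of n x])
    case (2 u)
    then show ?thesis using Suc[of u] less_imp_le[OF pos] by (simp add: add_nonneg_nonneg)
  qed (use Suc in simp)
qed (simp add: t1_0)

lemma t2_nonneg: "0 \<le> t2 n x"
proof (induction n arbitrary: x)
  case (Suc n)
  show ?case
  proof (cases rule: t2_Suc_cases[of n x])
    case 2
    then show ?thesis using t1_nonneg[of n x] less_imp_le[OF pos] by (simp add: add_nonneg_nonneg)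
  next
    case (3 u)
    then show ?thesis using Suc[of u] less_imp_le[OF pos] by (simp add: add_nonneg_nonneg)
  qed (use Suc in simp)
qed (simp add: t2_0)

lemma ev_greatest:
  assumes "\<And>y u. \<lbrakk>t1 n y = \<infinity>; t2 n y = \<infinity>; adj u y; t2 n u = \<infinity>\<rbrakk> \<Longrightarrow> b \<le> t1 n u + \<omega> (Spread1 u y)"
    and "\<And>y. t2 n y = \<infinity> \<Longrightarrow> b \<le> t1 n y + \<omega> (Convert y)"
    and "\<And>y u. \<lbrakk>t2 n y = \<infinity>; adj u y\<rbrakk> \<Longrightarrow> b \<le> t2 n u + \<omega> (Spread2 u y)"
  shows "b \<le> ev n"
  unfolding next_event_def pending1_def pending2_def
  using assms by (auto intro!: INF_greatest)

lemma t1_Suc_vacant: "t1 (Suc n) y = \<infinity> \<Longrightarrow> t1 n y = \<infinity>"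
  by (cases rule: t1_Suc_cases[of n y]) auto

lemma t2_Suc_vacant: "t2 (Suc n) y = \<infinity> \<Longrightarrow> t2 n y = \<infinity>"
  by (cases rule: t2_Suc_cases[of n y]) auto

lemma ev_le_add: "ev n \<le> ev n + ereal (\<omega> c)"
  using less_imp_le[OF pos[of c]] by (cases "ev n") auto

text \<open>What is pending after event \<open>n\<close> was either pending before, hence not due
  before \<open>ev n\<close>, or was created by event \<open>n\<close> and is due a positive delay
  later.\<close>

lemma ev_Suc: "ev n \<le> ev (Suc n)"
proof (rule ev_greatest)
  fix y u assume a: "t1 (Suc n) y = \<infinity>" "t2 (Suc n) y = \<infinity>" "adj u y" "t2 (Suc n) u = \<infinity>"
  show "ev n \<le> t1 (Suc n) u + \<omega> (Spread1 u y)"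
    by (cases rule: t1_Suc_cases[of n u])
      (use a ev_le1[of n y u] ev_le_add[of n "Spread1 u y"] t1_Suc_vacant t2_Suc_vacant in simp_all)
next
  fix y assume a: "t2 (Suc n) y = \<infinity>"
  show "ev n \<le> t1 (Suc n) y + \<omega> (Convert y)"
    by (cases rule: t1_Suc_cases[of n y])
      (use a ev_le_conversion[of n y] ev_le_add[of n "Convert y"] t2_Suc_vacant in simp_all)
next
  fix y u assume a: "t2 (Suc n) y = \<infinity>" "adj u y"
  show "ev n \<le> t2 (Suc n) u + \<omega> (Spread2 u y)"
    by (cases rule: t2_Suc_cases[of n u])
      (use a ev_le2[of n y u] ev_le_add[of n "Spread2 u y"] t2_Suc_vacant in simp_all)
qed

lemma ev_mono: "n \<le> k \<Longrightarrow> ev n \<le> ev k"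
  using lift_Suc_mono_le[of ev n k] ev_Suc by auto

lemma t1_Suc_stable: "t1 n x < \<infinity> \<Longrightarrow> t1 (Suc n) x = t1 n x"
  by (cases rule: t1_Suc_cases[of n x]) auto

lemma t2_Suc_stable: "t2 n x < \<infinity> \<Longrightarrow> t2 (Suc n) x = t2 n x"
  by (cases rule: t2_Suc_cases[of n x]) auto

lemma t1_stable: "\<lbrakk>t1 n x < \<infinity>; n \<le> k\<rbrakk> \<Longrightarrow> t1 k x = t1 n x"
  by (rotate_tac 1, induction k rule: dec_induct) (use t1_Suc_stable in auto)

lemma t2_stable: "\<lbrakk>t2 n x < \<infinity>; n \<le> k\<rbrakk> \<Longrightarrow> t2 k x = t2 n x"
  by (rotate_tac 1, induction k rule: dec_induct) (use t2_Suc_stable in auto)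

lemma t1_antimono: "n \<le> k \<Longrightarrow> t1 k x \<le> t1 n x"
  using t1_stable[of n x k] by (cases "t1 n x = \<infinity>") (auto simp: less_top)

lemma t2_antimono: "n \<le> k \<Longrightarrow> t2 k x \<le> t2 n x"
  using t2_stable[of n x k] by (cases "t2 n x = \<infinity>") (auto simp: less_top)

lemma T1_le: "T1 x \<le> t1 n x"
  unfolding type1_time_def by (rule INF_lower) simp

lemma T2_le: "T2 x \<le> t2 n x"
  unfolding type2_time_def by (rule INF_lower) simp

lemma T1_eq: assumes "t1 n x < \<infinity>" shows "T1 x = t1 n x"
proof (rule antisym[OF T1_le])
  show "t1 n x \<le> T1 x"
    unfolding type1_time_def
    using t1_stable[OF assms] t1_antimono by (intro INF_greatest) (metis nle_le)
qed

lemma T2_eq: assumes "t2 n x < \<infinity>" shows "T2 x = t2 n x"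
proof (rule antisym[OF T2_le])
  show "t2 n x \<le> T2 x"
    unfolding type2_time_def
    using t2_stable[OF assms] t2_antimono by (intro INF_greatest) (metis nle_le)
qed

lemma T1_finite: assumes "T1 x < \<infinity>" obtains n where "t1 n x < \<infinity>" "T1 x = t1 n x"
  using assms T1_eq unfolding type1_time_def by (metis INF_less_iff)

lemma T2_finite: assumes "T2 x < \<infinity>" obtains n where "t2 n x < \<infinity>" "T2 x = t2 n x"
  using assms T2_eq unfolding type2_time_def by (metis INF_less_iff)

lemma T2_nonneg: "0 \<le> T2 x"
  unfolding type2_time_def using t2_nonneg by (auto intro!: INF_greatest)

lemma t2_first:
  assumes "t2 n x < \<infinity>"
  obtains k where "k < n" "t2 k x = \<infinity>" "t2 (Suc k) x < \<infinity>" "T2 x = ev k"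
proof -
  have "\<exists>k<n. t2 k x = \<infinity> \<and> t2 (Suc k) x < \<infinity>"
    using assms
  proof (induction n)
    case (Suc n)
    then show ?case by (cases "t2 n x = \<infinity>") (auto simp: less_Suc_eq)
  qed (simp add: t2_0)
  then obtain k where k: "k < n" "t2 k x = \<infinity>" "t2 (Suc k) x < \<infinity>" by blast
  then have "T2 x = ev k"
    using T2_eq[OF k(3)] by (cases rule: t2_Suc_cases[of k x]) auto
  with k that show ?thesis by blast
qed

lemma T2_ge: assumes "t2 k x = \<infinity>" shows "ev k \<le> T2 x"
proof (cases "T2 x < \<infinity>")
  case True
  then obtain n where "t2 n x < \<infinity>" by (rule T2_finite)
  then obtain j where j: "t2 j x = \<infinity>" "t2 (Suc j) x < \<infinity>" "T2 x = ev j" by (rule t2_first)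
  have "k \<le> j"
    using t2_stable[OF j(2), of k] assms j(2) by (metis not_less_eq_eq ereal_infty_less(1))
  with j ev_mono show ?thesis by simp
qed auto

text \<open>At the event that infects \<open>x\<close>, neither \<open>x\<close> nor its infector
  \<open>u\<close> is of type 2; monotone event times turn this into the two inequalities with
  \<open>T2\<close>.\<close>

lemma t1_first:
  assumes "t1 n x < \<infinity>" "x \<noteq> v0"
  obtains k u where "k < n" "t1 k x = \<infinity>" "t2 k x = \<infinity>" "T1 x = ev k" "adj u x"
    "t2 k u = \<infinity>" "t1 k u < \<infinity>" "T1 x = T1 u + \<omega> (Spread1 u x)" "T1 x \<le> T2 u" "T1 x \<le> T2 x"
    "t1 (Suc k) x < \<infinity>"
proof -
  have "\<exists>k<n. t1 k x = \<infinity> \<and> t1 (Suc k) x < \<infinity>"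
    using assms
  proof (induction n)
    case (Suc n)
    then show ?case by (cases "t1 n x = \<infinity>") (auto simp: less_Suc_eq)
  qed (simp add: t1_0)
  then obtain k where k: "k < n" "t1 k x = \<infinity>" "t1 (Suc k) x < \<infinity>" by blast
  show ?thesis
  proof (cases rule: t1_Suc_cases[of k x])
    case 1
    with k show ?thesis by simp
  next
    case (2 u)
    then have "T1 x = ev k" "T1 u = t1 k u" using T1_eq[OF k(3)] T1_eq[of k u] by simp_all
    with that[OF k(1,2), of u] k(3) 2 T2_ge[of k u] T2_ge[of k x] show ?thesis by simp
  qed
qed

text \<open>Trace the infectors of \<open>w\<close> back in time. The infection that crosses time
  \<open>t\<close> starts at a site infected by time \<open>t\<close> and still of type 1 at the
  later event, hence of type 1 at time \<open>t\<close>.\<close>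

lemma type1_before:
  fixes t :: real
  assumes "t1 n w < \<infinity>" "0 \<le> t" "t < t1 n w"
  shows "\<exists>x. T1 x \<le> t \<and> t < T2 x"
  using assms
proof (induction n arbitrary: w)
  case 0
  then show ?case by (auto simp: t1_0 zero_ereal_def split: if_splits)
next
  case (Suc n)
  show ?case
  proof (cases rule: t1_Suc_cases[of n w])
    case 1
    with Suc show ?thesis by auto
  next
    case (2 u)
    show ?thesis
    proof (cases "t < t1 n u")
      case True
      with Suc.IH[of u] Suc.prems 2 show ?thesis by blast
    next
      case False
      then have "T1 u \<le> t" using T1_eq[of n u] 2 by auto
      moreover have "t < T2 u" using T2_ge[of n u] 2 Suc.prems by auto
      ultimately show ?thesis by blast
    qed
  qed
qed

lemma survives_iff_at: "type1_survives adj v0 \<omega> \<longleftrightarrow> (\<forall>t::real\<ge>0. \<exists>x. T1 x \<le> t \<and> t < T2 x)"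
proof -
  have "{x. site_at adj v0 \<omega> t x = Type1} = {x. T1 x \<le> t \<and> t < T2 x}" for t
    by (auto simp: site_at_def)
  then show ?thesis by (simp add: type1_survives_def)
qed

text \<open>
  Since type 1 cannot reappear after extinction, integer times suffice; this turns survival into a
  countable combination of events.
\<close>

lemma survives_iff_nat:
  "type1_survives adj v0 \<omega> \<longleftrightarrow> (\<forall>n::nat. \<exists>x. T1 x \<le> ereal (real n) \<and> ereal (real n) < T2 x)"
  unfolding survives_iff_at
proof (intro iffI allI impI)
  fix t :: real assume all: "\<forall>n::nat. \<exists>x. T1 x \<le> ereal (real n) \<and> ereal (real n) < T2 x" and t: "0 \<le> t"
  obtain n :: nat where n: "t \<le> real n" using real_arch_simple by blast
  with all obtain x where x: "T1 x \<le> real n" "real n < T2 x" by blast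
  show "\<exists>x. T1 x \<le> t \<and> t < T2 x"
  proof (cases "T1 x \<le> t")
    case True
    moreover have "t < T2 x" using x(2) n by (meson ereal_less_eq(3) order_le_less_trans)
    ultimately show ?thesis by blast
  next
    case False
    moreover have "T1 x < \<infinity>" using x(1) by (rule le_less_trans) simp
    then obtain k where "t1 k x < \<infinity>" "T1 x = t1 k x" by (rule T1_finite)
    ultimately show ?thesis using type1_before[of k x t] t by auto
  qed
qed auto

text \<open>Covers histories that end, for instance by explosion, before some type 1 site is
  converted. Afterwards one may assume that every type 1 site has a finite
  \<open>T2\<close>.\<close>

lemma survives_if_stuck:
  assumes "T1 x < \<infinity>" "T2 x = \<infinity>"
  shows "type1_survives adj v0 \<omega>"
  unfolding survives_iff_at
proof (intro allI impI)
  fix t :: real assume "0 \<le> t"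
  obtain k where k: "t1 k x < \<infinity>" "T1 x = t1 k x" by (rule T1_finite[OF assms(1)])
  show "\<exists>x. T1 x \<le> t \<and> t < T2 x"
  proof (cases "T1 x \<le> t")
    case True
    then show ?thesis using assms(2) by (intro exI[of _ x]) simp
  next
    case False
    then show ?thesis using type1_before[of k x t] \<open>0 \<le> t\<close> k by auto
  qed
qed

lemma survives_if_unbounded:
  assumes "\<And>t::real. \<exists>x. t < T1 x \<and> T1 x < \<infinity>"
  shows "type1_survives adj v0 \<omega>"
  unfolding survives_iff_at
proof (intro allI impI)
  fix t :: real assume t: "0 \<le> t"
  obtain x where x: "t < T1 x" "T1 x < \<infinity>" using assms by blast
  obtain k where "t1 k x < \<infinity>" "T1 x = t1 k x" by (rule T1_finite[OF x(2)])
  then show "\<exists>x. T1 x \<le> t \<and> t < T2 x"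
    using type1_before[of k x t] t x by auto
qed

end

section \<open>Survival from breeding vertices\<close>

context rooted_tree
begin

definition down1 :: "('v clock \<Rightarrow> real) \<Rightarrow> 'v \<Rightarrow> real" where
  "down1 \<omega> w = \<omega> (Spread1 (par w) w)"

definition down2 :: "('v clock \<Rightarrow> real) \<Rightarrow> 'v \<Rightarrow> real" where
  "down2 \<omega> w = \<omega> (Spread2 (par w) w)"

definition up2 :: "('v clock \<Rightarrow> real) \<Rightarrow> 'v \<Rightarrow> real" where
  "up2 \<omega> w = \<omega> (Spread2 w (par w))"

definition fast :: "('v clock \<Rightarrow> real) \<Rightarrow> 'v \<Rightarrow> real" where
  "fast \<omega> w = min (down1 \<omega> w) (down2 \<omega> w)"

text \<open>
  The pair of steps from \<open>par (par u)\<close> to \<open>u\<close>, with type 2 starting at the parent of \<open>par (par u)\<close>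
  when type 1 starts at \<open>par (par u)\<close>. The bounds by \<open>N\<close> keep all passage times comparable to \<open>n\<close>.
\<close>

definition block :: "real \<Rightarrow> ('v clock \<Rightarrow> real) \<Rightarrow> 'v \<Rightarrow> bool" where
  "block N \<omega> u \<longleftrightarrow>
     down1 \<omega> (par u) < down2 \<omega> (par (par u)) \<and>
     down1 \<omega> (par u) + down1 \<omega> u < down2 \<omega> (par (par u)) + down2 \<omega> (par u) \<and>
     1 / N \<le> down1 \<omega> u \<and> down1 \<omega> u \<le> N \<and> 1 / N \<le> down1 \<omega> (par u) \<and> down1 \<omega> (par u) \<le> N"

definition good :: "real \<Rightarrow> nat \<Rightarrow> ('v clock \<Rightarrow> real) \<Rightarrow> 'v \<Rightarrow> bool" where
  "good N n \<omega> y \<longleftrightarrow> (\<forall>i<n. block N \<omega> ((par ^^ (2 * i)) y))"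

text \<open>
  Time is counted from the infection of the \<open>2n\<close>-th ancestor of \<open>y\<close>. The lower bound on the
  passage time and the last condition ensure that type 2 does not return from \<open>y\<close> to its parent before
  time \<open>M\<close>.
\<close>

definition sel :: "real \<Rightarrow> nat \<Rightarrow> nat \<Rightarrow> ('v clock \<Rightarrow> real) \<Rightarrow> 'v \<Rightarrow> bool" where
  "sel N n M \<omega> y \<longleftrightarrow> good N n \<omega> y \<and>
     real M - 1 \<le> psum (down1 \<omega>) (2 * n) y \<and> psum (down1 \<omega>) (2 * n) y < real M \<and> 1 < up2 \<omega> y"

text \<open>
  \<open>psum (fast \<omega>) k w\<close> bounds from below the time after which \<open>w\<close> is occupied at all, so a conversion
  at \<open>w\<close> can only happen before time \<open>M\<close> if the inequality holds.
\<close>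

definition bad :: "nat \<Rightarrow> 'v \<Rightarrow> 'v set \<Rightarrow> ('v clock \<Rightarrow> real) \<Rightarrow> bool" where
  "bad M x S \<omega> \<longleftrightarrow>
     (\<exists>k. \<exists>w\<in>desc k x. (\<forall>s\<in>S. w \<notin> below s) \<and> psum (fast \<omega>) k w + \<omega> (Convert w) \<le> real M)"

definition selset :: "real \<Rightarrow> nat \<Rightarrow> nat \<Rightarrow> 'v \<Rightarrow> ('v clock \<Rightarrow> real) \<Rightarrow> 'v set" where
  "selset N n M x \<omega> = {y \<in> desc (2 * n) x. sel N n M \<omega> y}"

text \<open>\<open>j\<close> generations of the embedded branching process; it survives if this
  holds for all \<open>j\<close>. \<open>M\<close> is a function because the window is found by
  pigeonhole at each vertex separately.\<close>

fun breeds :: "real \<Rightarrow> nat \<Rightarrow> ('v \<Rightarrow> nat) \<Rightarrow> nat \<Rightarrow> 'v \<Rightarrow> ('v clock \<Rightarrow> real) \<Rightarrow> bool" where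
  "breeds N n M 0 x \<omega> = True"
| "breeds N n M (Suc j) x \<omega> =
     (\<not> bad (M x) x (selset N n (M x) x \<omega>) \<omega> \<and> (\<exists>y\<in>selset N n (M x) x \<omega>. breeds N n M j y \<omega>))"

lemma breeds_antimono: "breeds N n M (Suc j) x \<omega> \<Longrightarrow> breeds N n M j x \<omega>"
proof (induction j arbitrary: x)
  case (Suc j)
  then show ?case by (metis breeds.simps(2))
qed simp

lemma good_Suc: "good N (Suc n) \<omega> y \<longleftrightarrow> block N \<omega> y \<and> good N n \<omega> (par (par y))"
  unfolding good_def by (auto simp: less_Suc_eq_0_disj funpow_swap1)

text \<open>Let \<open>x\<close> be the \<open>2 * n\<close>-th ancestor of \<open>y\<close>. Both
  sums run over \<open>2 * n - j\<close> edges: type 1 goes from \<open>x\<close> to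
  \<open>(par ^^ j) y\<close>, type 2 from \<open>par x\<close> to the parent of
  \<open>(par ^^ j) y\<close>. So type 1 has crossed the edge before type 2 reaches its upper end.
  Each block provides this after its first and second step, and the leads of successive blocks add
  up.\<close>

lemma good_chase:
  assumes "good N n \<omega> y" "j < 2 * n"
  shows "psum (down1 \<omega>) (2 * n - j) ((par ^^ j) y) < psum (down2 \<omega>) (2 * n - j) ((par ^^ Suc j) y)"
  using assms
proof (induction n arbitrary: y j)
  case (Suc n)
  let ?z = "par (par y)"
  from Suc.prems have b: "block N \<omega> y" and g: "good N n \<omega> ?z" by (auto simp: good_Suc)
  \<comment> \<open>Weak inequality, to include \<open>n = 0\<close>, where both sums are
    empty.\<close>
  have z: "psum (down1 \<omega>) (2 * n) ?z \<le> psum (down2 \<omega>) (2 * n) (par ?z)"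
    using Suc.IH[OF g, of 0] by (cases n) auto
  consider "j = 0" | "j = 1" | i where "j = Suc (Suc i)"
    by (metis One_nat_def not0_implies_Suc)
  then show ?case
  proof cases
    case 1
    then show ?thesis using b z by (auto simp: psum_Suc block_def)
  next
    case 2
    then show ?thesis using b z by (auto simp: psum_Suc block_def)
  next
    case 3
    then show ?thesis using Suc.IH[OF g, of i] Suc.prems(2) by (simp add: funpow_swap1)
  qed
qed simp

lemma psum_add: "psum f (j + k) w = psum f j w + psum f k ((par ^^ j) w)"
  by (induction j arbitrary: w) (simp_all add: psum_Suc funpow_swap1)

lemma psum_nonneg: "(\<And>w. 0 \<le> f w) \<Longrightarrow> 0 \<le> psum f k w"
  unfolding psum_def by (simp add: sum_nonneg)

lemma good_le: "good N n \<omega> y \<Longrightarrow> psum (down1 \<omega>) (2 * n) y \<le> 2 * real n * N"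
proof (induction n arbitrary: y)
  case (Suc n)
  then have "psum (down1 \<omega>) (2 * n) (par (par y)) \<le> 2 * real n * N"
    "down1 \<omega> y \<le> N" "down1 \<omega> (par y) \<le> N"
    by (auto simp: good_Suc block_def)
  then show ?case by (simp add: psum_Suc algebra_simps)
qed simp

text \<open>The purpose of the lower bound \<open>1 / N\<close> in \<open>block\<close>: each
  generation takes at least this long, so many generations mean late infections.\<close>

lemma good_ge:
  assumes "good N n \<omega> y" "\<And>c. 0 < \<omega> c" "0 < n"
  shows "1 / N \<le> psum (down1 \<omega>) (2 * n) y"
proof -
  obtain k where n: "n = Suc k" using assms(3) by (cases n) auto
  have "0 \<le> psum (down1 \<omega>) (2 * k) (par (par y))" "0 \<le> down1 \<omega> (par y)"
    using assms(2) by (auto intro!: psum_nonneg simp: down1_def less_imp_le)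
  then show ?thesis using assms(1) by (auto simp: n good_Suc psum_Suc block_def)
qed

end

section \<open>Occupation times below the starting vertex\<close>

locale tree_process = rooted_tree adj root par level m + positive_clocks adj v0 \<omega>
  for adj :: "'v \<Rightarrow> 'v \<Rightarrow> bool" and root par level m v0 \<omega> +
  assumes v0: "v0 \<noteq> root"
begin

abbreviation nonvac :: "nat \<Rightarrow> 'v \<Rightarrow> ereal" where "nonvac n w \<equiv> min (t1 n w) (t2 n w)"

lemma down_pos: "0 < down1 \<omega> w" "0 < down2 \<omega> w" "0 < fast \<omega> w"
  using pos by (auto simp: down1_def down2_def fast_def)

lemma fast_le: "fast \<omega> w \<le> down1 \<omega> w" "fast \<omega> w \<le> down2 \<omega> w"
  by (auto simp: fast_def)

lemma adj_below_cases:
  assumes "adj u w" "w \<in> below v0"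
  obtains "u = par w" | "u \<in> below v0" "u \<noteq> v0" "par u = w" "u \<noteq> root"
proof -
  have "u \<noteq> v0" if "par u = w" "u \<noteq> root"
    using child_not_below[of v0] v0 assms(2) that by auto
  then show ?thesis
    using assms that below_child[of u v0] by (auto simp: adj_iff)
qed

lemma nonvac_Suc: "nonvac (Suc n) w \<le> nonvac n w"
  using t1_antimono[of n "Suc n" w] t2_antimono[of n "Suc n" w] by (auto simp: min_le_iff_disj)

text \<open>Initially only \<open>v0\<close> is occupied, so a site strictly below it is first
  entered from its parent, through one of the two downward clocks. A conversion, or an arrival from
  a child, presupposes by induction that \<open>w\<close> is already occupied.\<close>

lemma nonvac_par:
  assumes "w \<in> below v0" "w \<noteq> v0"
  shows "nonvac n (par w) + fast \<omega> w \<le> nonvac n w"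
  using assms
proof (induction n arbitrary: w)
  case 0
  then show ?case by (simp add: t1_0 t2_0)
next
  case (Suc n)
  let ?l = "nonvac n (par w) + fast \<omega> w"
  note IH = Suc.IH[OF Suc.prems]
  have up: "nonvac n w \<le> nonvac n u" if "par u = w" "u \<in> below v0" "u \<noteq> v0" for u
  proof -
    have "nonvac n w + 0 \<le> nonvac n w + fast \<omega> u"
      using less_imp_le[OF down_pos(3)[of u]] by (intro add_left_mono) simp
    with Suc.IH[of u] that show ?thesis by auto
  qed
  have conv: "nonvac n w \<le> z + ereal (\<omega> c)" if "nonvac n w \<le> z" for z c
    using add_mono[OF that, of 0 "ereal (\<omega> c)"] less_imp_le[OF pos[of c]] by simp
  have 1: "?l \<le> t1 (Suc n) w"
  proof (cases rule: t1_Suc_cases[of n w])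
    case 1
    with IH show ?thesis by simp
  next
    case (2 u)
    from \<open>adj u w\<close> Suc.prems(1) show ?thesis
    proof (cases rule: adj_below_cases)
      case 1
      have "?l \<le> t1 n (par w) + ereal (down1 \<omega> w)"
        using fast_le(1)[of w] by (intro add_mono) auto
      with 1 2 show ?thesis by (simp add: down1_def)
    next
      case c: 2
      have "nonvac n w \<le> t1 n u + ereal (\<omega> (Spread1 u w))"
        by (rule conv) (use up[of u] c in auto)
      with IH 2 show ?thesis by (metis order_trans)
    qed
  qed
  have 2: "?l \<le> t2 (Suc n) w"
  proof (cases rule: t2_Suc_cases[of n w])
    case 1
    with IH show ?thesis by simp
  next
    case 2
    have "nonvac n w \<le> t1 n w + ereal (\<omega> (Convert w))"
      by (rule conv) auto
    with IH 2 show ?thesis by (metis order_trans)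
  next
    case (3 u)
    from \<open>adj u w\<close> Suc.prems(1) show ?thesis
    proof (cases rule: adj_below_cases)
      case 1
      have "?l \<le> t2 n (par w) + ereal (down2 \<omega> w)"
        using fast_le(2)[of w] by (intro add_mono) auto
      with 1 3 show ?thesis by (simp add: down2_def)
    next
      case c: 2
      have "nonvac n w \<le> t2 n u + ereal (\<omega> (Spread2 u w))"
        by (rule conv) (use up[of u] c in auto)
      with IH 3 show ?thesis by (metis order_trans)
    qed
  qed
  have "nonvac (Suc n) (par w) + fast \<omega> w \<le> ?l"
    by (intro add_right_mono nonvac_Suc)
  with 1 2 show ?case by auto
qed

lemma vacant_child:
  assumes "w \<in> below v0" "w \<noteq> v0" "t1 n (par w) = \<infinity>" "t2 n (par w) = \<infinity>"
  shows "t1 n w = \<infinity>" "t2 n w = \<infinity>"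
  using nonvac_par[OF assms(1,2), of n] assms(3,4) by auto

lemma min_T_par:
  assumes "w \<in> below v0" "w \<noteq> v0"
  shows "min (T1 (par w)) (T2 (par w)) + fast \<omega> w \<le> min (T1 w) (T2 w)"
proof -
  have le: "min (T1 (par w)) (T2 (par w)) + fast \<omega> w \<le> nonvac n w" for n
  proof -
    have "min (T1 (par w)) (T2 (par w)) \<le> nonvac n (par w)"
      using T1_le T2_le by (intro min.mono)
    then have "min (T1 (par w)) (T2 (par w)) + fast \<omega> w \<le> nonvac n (par w) + fast \<omega> w"
      by (rule add_right_mono)
    also note nonvac_par[OF assms]
    finally show ?thesis .
  qed
  show ?thesis
    unfolding type1_time_def[of _ _ _ w] type2_time_def[of _ _ _ w]
    using le by (auto intro!: INF_greatest)
qed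

lemma T1_v0: "T1 v0 = 0"
  using T1_eq[of 0 v0] by (simp add: t1_0)

text \<open>The infector is the parent: as long as \<open>w\<close> is vacant, so are its
  children.\<close>

lemma T1_par:
  assumes "w \<in> below v0" "w \<noteq> v0" "T1 w < \<infinity>"
  shows "T1 w = T1 (par w) + down1 \<omega> w" "T1 w \<le> T2 (par w)" "T1 (par w) < \<infinity>"
proof -
  obtain n where "t1 n w < \<infinity>" by (rule T1_finite[OF assms(3)])
  from this assms(2) obtain k u where u: "t1 k w = \<infinity>" "t2 k w = \<infinity>" "adj u w"
    "t1 k u < \<infinity>" "T1 w = T1 u + \<omega> (Spread1 u w)" "T1 w \<le> T2 u"
    by (rule t1_first)
  have "u = par w"
    using u(3) assms(1)
  proof (cases rule: adj_below_cases)
    case 2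
    with vacant_child[of u k] u show ?thesis by auto
  qed
  with u T1_eq[of k u] show "T1 w = T1 (par w) + down1 \<omega> w" "T1 w \<le> T2 (par w)" "T1 (par w) < \<infinity>"
    by (auto simp: down1_def)
qed

lemma T1_le_T2: assumes "T1 w < \<infinity>" shows "T1 w \<le> T2 w"
proof (cases "w = v0")
  case False
  obtain n where "t1 n w < \<infinity>" by (rule T1_finite[OF assms])
  from this False show ?thesis by (rule t1_first)
qed (simp add: T1_v0 T2_nonneg)

text \<open>The worst case of the overview in the form used below: type 2 is not at the parent
  before \<open>w\<close> is infected.\<close>

lemma T1_le_T2_par: "\<lbrakk>w \<in> below v0; T1 w < \<infinity>\<rbrakk> \<Longrightarrow> T1 w \<le> T2 (par w)"
  using T1_par(2) T1_v0 T2_nonneg by (cases "w = v0") auto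

text \<open>
  The process may explode, in which case pending infections are never executed. The assumption that
  \<open>par v\<close> is eventually of type 2 ensures that the history covers the time of the attempt.
\<close>

lemma T1_child_finite:
  assumes "v \<in> below v0" "v \<noteq> v0" "T1 (par v) + down1 \<omega> v < T2 (par v)" "T2 (par v) < \<infinity>"
  shows "T1 v < \<infinity>"
proof (rule ccontr)
  assume inf: "\<not> T1 v < \<infinity>"
  let ?u = "par v"
  have adj: "adj ?u v" using par_below[OF assms(1,2)] by (auto simp: adj_iff)
  have t1v: "t1 k v = \<infinity>" for k using T1_eq[of k v] inf by auto
  obtain n where "t2 n ?u < \<infinity>" by (rule T2_finite[OF assms(4)])
  then obtain j where j: "t2 j ?u = \<infinity>" "t2 (Suc j) ?u < \<infinity>" "T2 ?u = ev j" by (rule t2_first)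
  have "T1 ?u < \<infinity>"
    using assms(3,4) less_trans by (cases "T1 ?u") auto
  then obtain i where i: "t1 i ?u < \<infinity>" "T1 ?u = t1 i ?u" by (rule T1_finite)
  have "T1 ?u < T2 ?u"
    using assms(3) add_mono[of "T1 ?u" "T1 ?u" 0 "ereal (down1 \<omega> v)"] down_pos(1)[of v]
    by (auto simp: less_imp_le)
  have t1u: "t1 j ?u < \<infinity>"
  proof (cases "?u = v0")
    case True
    then show ?thesis using t1_stable[of 0 v0 j] by (simp add: t1_0)
  next
    case False
    from i(1) False obtain k where k: "T1 ?u = ev k" "t1 (Suc k) ?u < \<infinity>"
      by (rule t1_first)
    then have "k < j"
      using \<open>T1 ?u < T2 ?u\<close> j(3) ev_mono[of j k] by (metis leD not_le)
    then show ?thesis using t1_stable[OF k(2), of j] k(2) by simp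
  qed
  \<comment> \<open>Event \<open>j\<close> turns the parent into type 2. If \<open>v\<close> is not
    of type 2 then, its pending infection is due before \<open>ev j\<close>. If it is, it took type
    2 from its conversion (but it never was of type 1), its parent (not yet of type 2) or a child
    (still vacant): all impossible.\<close>
  show False
  proof (cases "t2 j v = \<infinity>")
    case True
    then have "ev j \<le> t1 j ?u + \<omega> (Spread1 ?u v)"
      using ev_le1[of j v ?u] t1v adj j(1) by blast
    also have "\<dots> = T1 ?u + down1 \<omega> v"
      using T1_eq[OF t1u] by (simp add: down1_def)
    finally show False using assms(3) j(3) by simp
  next
    case False
    then have "t2 j v < \<infinity>" by simp
    then obtain k where k: "k < j" "t2 k v = \<infinity>" "t2 (Suc k) v < \<infinity>" by (rule t2_first)
    show False
    proof (cases rule: t2_Suc_cases[of k v])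
      case 1
      with k show ?thesis by simp
    next
      case 2
      with t1v show ?thesis by simp
    next
      case (3 w)
      from \<open>adj w v\<close> assms(1) show ?thesis
      proof (cases rule: adj_below_cases)
        case 1
        with 3 k(1) j(1) t2_stable[of k w j] show ?thesis by auto
      next
        case 2
        with vacant_child[of w k] t1v k(2) 3 show ?thesis by auto
      qed
    qed
  qed
qed

end

lemma ereal_add_le_trans:
  fixes T :: ereal
  shows "\<lbrakk>ereal a + ereal b \<le> T; c \<le> a + b\<rbrakk> \<Longrightarrow> ereal c \<le> T"
  by (cases T) auto

context tree_process
begin

lemma T1_desc:
  assumes "x \<in> below v0" "w \<in> desc k x" "T1 w < \<infinity>"
  shows "T1 w = T1 x + psum (down1 \<omega>) k w"
  using assms(2,3)
proof (induction k arbitrary: w)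
  case (Suc k)
  then have w: "par w \<in> desc k x" "w \<noteq> root" by (auto simp: desc_Suc)
  have b: "w \<in> below v0" using Suc.prems(1) assms(1) below_trans desc_below by blast
  have "w \<noteq> v0"
    using w(1) assms(1) below_trans desc_below child_not_below[OF v0] by metis
  note p = T1_par[OF b this Suc.prems(2)]
  show ?case using Suc.IH[OF w(1) p(3)] p(1)
    by (cases "T1 x") (simp_all add: psum_Suc)
qed simp

lemma nonvac_desc:
  assumes "x \<in> below v0" "w \<in> desc k x"
  shows "min (T1 x) (T2 x) + psum (fast \<omega>) k w \<le> min (T1 w) (T2 w)"
  using assms(2)
proof (induction k arbitrary: w)
  case (Suc k)
  then have w: "par w \<in> desc k x" "w \<noteq> root" by (auto simp: desc_Suc)
  have b: "w \<in> below v0" using Suc.prems(1) assms(1) below_trans desc_below by blast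
  have "w \<noteq> v0"
    using w(1) assms(1) below_trans desc_below child_not_below[OF v0] by metis
  have "min (T1 x) (T2 x) + psum (fast \<omega>) (Suc k) w
      = min (T1 x) (T2 x) + psum (fast \<omega>) k (par w) + fast \<omega> w"
    by (cases "min (T1 x) (T2 x)") (simp_all add: psum_Suc)
  also have "\<dots> \<le> min (T1 (par w)) (T2 (par w)) + fast \<omega> w"
    by (intro add_right_mono Suc.IH w)
  also note min_T_par[OF b \<open>w \<noteq> v0\<close>]
  finally show ?case .
qed simp

lemma t2_source:
  assumes "t2 n w < \<infinity>"
  obtains (conv) k where "k < n" "T1 w < \<infinity>" "T2 w = T1 w + \<omega> (Convert w)"
  | (spread) k u where "k < n" "adj u w" "t2 k u < \<infinity>" "T2 w = T2 u + \<omega> (Spread2 u w)"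
proof -
  obtain k where k: "k < n" "t2 k w = \<infinity>" "t2 (Suc k) w < \<infinity>" "T2 w = ev k"
    using assms by (rule t2_first)
  show ?thesis
  proof (cases rule: t2_Suc_cases[of k w])
    case 1
    with k show ?thesis by simp
  next
    case 2
    with k conv[of k] T1_eq[of k w] show ?thesis by simp
  next
    case (3 u)
    with k spread[of k u] T2_eq[of k u] show ?thesis by simp
  qed
qed

section \<open>One generation: every kept endpoint is infected on time\<close>

context
  fixes x :: 'v and t M :: real and K :: nat and S :: "'v set"
  assumes x: "x \<in> below v0" "T1 x = ereal t"
    and K: "0 < K" and S: "S \<subseteq> desc K x"
    and chase: "\<And>s j. \<lbrakk>s \<in> S; j < K\<rbrakk> \<Longrightarrow>
      psum (down1 \<omega>) (K - j) ((par ^^ j) s) < psum (down2 \<omega>) (K - j) ((par ^^ Suc j) s)"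
    and window: "\<And>s. s \<in> S \<Longrightarrow> M - 1 \<le> psum (down1 \<omega>) K s \<and> psum (down1 \<omega>) K s < M"
    and up: "\<And>s. s \<in> S \<Longrightarrow> 1 < up2 \<omega> s"
    and calm: "\<And>k w. \<lbrakk>w \<in> desc k x; \<forall>s\<in>S. w \<notin> below s\<rbrakk> \<Longrightarrow> M < psum (fast \<omega>) k w + \<omega> (Convert w)"
begin

lemma T_x_le: "ereal t \<le> min (T1 x) (T2 x)" "ereal t \<le> T2 (par x)"
  using x T1_le_T2[of x] T1_le_T2_par[of x] by auto

lemma par_not_below_S:
  assumes "s \<in> S" "0 < j" "j \<le> K" "s' \<in> S"
  shows "(par ^^ j) s \<notin> below s'"
proof
  assume "(par ^^ j) s \<in> below s'"
  then have "level s' \<le> level ((par ^^ j) s)" by (rule level_below)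
  moreover have "(par ^^ j) s \<in> desc (K - j) x" "s' \<in> desc K x"
    using assms S par_funpow_desc[of s K x j] by auto
  ultimately show False using assms(2,3) by (auto simp: desc_def)
qed

text \<open>
  Before time \<open>t + M\<close>, the only type 2 sites outside the subtrees of \<open>S\<close> come straight down from the
  parent of \<open>x\<close>.
\<close>

lemma T2_lower:
  assumes "t2 n w < \<infinity>"
  shows "w \<in> desc k x \<Longrightarrow> \<forall>s\<in>S. w \<notin> below s \<Longrightarrow>
      t + min M (psum (down2 \<omega>) (Suc k) w) \<le> T2 w"
    and "w \<in> S \<Longrightarrow> t + (M - 1) \<le> T2 w"
  using assms
\<comment> \<open>The source of a type 2 arrival is recorded in an earlier history, hence strong
  induction on the index. Both claims go together: sites outside may be entered from
  \<open>S\<close> and sites of \<open>S\<close> from outside.\<close>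
proof (induction n arbitrary: w k rule: less_induct)
  case (less n)
  {
    case 1
    have b: "w \<in> below v0" using 1(1) x(1) below_trans desc_below by blast
    show ?case
      using 1(3)
    proof (cases rule: t2_source)
      case (conv i)
      have "ereal t + psum (fast \<omega>) k w \<le> min (T1 x) (T2 x) + psum (fast \<omega>) k w"
        using T_x_le(1) by (rule add_right_mono)
      also have "\<dots> \<le> T1 w"
        using nonvac_desc[OF x(1) 1(1)] by simp
      finally have "ereal t + psum (fast \<omega>) k w + \<omega> (Convert w) \<le> T2 w"
        unfolding conv(3) by (rule add_right_mono)
      then have "ereal (t + psum (fast \<omega>) k w + \<omega> (Convert w)) \<le> T2 w" by simp
      moreover have "t + min M (psum (down2 \<omega>) (Suc k) w) \<le> t + psum (fast \<omega>) k w + \<omega> (Convert w)"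
        using calm[OF 1(1,2)] by simp
      ultimately show ?thesis by (meson ereal_less_eq(3) order_trans)
    next
      case (spread i u)
      from \<open>adj u w\<close> b show ?thesis
      proof (cases rule: adj_below_cases)
        case u: 1
        show ?thesis
        proof (cases k)
          case 0
          then have "w = x" using 1(1) by simp
          then have "ereal t + down2 \<omega> w \<le> T2 w"
            unfolding spread(4) u(1) down2_def using T_x_le(2) \<open>w = x\<close> by (intro add_right_mono) simp
          moreover have "t + min M (psum (down2 \<omega>) (Suc k) w) \<le> t + down2 \<omega> w"
            by (simp add: 0 psum_Suc)
          ultimately show ?thesis
            by (rule ereal_add_le_trans)
        next
          case (Suc k')
          then have p: "par w \<in> desc k' x" "w \<noteq> root" using 1(1) by (auto simp: desc_Suc)
          have "\<forall>s\<in>S. par w \<notin> below s" using 1(2) p(2) below_child by blast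
          from less(1)[OF spread(1) p(1) this] spread(3) u
          have "ereal (t + min M (psum (down2 \<omega>) k (par w))) \<le> T2 (par w)" by (simp add: Suc)
          then have "ereal (t + min M (psum (down2 \<omega>) k (par w))) + down2 \<omega> w \<le> T2 w"
            unfolding spread(4) u(1) down2_def by (rule add_right_mono)
          moreover have "t + min M (psum (down2 \<omega>) (Suc k) w)
              \<le> t + min M (psum (down2 \<omega>) k (par w)) + down2 \<omega> w"
            using down_pos(2)[of w] by (auto simp: psum_Suc min_def)
          ultimately show ?thesis
            by (rule ereal_add_le_trans)
        qed
      next
        case u: 2
        show ?thesis
        proof (cases "u \<in> S")
          case True
          have "ereal (t + (M - 1)) \<le> T2 u"
            using less(2)[OF spread(1) True spread(3)] .
          then have "ereal (t + (M - 1)) + \<omega> (Spread2 u w) \<le> T2 w"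
            unfolding spread(4) by (rule add_right_mono)
          moreover have "1 < \<omega> (Spread2 u w)" using up[OF True] u(3) by (simp add: up2_def)
          then have "t + min M (psum (down2 \<omega>) (Suc k) w) \<le> t + (M - 1) + \<omega> (Spread2 u w)"
            by simp
          ultimately show ?thesis
            by (rule ereal_add_le_trans)
        next
          case False
          have ud: "u \<in> desc (Suc k) x" using u 1(1) by (simp add: desc_Suc)
          have "\<forall>s\<in>S. u \<notin> below s"
            using 1(2) False par_below u(3) by metis
          from less(1)[OF spread(1) ud this spread(3)]
          have "ereal (t + min M (psum (down2 \<omega>) (Suc (Suc k)) u)) \<le> T2 u" .
          then have "ereal (t + min M (psum (down2 \<omega>) (Suc (Suc k)) u)) + \<omega> (Spread2 u w) \<le> T2 w"
            unfolding spread(4) by (rule add_right_mono)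
          moreover have "t + min M (psum (down2 \<omega>) (Suc k) w)
              \<le> t + min M (psum (down2 \<omega>) (Suc (Suc k)) u) + \<omega> (Spread2 u w)"
            using down_pos(2)[of u] pos[of "Spread2 u w"] u(3)
            by (simp add: psum_Suc[of _ "Suc k" u] min_def)
          ultimately show ?thesis
            by (rule ereal_add_le_trans)
        qed
      qed
    qed
  next
    case 2
    have wd: "w \<in> desc K x" using S 2(1) by auto
    have b: "w \<in> below v0" using wd x(1) below_trans desc_below by blast
    have T1w: "ereal (t + (M - 1)) \<le> T1 w"
    proof (cases "T1 w < \<infinity>")
      case True
      then show ?thesis using T1_desc[OF x(1) wd True] window[OF 2(1)] x(2) by simp
    qed auto
    show ?case
      using 2(2)
    proof (cases rule: t2_source)
      case (conv i)
      then show ?thesis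
        using add_mono[OF T1w, of 0 "ereal (\<omega> (Convert w))"] less_imp_le[OF pos] by simp
    next
      case (spread i u)
      from \<open>adj u w\<close> b show ?thesis
      proof (cases rule: adj_below_cases)
        case u: 1
        obtain k' where K': "K = Suc k'" using K by (cases K) auto
        have p: "par w \<in> desc k' x" using wd by (simp add: K' desc_Suc)
        have "\<forall>s\<in>S. par w \<notin> below s" using par_not_below_S[OF 2(1), of 1] K by simp
        from less(1)[OF spread(1) p this] spread(3) u
        have "ereal (t + min M (psum (down2 \<omega>) K (par w))) \<le> T2 (par w)" by (simp add: K')
        also have "\<dots> \<le> T2 w"
          using u spread(4) add_left_mono[of 0 "ereal (\<omega> (Spread2 u w))" "T2 u"] less_imp_le[OF pos]
          by simp
        finally have "ereal (t + min M (psum (down2 \<omega>) K (par w))) \<le> T2 w" .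
        moreover have "t + (M - 1) \<le> t + min M (psum (down2 \<omega>) K (par w))"
          using chase[OF 2(1), of 0] K window[OF 2(1)] by simp
        ultimately show ?thesis by (meson ereal_less_eq(3) order_trans)
      next
        case u: 2
        have ub: "u \<in> below v0" "u \<noteq> v0" using u by auto
        have "min (T1 w) (T2 w) + fast \<omega> u \<le> T2 u"
          using min_T_par[OF ub] u(3) by simp
        moreover have "T2 u < \<infinity>" using T2_eq[OF spread(3)] spread(3) by simp
        ultimately have *: "min (T1 w) (T2 w) + fast \<omega> u + \<omega> (Spread2 u w) \<le> T2 w" "T2 w < \<infinity>"
          by (auto simp: spread(4) intro: add_right_mono)
        \<comment> \<open>The child \<open>u\<close> was occupied only after \<open>w\<close>. If
          \<open>w\<close> had started as type 2, it would have received type 2 from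
          \<open>u\<close> strictly after \<open>T2 w\<close>.\<close>
        have "T1 w \<le> T2 w"
        proof (rule ccontr)
          assume "\<not> T1 w \<le> T2 w"
          then have "T2 w + fast \<omega> u + \<omega> (Spread2 u w) \<le> T2 w" using *(1) by (simp add: min_def)
          moreover have "0 < fast \<omega> u + \<omega> (Spread2 u w)" using down_pos pos by (simp add: add_pos_pos)
          ultimately show False
            using *(2) T2_nonneg[of w] by (cases "T2 w") auto
        qed
        with T1w show ?thesis by (rule order_trans)
      qed
    qed
  }
qed

text \<open>Walk down from \<open>x\<close> to \<open>s\<close>. Each attempt is made before time
  \<open>t + M\<close> by \<open>window\<close>, and before type 2 can arrive straight from
  \<open>par x\<close> by \<open>chase\<close>; by \<open>T2_lower\<close> the infecting site is
  then still of type 1. \<open>conv\<close> supplies the finite \<open>T2\<close> that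
  \<open>T1_child_finite\<close> asks for.\<close>

lemma T1_selected:
  assumes s: "s \<in> S" and conv: "\<And>u. T1 u < \<infinity> \<Longrightarrow> T2 u < \<infinity>"
  shows "T1 s = ereal (t + psum (down1 \<omega>) K s)"
proof -
  have sd: "s \<in> desc K x" using s S by auto
  have step: "T1 ((par ^^ (K - i)) s) < \<infinity>" if "i \<le> K" for i
    using that
  proof (induction i)
    case 0
    then show ?case using sd x(2) by (simp add: desc_def)
  next
    case (Suc i)
    define j where "j = K - Suc i"
    have j: "j < K" "K - i = Suc j" "K - j = Suc i" "K - Suc j = i" using Suc.prems by (auto simp: j_def)
    let ?v = "(par ^^ j) s"
    have v: "?v \<in> desc (Suc i) x" "par ?v \<in> desc i x"
      using par_funpow_desc[OF sd, of j] par_funpow_desc[OF sd, of "Suc j"] j Suc.prems by auto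
    have fin: "T1 (par ?v) < \<infinity>" using Suc j by simp
    then obtain n where n: "t2 n (par ?v) < \<infinity>" using conv T2_finite by metis
    have "T1 (par ?v) + down1 \<omega> ?v < T2 (par ?v)"
    proof -
      have nb: "\<forall>s\<in>S. par ?v \<notin> below s"
        using par_not_below_S[OF s, of "Suc j"] j by auto
      have "T1 (par ?v) + down1 \<omega> ?v = ereal (t + psum (down1 \<omega>) (K - j) ?v)"
        using T1_desc[OF x(1) v(2) fin] x(2) j by (simp add: psum_Suc)
      also have "\<dots> < T2 (par ?v)"
      proof -
        have "0 \<le> psum (down1 \<omega>) j s"
          using down_pos(1) by (simp add: psum_nonneg less_imp_le)
        then have "psum (down1 \<omega>) (K - j) ?v < M"
          using window[OF s] psum_add[of "down1 \<omega>" j "K - j" s] j(1) by simp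
        then have "t + psum (down1 \<omega>) (K - j) ?v < t + min M (psum (down2 \<omega>) (Suc i) (par ?v))"
          using chase[OF s j(1)] j by simp
        then have "ereal (t + psum (down1 \<omega>) (K - j) ?v)
            < ereal (t + min M (psum (down2 \<omega>) (Suc i) (par ?v)))" by simp
        also note T2_lower(1)[OF n v(2) nb]
        finally show ?thesis .
      qed
      finally show ?thesis .
    qed
    moreover have "?v \<noteq> v0"
      using v(2) x(1) below_trans desc_below child_not_below[OF v0] by metis
    moreover have "?v \<in> below v0" using v(1) x(1) below_trans desc_below by blast
    ultimately have "T1 ?v < \<infinity>"
      using T1_child_finite conv fin by blast
    then show ?case by (simp add: j_def)
  qed
  from step[of K] have "T1 s < \<infinity>" by simp
  from T1_desc[OF x(1) sd this] x(2) show ?thesis by simp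
qed

end

lemma selected_infected:
  assumes x: "x \<in> below v0" "T1 x = ereal t" and n: "0 < n"
    and S: "S = selset N n M x \<omega>" and calm: "\<not> bad M x S \<omega>" and y: "y \<in> S"
    and conv: "\<And>u. T1 u < \<infinity> \<Longrightarrow> T2 u < \<infinity>"
  shows "T1 y = ereal (t + psum (down1 \<omega>) (2 * n) y)"
proof (rule T1_selected[where M = "real M" and S = S])
  show "psum (down1 \<omega>) (2 * n - j) ((par ^^ j) s) < psum (down2 \<omega>) (2 * n - j) ((par ^^ Suc j) s)"
    if "s \<in> S" "j < 2 * n" for s j
    using that good_chase[of N n \<omega> s j] by (simp add: S selset_def sel_def)
  show "real M < psum (fast \<omega>) k w + \<omega> (Convert w)"
    if "w \<in> desc k x" "\<forall>s\<in>S. w \<notin> below s" for k w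
    using calm that by (metis bad_def not_le)
qed (use assms in \<open>auto simp: selset_def sel_def\<close>)

lemma breeds_late:
  assumes "breeds N n M j x \<omega>" "x \<in> below v0" "T1 x = ereal t" "0 < n"
    and "\<And>u. T1 u < \<infinity> \<Longrightarrow> T2 u < \<infinity>"
  shows "\<exists>y s. T1 y = ereal s \<and> t + real j / N \<le> s"
  using assms(1-3)
proof (induction j arbitrary: x t)
  case (Suc j)
  then obtain y where y: "y \<in> selset N n (M x) x \<omega>" "breeds N n M j y \<omega>"
    and calm: "\<not> bad (M x) x (selset N n (M x) x \<omega>) \<omega>" by auto
  let ?s = "t + psum (down1 \<omega>) (2 * n) y"
  have T: "T1 y = ereal ?s"
    using selected_infected[OF Suc.prems(2,3) assms(4) refl calm y(1) assms(5)] .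
  have "y \<in> below v0"
    using y(1) desc_below below_trans[OF _ Suc.prems(2)] unfolding selset_def by blast
  from Suc.IH[OF y(2) this T] obtain z s where z: "T1 z = ereal s" "?s + real j / N \<le> s" by blast
  have "1 / N \<le> psum (down1 \<omega>) (2 * n) y"
    using y(1) good_ge[of N n \<omega> y] pos assms(4) by (auto simp: selset_def sel_def)
  with z show ?case by (intro exI[of _ z] exI[of _ s]) (simp add: add_divide_distrib)
qed auto

text \<open>Either some type 1 site stays type 1 forever, or all of them convert and
  \<open>breeds_late\<close> produces infections after any given time.\<close>

lemma survives_if_breeds:
  assumes "\<And>j. breeds N n M j v0 \<omega>" "0 < n" "0 < N"
  shows "type1_survives adj v0 \<omega>"
proof (cases "\<exists>u. T1 u < \<infinity> \<and> T2 u = \<infinity>")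
  case True
  then show ?thesis using survives_if_stuck by blast
next
  case False
  then have conv: "T2 u < \<infinity>" if "T1 u < \<infinity>" for u using that by auto
  show ?thesis
  proof (rule survives_if_unbounded)
    fix t :: real
    obtain j :: nat where j: "t * N < real j" using reals_Archimedean2 by blast
    obtain y s where "T1 y = ereal s" "0 + real j / N \<le> s"
      using breeds_late[OF assms(1)[of j] self_below _ assms(2) conv, of 0] T1_v0
      by (metis zero_ereal_def)
    moreover have "t < real j / N" using j assms(3) by (simp add: field_simps)
    ultimately show "\<exists>x. t < T1 x \<and> T1 x < \<infinity>" by (intro exI[of _ y]) simp
  qed
qed

end

section \<open>Exponential clocks\<close>

definition expo :: "real \<Rightarrow> real measure" where
  "expo r = density lborel (exponential_density r)"

lemma space_expo [simp]: "space (expo r) = UNIV"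
  and sets_expo [simp, measurable_cong]: "sets (expo r) = sets borel"
  by (simp_all add: expo_def)

lemma prob_space_expo: "0 < r \<Longrightarrow> prob_space (expo r)"
  unfolding expo_def by (rule prob_space_exponential_density)

lemma measure_expo_le:
  assumes "0 < r" "0 \<le> s"
  shows "measure (expo r) {..s} = 1 - exp (- (r * s))"
  using emeasure_erlang_density[of r 0 s] assms
  by (simp add: expo_def measure_def erlang_CDF_0)

lemma measure_expo_gt:
  assumes "0 < r" "0 \<le> s"
  shows "measure (expo r) {s<..} = exp (- (r * s))"
proof -
  interpret prob_space "expo r" using assms by (intro prob_space_expo)
  have "measure (expo r) {s<..} = 1 - measure (expo r) {..s}"
    using prob_compl[of "{..s}"] by (simp add: Compl_eq_Diff_UNIV[symmetric])
  then show ?thesis using measure_expo_le[OF assms] by simp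
qed

lemma measure_expo_interval:
  assumes "0 < r" "0 \<le> u" "u \<le> v"
  shows "measure (expo r) {u<..v} = exp (- (r * u)) - exp (- (r * v))"
proof -
  interpret prob_space "expo r" using assms by (intro prob_space_expo)
  have "{u<..v} = {..v} - {..u}" by auto
  then have "measure (expo r) {u<..v} = measure (expo r) {..v} - measure (expo r) {..u}"
    using assms by (simp add: finite_measure_Diff)
  then show ?thesis using assms by (simp add: measure_expo_le)
qed

lemma AE_expo_pos: "0 < r \<Longrightarrow> AE x in expo r. 0 < x"
proof -
  assume r: "0 < r"
  interpret prob_space "expo r" using r by (rule prob_space_expo)
  have "measure (expo r) {0<..} = 1" using measure_expo_gt[OF r, of 0] by simp
  then have "AE x in expo r. x \<in> {0<..}" by (subst (asm) prob_eq_1) auto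
  then show ?thesis by simp
qed

lemma laplace_expo:
  assumes "0 < r" "0 \<le> \<theta>"
  shows "(\<integral>\<^sup>+x. ennreal (exp (- \<theta> * x)) \<partial>expo r) = ennreal (r / (r + \<theta>))"
proof -
  interpret E: prob_space "expo (r + \<theta>)" using assms by (intro prob_space_expo) simp
  have "(\<integral>\<^sup>+x. ennreal (exp (- \<theta> * x)) \<partial>expo r)
      = (\<integral>\<^sup>+x. ennreal (exponential_density r x) * ennreal (exp (- \<theta> * x)) \<partial>lborel)"
    unfolding expo_def by (subst nn_integral_density) auto
  also have "\<dots> = (\<integral>\<^sup>+x. ennreal (r / (r + \<theta>)) * ennreal (exponential_density (r + \<theta>) x) \<partial>lborel)"
  proof (intro nn_integral_cong)
    fix x :: real
    have "exponential_density r x * exp (- \<theta> * x) = r / (r + \<theta>) * exponential_density (r + \<theta>) x"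
    proof (cases "x < 0")
      case False
      have "r / (r + \<theta>) * ((r + \<theta>) * exp (- x * (r + \<theta>))) = r * exp (- x * (r + \<theta>))"
        using assms by simp
      moreover have "exp (- x * (r + \<theta>)) = exp (- x * r) * exp (- \<theta> * x)"
        by (simp add: exp_add[symmetric] algebra_simps)
      ultimately have "r * exp (- x * r) * exp (- \<theta> * x)
          = r / (r + \<theta>) * ((r + \<theta>) * exp (- x * (r + \<theta>)))"
        by (simp only: mult.assoc)
      then show ?thesis
        using False by (simp only: exponential_density_def if_False)
    qed (simp add: exponential_density_def)
    then show "ennreal (exponential_density r x) * ennreal (exp (- \<theta> * x))
        = ennreal (r / (r + \<theta>)) * ennreal (exponential_density (r + \<theta>) x)"
      using assms by (simp add: ennreal_mult[symmetric] exponential_density_nonneg)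
  qed
  also have "\<dots> = ennreal (r / (r + \<theta>)) * (\<integral>\<^sup>+x. ennreal (exponential_density (r + \<theta>) x) \<partial>lborel)"
    by (rule nn_integral_cmult) auto
  also have "(\<integral>\<^sup>+x. ennreal (exponential_density (r + \<theta>) x) \<partial>lborel) = emeasure (expo (r + \<theta>)) UNIV"
    unfolding expo_def by (subst emeasure_density) auto
  also have "\<dots> = 1" using E.emeasure_space_1 by simp
  finally show ?thesis by simp
qed

text \<open>The events determined by the clocks in \<open>J\<close>, as a sigma-algebra on the whole
  configuration space, so that independence for disjoint sets of clocks can be expressed by
  \<open>indep_sets\<close>.\<close>

definition coords :: "'i set \<Rightarrow> ('i \<Rightarrow> real) measure" where
  "coords J = vimage_algebra UNIV (\<lambda>\<omega>. restrict \<omega> J) (PiM J (\<lambda>_. borel))"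

lemma space_coords [simp]: "space (coords J) = UNIV"
  by (simp add: coords_def)

lemma measurable_coord:
  assumes "c \<in> J" shows "(\<lambda>\<omega>. \<omega> c) \<in> borel_measurable (coords J)"
proof -
  have "(\<lambda>\<omega>. restrict \<omega> J) \<in> measurable (coords J) (PiM J (\<lambda>_. borel))"
    unfolding coords_def by (rule measurable_vimage_algebra1) (auto simp: space_PiM)
  from measurable_compose[OF this measurable_component_singleton[OF assms]] assms
  show ?thesis by simp
qed

lemma sets_coords_subset:
  assumes "space M = UNIV" "\<And>c. c \<in> J \<Longrightarrow> (\<lambda>\<omega>. \<omega> c) \<in> borel_measurable M"
  shows "sets (coords J) \<subseteq> sets M"
  unfolding coords_def
  by (intro sets_image_in_sets[OF assms(1)] measurable_restrict assms(2))

lemma sets_coords_mono: "J \<subseteq> K \<Longrightarrow> sets (coords J) \<subseteq> sets (coords K)"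
  by (rule sets_coords_subset) (auto intro: measurable_coord)

locale exponential_clocks =
  fixes rate :: "'i \<Rightarrow> real"
  assumes rate_pos: "\<And>c. 0 < rate c"
begin

text \<open>The product measure before completion: all events are first shown measurable here, and
  only survival itself is transferred to the completion.\<close>

definition P :: "('i \<Rightarrow> real) measure" where
  "P = PiM UNIV (\<lambda>c. expo (rate c))"

sublocale prod: product_prob_space "\<lambda>c. expo (rate c)" UNIV
proof -
  have "product_prob_space (\<lambda>c. expo (rate c))"
    unfolding product_prob_space_def product_sigma_finite_def product_prob_space_axioms_def
    using prob_space_expo[OF rate_pos] prob_space_imp_sigma_finite by blast
  then show "product_prob_space (\<lambda>c. expo (rate c))" .
qed

sublocale prob_space P
  unfolding P_def by (rule prod.P.prob_space_axioms)

lemma space_P [simp]: "space P = UNIV"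
  by (simp add: P_def space_PiM)

lemma measurable_P: "(\<lambda>\<omega>. \<omega> c) \<in> borel_measurable P"
  unfolding P_def
  by (subst measurable_cong_sets[OF refl sets_expo[symmetric, of "rate c"]])
    (rule measurable_component_singleton, simp)

lemma sets_coords_P: "sets (coords J) \<subseteq> sets P"
  by (rule sets_coords_subset) (auto intro: measurable_P)

lemma distr_coord: "distr P borel (\<lambda>\<omega>. \<omega> c) = expo (rate c)"
proof -
  have "distr P borel (\<lambda>\<omega>. \<omega> c) = distr P (expo (rate c)) (\<lambda>\<omega>. \<omega> c)"
    by (rule distr_cong) auto
  then show ?thesis unfolding P_def using prod.PiM_component[of c] by simp
qed

lemma prob_coord: "A \<in> sets borel \<Longrightarrow> prob {\<omega>. \<omega> c \<in> A} = measure (expo (rate c)) A"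
  unfolding distr_coord[symmetric]
  by (subst measure_distr[OF measurable_P]) (auto simp: vimage_def)

lemma nn_integral_coord:
  "f \<in> borel_measurable borel \<Longrightarrow> (\<integral>\<^sup>+\<omega>. f (\<omega> c) \<partial>P) = (\<integral>\<^sup>+x. f x \<partial>expo (rate c))"
  unfolding distr_coord[symmetric] by (subst nn_integral_distr[OF measurable_P]) auto

lemma AE_coord_pos: "AE \<omega> in P. 0 < \<omega> c"
  unfolding P_def using prod.AE_component[of c] AE_expo_pos[OF rate_pos] by simp

lemma AE_pos: "countable (UNIV :: 'i set) \<Longrightarrow> AE \<omega> in P. \<forall>c. 0 < \<omega> c"
proof -
  assume c: "countable (UNIV :: 'i set)"
  have "AE \<omega> in P. \<forall>c\<in>UNIV. 0 < \<omega> c"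
    using AE_coord_pos by (subst AE_ball_countable[OF c]) auto
  then show ?thesis by simp
qed

lemma indep_vars_coord: "indep_vars (\<lambda>_. borel) (\<lambda>c \<omega>. \<omega> c) UNIV"
proof (subst indep_vars_iff_distr_eq_PiM)
  have "PiM UNIV (\<lambda>c. distr P borel (\<lambda>\<omega>. \<omega> c)) = P"
    unfolding distr_coord by (simp add: P_def)
  moreover have "distr P (PiM UNIV (\<lambda>_. borel)) (\<lambda>x. \<lambda>i\<in>UNIV. x i) = distr P P (\<lambda>x. x)"
    by (rule distr_cong) (auto simp: P_def intro!: sets_PiM_cong)
  ultimately show "distr P (PiM UNIV (\<lambda>_. borel)) (\<lambda>x. \<lambda>i\<in>UNIV. x i)
      = PiM UNIV (\<lambda>c. distr P borel (\<lambda>\<omega>. \<omega> c))" by simp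
qed (auto intro: measurable_P)

lemma indep_coords:
  assumes "disjoint_family_on J I"
  shows "indep_sets (\<lambda>i. sets (coords (J i))) I"
proof -
  have "indep_vars (\<lambda>j. PiM (J j) (\<lambda>_. borel)) (\<lambda>j \<omega>. restrict (\<lambda>i. \<omega> i) (J j)) I"
    by (rule indep_vars_restrict[OF indep_vars_coord _ assms]) simp
  then show ?thesis
    unfolding indep_vars_def coords_def sets_vimage_algebra by simp
qed

lemma prob_INT:
  assumes "finite I" "disjoint_family_on J I" "\<And>i. i \<in> I \<Longrightarrow> A i \<in> sets (coords (J i))"
  shows "prob (\<Inter>i\<in>I. A i) = (\<Prod>i\<in>I. prob (A i))"
proof (cases "I = {}")
  case True
  then show ?thesis using prob_space by simp
next
  case False
  with assms show ?thesis by (intro indep_setsD[OF indep_coords]) auto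
qed

lemma nn_integral_prod_coords:
  assumes "finite I" "disjoint_family_on J I" "\<And>i. i \<in> I \<Longrightarrow> f i \<in> borel_measurable (coords (J i))"
  shows "(\<integral>\<^sup>+\<omega>. (\<Prod>i\<in>I. f i \<omega>) \<partial>P) = (\<Prod>i\<in>I. \<integral>\<^sup>+\<omega>. f i \<omega> \<partial>P)"
proof (rule indep_vars_nn_integral[OF assms(1)])
  have m: "f i \<in> borel_measurable P" if "i \<in> I" for i
    using measurable_mono[of borel borel "coords (J i)" P] assms(3)[OF that] sets_coords_P[of "J i"]
    by (auto simp: measurable_def)
  have "indep_sets (\<lambda>i. {f i -` A \<inter> space P |A. A \<in> sets borel}) I"
    using measurable_sets[OF assms(3)]
    by (intro indep_sets_mono_sets[OF indep_coords[OF assms(2)]]) auto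
  then show "indep_vars (\<lambda>_. borel) f I"
    unfolding indep_vars_def2 using m by auto
qed auto

end

text \<open>The integrand is at most 1, so cutting off \<open>u\<close> below \<open>1 / N\<close>
  and above \<open>N\<close> costs at most the probabilities \<open>1 - exp (- (1 / N))\<close> and
  \<open>exp (- N)\<close>.\<close>

lemma truncated_laplace:
  assumes "0 < r" "0 < N"
  defines "g \<equiv> \<lambda>u. indicator {1 / N..N} u * ennreal (exp (- r * u))"
  shows "ennreal (1 / (1 + r) - (1 - exp (- (1 / N))) - exp (- N)) \<le> (\<integral>\<^sup>+u. g u \<partial>expo 1)"
proof -
  interpret E: prob_space "expo 1" by (rule prob_space_expo) simp
  have [measurable]: "g \<in> borel_measurable borel" unfolding g_def by measurable
  let ?A = "{..1 / N}" and ?B = "{N<..}"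
  have "ennreal (1 / (1 + r)) = (\<integral>\<^sup>+u. ennreal (exp (- r * u)) \<partial>expo 1)"
    using laplace_expo[of 1 r] assms(1) by simp
  also have "\<dots> \<le> (\<integral>\<^sup>+u. g u + indicator ?A u + indicator ?B u \<partial>expo 1)"
  proof (rule nn_integral_mono_AE)
    show "AE u in expo 1. ennreal (exp (- r * u)) \<le> g u + indicator ?A u + indicator ?B u"
      using AE_expo_pos[OF zero_less_one]
    proof eventually_elim
      case (elim u)
      then have le1: "ennreal (exp (- r * u)) \<le> 1" using assms(1) by simp
      show ?case
      proof (cases "u \<in> {1 / N..N}")
        case False
        then have "1 \<le> indicator ?A u + (indicator ?B u :: ennreal)"
          by (auto simp: indicator_def)
        with le1 show ?thesis
          by (metis False add.left_neutral g_def indicator_simps(2) mult_zero_left order_trans)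
      qed (simp add: g_def add.assoc)
    qed
  qed
  also have "\<dots> = (\<integral>\<^sup>+u. g u \<partial>expo 1) + emeasure (expo 1) ?A + emeasure (expo 1) ?B"
    by (simp add: nn_integral_add)
  also have "\<dots> = (\<integral>\<^sup>+u. g u \<partial>expo 1) + ennreal ((1 - exp (- (1 / N))) + exp (- N))"
    using assms(2) measure_expo_le[of 1 "1 / N"] measure_expo_gt[of 1 N]
    by (simp add: E.emeasure_eq_measure add.assoc)
  finally have "ennreal (1 / (1 + r)) \<le> (\<integral>\<^sup>+u. g u \<partial>expo 1) + ennreal ((1 - exp (- (1 / N))) + exp (- N))" .
  then have "ennreal (1 / (1 + r)) - ennreal ((1 - exp (- (1 / N))) + exp (- N)) \<le> (\<integral>\<^sup>+u. g u \<partial>expo 1)"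
    by (simp add: ennreal_minus_le_iff add.commute)
  moreover have "ennreal (1 / (1 + r)) - ennreal ((1 - exp (- (1 / N))) + exp (- N))
      = ennreal (1 / (1 + r) - (1 - exp (- (1 / N))) - exp (- N))"
  proof (subst ennreal_minus)
    show "0 \<le> (1 - exp (- (1 / N))) + exp (- N)"
      using assms(2) by (intro add_nonneg_nonneg) auto
  qed (simp add: diff_diff_eq)
  ultimately show ?thesis by simp
qed

text \<open>Integrate over \<open>b\<close> first: given the other two clocks, \<open>b\<close>
  exceeds their sum with probability \<open>exp (- rate b * (a + a'))\<close>. This factorises,
  leaving the product of two truncated Laplace transforms.\<close>

lemma (in exponential_clocks) prob_sum_less:
  fixes N :: real
  assumes dist: "distinct [a, a', b]" and N: "0 < N" and rate: "rate a = 1" "rate a' = 1"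
  defines "L \<equiv> 1 / (1 + rate b) - (1 - exp (- (1 / N))) - exp (- N)"
  assumes L: "0 \<le> L"
  shows "L\<^sup>2 \<le> prob {\<omega>. \<omega> a \<in> {1 / N..N} \<and> \<omega> a' \<in> {1 / N..N} \<and> \<omega> a + \<omega> a' < \<omega> b}"
proof -
  let ?M = "\<lambda>c. expo (rate c)"
  let ?I = "{a, a'}" and ?J = "insert b {a, a'}"
  define g where "g u = indicator {1 / N..N} u * ennreal (exp (- rate b * u))" for u
  have [measurable]: "g \<in> borel_measurable borel" unfolding g_def by measurable
  define R where "R = {\<omega> :: 'i \<Rightarrow> real. \<omega> a \<in> {1 / N..N} \<and> \<omega> a' \<in> {1 / N..N} \<and> \<omega> a + \<omega> a' < \<omega> b}"
  have coordJ: "(\<lambda>\<omega>. \<omega> c) \<in> borel_measurable (PiM ?J ?M)" if "c \<in> ?J" for c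
    by (subst measurable_cong_sets[OF refl sets_expo[symmetric, of "rate c"]])
      (rule measurable_component_singleton[OF that])
  have Rm: "R \<inter> space Q \<in> sets Q"
    if "\<And>c. c \<in> ?J \<Longrightarrow> (\<lambda>\<omega>. \<omega> c) \<in> borel_measurable Q" for Q
  proof -
    have [measurable]: "(\<lambda>\<omega>. \<omega> a) \<in> borel_measurable Q" "(\<lambda>\<omega>. \<omega> a') \<in> borel_measurable Q"
      "(\<lambda>\<omega>. \<omega> b) \<in> borel_measurable Q"
      using that by auto
    have "R \<inter> space Q = {\<omega> \<in> space Q. \<omega> a \<in> {1 / N..N} \<and> \<omega> a' \<in> {1 / N..N} \<and> \<omega> a + \<omega> a' < \<omega> b}"
      by (auto simp: R_def)
    also have "\<dots> \<in> sets Q" by measurable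
    finally show ?thesis .
  qed
  have m: "(indicator R :: _ \<Rightarrow> ennreal) \<in> borel_measurable (PiM ?J ?M)"
    unfolding borel_measurable_indicator_iff by (intro Rm coordJ)
  have "ennreal (L\<^sup>2) = (ennreal L)\<^sup>2"
    using L by (simp add: ennreal_power)
  also have "\<dots> \<le> (\<Prod>c\<in>?I. \<integral>\<^sup>+u. g u \<partial>?M c)"
  proof -
    have "ennreal L \<le> (\<integral>\<^sup>+u. g u \<partial>expo 1)"
      unfolding L_def g_def by (rule truncated_laplace[OF rate_pos N])
    then show ?thesis using dist rate by (simp add: power2_eq_square mult_mono)
  qed
  also have "\<dots> = (\<integral>\<^sup>+x. (\<Prod>c\<in>?I. g (x c)) \<partial>PiM ?I ?M)"
  proof -
    have "g \<in> borel_measurable (?M c)" for c by measurable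
    then show ?thesis by (intro prod.product_nn_integral_prod[symmetric]) auto
  qed
  also have "\<dots> \<le> (\<integral>\<^sup>+x. (\<integral>\<^sup>+y. indicator R (x(b := y)) \<partial>?M b) \<partial>PiM ?I ?M)"
  proof (rule nn_integral_mono)
    fix x :: "'i \<Rightarrow> real"
    show "(\<Prod>c\<in>?I. g (x c)) \<le> (\<integral>\<^sup>+y. indicator R (x(b := y)) \<partial>?M b)"
    proof (cases "x a \<in> {1 / N..N} \<and> x a' \<in> {1 / N..N}")
      case True
      then have "0 \<le> x a" "0 \<le> x a'" using N by (auto intro: order_trans[rotated])
      have "(\<integral>\<^sup>+y. indicator R (x(b := y)) \<partial>?M b) = (\<integral>\<^sup>+y. indicator {x a + x a'<..} y \<partial>?M b)"
        using True dist by (intro nn_integral_cong) (auto simp: R_def indicator_def)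
      also have "\<dots> = ennreal (exp (- (rate b * (x a + x a'))))"
        using measure_expo_gt[OF rate_pos, of "x a + x a'" b] \<open>0 \<le> x a\<close> \<open>0 \<le> x a'\<close>
        by (simp add: prod.M.emeasure_eq_measure)
      also have "\<dots> = (\<Prod>c\<in>?I. g (x c))"
        using True dist by (simp add: g_def ennreal_mult[symmetric] exp_add[symmetric] algebra_simps)
      finally show ?thesis by simp
    next
      case False
      then have "(\<Prod>c\<in>?I. g (x c)) = 0" using dist by (auto simp: g_def)
      then show ?thesis by (simp only: zero_le)
    qed
  qed
  also have "\<dots> = (\<integral>\<^sup>+x. indicator R x \<partial>PiM ?J ?M)"
    using dist by (intro prod.product_nn_integral_insert[symmetric] m) auto
  also have "\<dots> = (\<integral>\<^sup>+x. indicator R x \<partial>distr (PiM UNIV ?M) (PiM ?J ?M) (\<lambda>f. restrict f ?J))"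
    using distr_PiM_reindex[of UNIV ?M "\<lambda>c. c" ?J] prob_space_expo[OF rate_pos]
    by (simp add: restrict_def)
  also have "\<dots> = (\<integral>\<^sup>+\<omega>. indicator R (restrict \<omega> ?J) \<partial>P)"
    unfolding P_def
    by (rule nn_integral_distr) (use m in \<open>simp_all add: measurable_restrict_subset\<close>)
  also have "\<dots> = (\<integral>\<^sup>+\<omega>. indicator R \<omega> \<partial>P)"
    by (intro nn_integral_cong) (auto simp: R_def indicator_def)
  also have "\<dots> = ennreal (prob R)"
  proof -
    have "R \<in> sets P" using Rm[of P] measurable_P by simp
    then show ?thesis by (simp add: emeasure_eq_measure)
  qed
  finally show ?thesis unfolding R_def by simp
qed

text \<open>
  Type 1 wins a pair of steps if \<open>a\<^sub>1 + a\<^sub>2 < b\<^sub>0\<close>, which has probability \<open>(1 / (1 + r))\<^sup>2\<close>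
  and is exactly borderline at \<open>r = 1\<close>. Truncating \<open>a\<^sub>1\<close> and \<open>a\<^sub>2\<close> to \<open>[1 / N, N]\<close> replaces
  \<open>1 / (1 + r)\<close> by at least \<open>trunc r N\<close>; the strict surplus comes from the disjoint event
  \<open>1/2 < a\<^sub>1 \<le> 1 < b\<^sub>0 \<le> 2 < a\<^sub>2 \<le> 3 < b\<^sub>1\<close> of probability \<open>extra r\<close>.
\<close>

definition extra :: "real \<Rightarrow> real" where
  "extra r = (exp (- (1 / 2)) - exp (- 1)) * (exp (- 2) - exp (- 3)) *
     (exp (- r) - exp (- (2 * r))) * exp (- (3 * r))"

definition trunc :: "real \<Rightarrow> real \<Rightarrow> real" where
  "trunc r N = 1 / (1 + r) - (1 - exp (- (1 / N))) - exp (- N)"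

lemma (in exponential_clocks) prob_block:
  fixes N :: real
  assumes dist: "distinct [a, a', b, b']" and N: "4 \<le> N"
    and rate: "rate a = 1" "rate a' = 1" "rate b' = rate b"
    and L: "0 \<le> trunc (rate b) N"
  shows "(trunc (rate b) N)\<^sup>2 + extra (rate b)
    \<le> prob {\<omega>. \<omega> a < \<omega> b \<and> \<omega> a + \<omega> a' < \<omega> b + \<omega> b' \<and>
        1 / N \<le> \<omega> a' \<and> \<omega> a' \<le> N \<and> 1 / N \<le> \<omega> a \<and> \<omega> a \<le> N}" (is "_ \<le> prob ?B")
proof -
  have [measurable]: "(\<lambda>\<omega>. \<omega> c) \<in> borel_measurable P" for c by (rule measurable_P)
  define E1 where "E1 = {\<omega> :: 'i \<Rightarrow> real. \<omega> a \<in> {1 / N..N} \<and> \<omega> a' \<in> {1 / N..N} \<and> \<omega> a + \<omega> a' < \<omega> b}"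
  define D :: "'i \<Rightarrow> real set" where
    "D c = (if c = a then {1 / 2<..1} else if c = a' then {2<..3} else if c = b then {1<..2} else {3<..})" for c
  define E2 where "E2 = (\<Inter>c\<in>{a, a', b, b'}. {\<omega> :: 'i \<Rightarrow> real. \<omega> c \<in> D c})"
  have [measurable]: "D c \<in> sets borel" for c by (simp add: D_def)
  have "E1 = {\<omega> \<in> space P. \<omega> a \<in> {1 / N..N} \<and> \<omega> a' \<in> {1 / N..N} \<and> \<omega> a + \<omega> a' < \<omega> b}"
    by (simp add: E1_def)
  also have "\<dots> \<in> sets P" by measurable
  finally have E1 [measurable]: "E1 \<in> sets P" .
  have "E2 = (\<Inter>c\<in>{a, a', b, b'}. {\<omega> \<in> space P. \<omega> c \<in> D c})"
    by (simp add: E2_def)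
  also have "\<dots> \<in> sets P"
  proof (intro sets.finite_INT)
    show "{\<omega> \<in> space P. \<omega> c \<in> D c} \<in> sets P" for c :: 'i by measurable
  qed auto
  finally have E2 [measurable]: "E2 \<in> sets P" .
  have "?B = {\<omega> \<in> space P. \<omega> a < \<omega> b \<and> \<omega> a + \<omega> a' < \<omega> b + \<omega> b' \<and>
        1 / N \<le> \<omega> a' \<and> \<omega> a' \<le> N \<and> 1 / N \<le> \<omega> a \<and> \<omega> a \<le> N}" by simp
  also have "\<dots> \<in> sets P" by measurable
  finally have B: "?B \<in> sets P" .
  have p1: "(trunc (rate b) N)\<^sup>2 \<le> prob E1"
    unfolding E1_def trunc_def
    by (rule prob_sum_less) (use dist N rate L in \<open>auto simp: trunc_def\<close>)
  have "prob E2 = (\<Prod>c\<in>{a, a', b, b'}. prob {\<omega>. \<omega> c \<in> D c})"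
    unfolding E2_def
  proof (rule prob_INT[where J = "\<lambda>c. {c}"])
    fix c :: 'i
    have [measurable]: "(\<lambda>\<omega>. \<omega> c) \<in> borel_measurable (coords {c})" by (rule measurable_coord) simp
    have "{\<omega>. \<omega> c \<in> D c} = {\<omega> \<in> space (coords {c}). \<omega> c \<in> D c}" by simp
    also have "\<dots> \<in> sets (coords {c})" by measurable
    finally show "{\<omega>. \<omega> c \<in> D c} \<in> sets (coords {c})" .
  qed (auto simp: disjoint_family_on_def)
  also have "\<dots> = (\<Prod>c\<in>{a, a', b, b'}. measure (expo (rate c)) (D c))"
    by (intro prod.cong prob_coord) auto
  also have "\<dots> = extra (rate b)"
  proof -
    have "D a = {1 / 2<..1}" "D a' = {2<..3}" "D b = {1<..2}" "D b' = {3<..}"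
      using dist by (auto simp: D_def)
    then show ?thesis
      using dist rate rate_pos[of b]
      by (simp add: measure_expo_interval measure_expo_gt extra_def mult_ac)
  qed
  finally have p2: "prob E2 = extra (rate b)" .
  \<comment> \<open>\<open>4 \<le> N\<close> puts the ranges of \<open>a\<close> and
    \<open>a'\<close> in \<open>E2\<close> inside \<open>[1 / N, N]\<close>. On \<open>E2\<close>
    the sum of these two clocks exceeds 5/2 while \<open>b\<close> is at most 2, so
    \<open>E1\<close> cannot occur.\<close>
  have "1 / N \<le> 1 / 4" using N by (simp add: field_simps)
  have disj: "E1 \<inter> E2 = {}"
    using dist by (auto simp: E1_def E2_def D_def)
  have "prob (E1 \<union> E2) \<le> prob ?B"
  \<comment> \<open>Only almost surely: on \<open>E1\<close> the second inequality of the block also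
    needs \<open>b'\<close> to be positive.\<close>
  proof (rule finite_measure_mono_AE[OF _ B])
    show "AE \<omega> in P. \<omega> \<in> E1 \<union> E2 \<longrightarrow> \<omega> \<in> ?B"
      using AE_coord_pos[of b']
    proof eventually_elim
      case (elim \<omega>)
      have "0 < 1 / N" using N by simp
      show ?case
      proof
        assume "\<omega> \<in> E1 \<union> E2"
        then show "\<omega> \<in> ?B"
        proof
          assume "\<omega> \<in> E1"
          then show ?thesis using elim \<open>0 < 1 / N\<close> unfolding E1_def by (auto simp del: zero_less_divide_iff zero_less_divide_1_iff)
        next
          assume "\<omega> \<in> E2"
          then have D: "\<omega> a \<in> {1 / 2<..1}" "\<omega> a' \<in> {2<..3}" "\<omega> b \<in> {1<..2}" "\<omega> b' \<in> {3<..}"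
            using dist by (auto simp: E2_def D_def)
          have "1 / N \<le> \<omega> a" by (rule order_trans[OF \<open>1 / N \<le> 1 / 4\<close>]) (use D in auto)
          moreover have "1 / N \<le> \<omega> a'" by (rule order_trans[OF \<open>1 / N \<le> 1 / 4\<close>]) (use D in auto)
          ultimately show ?thesis using N D by auto
        qed
      qed
    qed
  qed
  moreover have "prob (E1 \<union> E2) = prob E1 + prob E2"
    by (rule finite_measure_Union[OF E1 E2 disj])
  ultimately show ?thesis using p1 p2 by simp
qed

lemma extra_pos: "0 < r \<Longrightarrow> 0 < extra r"
  by (simp add: extra_def)

text \<open>Without truncation the bound at rate 1 is \<open>1 / 4 + extra 1\<close>; continuity
  carries the strict inequality up to \<open>1 + e\<close>, which becomes \<open>lam0\<close>. For
  rates up to 1 the square alone is at least 1/4. For a fixed rate the truncation error vanishes as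
  \<open>N\<close> grows. The value 1/4 matches the least possible number of grandchildren,
  four.\<close>

lemma supercritical_rate:
  "\<exists>lam0>1. \<forall>lam. 0 < lam \<and> lam < lam0 \<longrightarrow>
     (\<exists>N\<ge>4. 0 \<le> trunc lam N \<and> 1 / 4 < (trunc lam N)\<^sup>2 + extra lam)"
proof -
  let ?f = "\<lambda>r::real. (1 / (1 + r))\<^sup>2 + extra r"
  have "isCont ?f 1" unfolding extra_def by (intro continuous_intros) auto
  moreover have "1 / 4 < ?f 1" using extra_pos[of 1] by (simp add: power2_eq_square)
  ultimately have "eventually (\<lambda>r. 1 / 4 < ?f r) (at 1)"
    unfolding isCont_def by (rule order_tendstoD(1))
  then obtain e where e: "0 < e" "\<And>r. r \<noteq> 1 \<Longrightarrow> dist r 1 < e \<Longrightarrow> 1 / 4 < ?f r"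
    unfolding eventually_at by auto
  have f: "1 / 4 < ?f r" if "0 < r" "r < 1 + e" for r
  proof (cases "r \<le> 1")
    case True
    then have "1 / 2 \<le> 1 / (1 + r)" using that by (simp add: field_simps)
    from power_mono[OF this, of 2] extra_pos[OF that(1)] show ?thesis
      by (simp add: power2_eq_square)
  next
    case False
    then show ?thesis using e(2)[of r] that by (simp add: dist_real_def)
  qed
  show ?thesis
  proof (rule exI[of _ "1 + e"], intro conjI allI impI)
    fix lam assume lam: "0 < lam \<and> lam < 1 + e"
    have z: "((\<lambda>N::real. 1 / N) \<longlongrightarrow> 0) at_top"
      by (rule tendsto_divide_0[OF tendsto_const filterlim_at_top_imp_at_infinity[OF filterlim_ident]])
    have x: "((\<lambda>N::real. exp (- N)) \<longlongrightarrow> 0) at_top"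
      by (rule filterlim_compose[OF exp_at_bot filterlim_uminus_at_bot_at_top])
    have lim: "((\<lambda>N. trunc lam N) \<longlongrightarrow> 1 / (1 + lam) - (1 - exp (- 0)) - 0) at_top"
      unfolding trunc_def by (intro tendsto_diff tendsto_const tendsto_exp tendsto_minus z x)
    then have lim: "((\<lambda>N. trunc lam N) \<longlongrightarrow> 1 / (1 + lam)) at_top" by simp
    have "eventually (\<lambda>N. 0 < trunc lam N) at_top"
      by (rule order_tendstoD(1)[OF lim]) (use lam in auto)
    moreover have "eventually (\<lambda>N. 1 / 4 < (trunc lam N)\<^sup>2 + extra lam) at_top"
      by (rule order_tendstoD(1)[where y = "?f lam"])
        (use lam f in \<open>auto intro!: tendsto_intros lim\<close>)
    ultimately have "eventually (\<lambda>N. 4 \<le> N \<and> 0 < trunc lam N \<and> 1 / 4 < (trunc lam N)\<^sup>2 + extra lam) at_top"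
      using eventually_ge_at_top[of 4] by eventually_elim auto
    then obtain N where "4 \<le> N" "0 < trunc lam N" "1 / 4 < (trunc lam N)\<^sup>2 + extra lam"
      using eventually_happens'[OF trivial_limit_at_top_linorder] by blast
    then show "\<exists>N\<ge>4. 0 \<le> trunc lam N \<and> 1 / 4 < (trunc lam N)\<^sup>2 + extra lam"
      by (intro exI[of _ N]) auto
  qed (use e(1) in simp)
qed

section \<open>Events determined by a subtree\<close>

context rooted_tree
begin

text \<open>
  The clocks between \<open>x\<close> and its parent are split: the type 2 clock towards \<open>x\<close> belongs to the
  subtree of \<open>x\<close>, whereas the other two decide whether \<open>x\<close> is selected.
\<close>

definition subclocks :: "'v \<Rightarrow> 'v clock set" where
  "subclocks x = Convert ` below x \<union> (\<lambda>w. Spread2 (par w) w) ` below x \<union>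
     (\<lambda>w. Spread1 (par w) w) ` (below x - {x}) \<union> (\<lambda>w. Spread2 w (par w)) ` (below x - {x})"

text \<open>The clocks that decide whether \<open>S\<close> is the kept set of \<open>x\<close> and
  whether \<open>bad\<close> occurs for \<open>S\<close>.\<close>

definition outer :: "'v \<Rightarrow> 'v set \<Rightarrow> 'v clock set" where
  "outer x S = subclocks x - (\<Union>s\<in>S. subclocks s)"

lemma level_less: "w \<noteq> root \<Longrightarrow> level (par w) < level w"
  using level_par[of w] by simp

lemma Convert_subclocks [simp]: "Convert w \<in> subclocks x \<longleftrightarrow> w \<in> below x"
  by (auto simp: subclocks_def)

lemma down_subclocks:
  assumes "x \<noteq> root" "w \<noteq> root"
  shows "Spread1 (par w) w \<in> subclocks x \<longleftrightarrow> w \<in> below x \<and> w \<noteq> x"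
    and "Spread2 (par w) w \<in> subclocks x \<longleftrightarrow> w \<in> below x"
    and "Spread2 w (par w) \<in> subclocks x \<longleftrightarrow> w \<in> below x \<and> w \<noteq> x"
proof -
  \<comment> \<open>Otherwise the clock from \<open>par w\<close> down to \<open>w\<close> could
    also be read as the upward clock of \<open>par w\<close>.\<close>
  have "par (par w) \<noteq> w" if "par w \<in> below x"
    using level_less[OF assms(2)] level_less[OF below_not_root[OF that assms(1)]] by auto
  then show "Spread1 (par w) w \<in> subclocks x \<longleftrightarrow> w \<in> below x \<and> w \<noteq> x"
    and "Spread2 (par w) w \<in> subclocks x \<longleftrightarrow> w \<in> below x"
    and "Spread2 w (par w) \<in> subclocks x \<longleftrightarrow> w \<in> below x \<and> w \<noteq> x"
    by (auto simp: subclocks_def)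
qed

lemma subclocks_cases:
  assumes "c \<in> subclocks x" "x \<noteq> root"
  obtains w where "w \<in> below x" "w \<noteq> root" "c = Convert w \<or> c = Spread1 (par w) w \<or>
    c = Spread2 (par w) w \<or> c = Spread2 w (par w)"
proof -
  have "\<exists>w\<in>below x. c = Convert w \<or> c = Spread1 (par w) w \<or> c = Spread2 (par w) w \<or> c = Spread2 w (par w)"
    using assms(1) by (auto simp: subclocks_def)
  then show ?thesis using that below_not_root[OF _ assms(2)] by blast
qed

lemma subclocks_mono:
  assumes "y \<in> below x" "x \<noteq> root" shows "subclocks y \<subseteq> subclocks x"
proof -
  have "x = y" if "x \<in> below y"
  proof -
    have "level x = level y"
      using level_below[OF that] level_below[OF assms(1)] by (rule le_antisym[rotated])
    with assms(1) show ?thesis by (auto simp: below_def desc_def)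
  qed
  moreover have sub: "below y \<subseteq> below x"
    using below_trans[OF _ assms(1)] by (rule subsetI)
  ultimately have "below y - {y} \<subseteq> below x - {x}" by blast
  with sub show ?thesis unfolding subclocks_def by (intro Un_mono image_mono)
qed

lemma subclocks_disjoint:
  assumes "y \<in> desc k x" "y' \<in> desc k x" "x \<noteq> root" "y \<noteq> y'"
  shows "subclocks y \<inter> subclocks y' = {}"
proof -
  have nr: "y \<noteq> root" "y' \<noteq> root" using assms desc_not_root by auto
  have "c \<notin> subclocks y'" if cy: "c \<in> subclocks y" for c
  proof
    assume c: "c \<in> subclocks y'"
    obtain w where w: "w \<in> below y" "w \<noteq> root" "c = Convert w \<or> c = Spread1 (par w) w \<or>
      c = Spread2 (par w) w \<or> c = Spread2 w (par w)"
      using subclocks_cases[OF cy nr(1)] by metis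
    then have "w \<in> below y'" using c nr down_subclocks by auto
    with w(1) assms below_unique show False by blast
  qed
  then show ?thesis by auto
qed

lemma outer_subset: "outer x S \<subseteq> subclocks x"
  by (auto simp: outer_def)

lemma outer_disjoint: "s \<in> S \<Longrightarrow> outer x S \<inter> subclocks s = {}"
  by (auto simp: outer_def)

lemma in_outer:
  assumes "x \<noteq> root" "w \<in> below x" "root \<notin> S"
  shows "\<lbrakk>w \<noteq> x; \<And>s. s \<in> S \<Longrightarrow> w \<in> below s \<Longrightarrow> w = s\<rbrakk> \<Longrightarrow> Spread1 (par w) w \<in> outer x S"
    and "\<lbrakk>w \<noteq> x; \<And>s. s \<in> S \<Longrightarrow> w \<in> below s \<Longrightarrow> w = s\<rbrakk> \<Longrightarrow> Spread2 w (par w) \<in> outer x S"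
    and "\<lbrakk>\<And>s. s \<in> S \<Longrightarrow> w \<notin> below s\<rbrakk> \<Longrightarrow> Spread2 (par w) w \<in> outer x S"
    and "\<lbrakk>\<And>s. s \<in> S \<Longrightarrow> w \<notin> below s\<rbrakk> \<Longrightarrow> Convert w \<in> outer x S"
proof -
  have w: "w \<noteq> root" using assms below_not_root by blast
  have s: "s \<noteq> root" if "s \<in> S" for s using assms(3) that by auto
  show "\<lbrakk>w \<noteq> x; \<And>s. s \<in> S \<Longrightarrow> w \<in> below s \<Longrightarrow> w = s\<rbrakk> \<Longrightarrow> Spread1 (par w) w \<in> outer x S"
    and "\<lbrakk>w \<noteq> x; \<And>s. s \<in> S \<Longrightarrow> w \<in> below s \<Longrightarrow> w = s\<rbrakk> \<Longrightarrow> Spread2 w (par w) \<in> outer x S"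
    and "\<lbrakk>\<And>s. s \<in> S \<Longrightarrow> w \<notin> below s\<rbrakk> \<Longrightarrow> Spread2 (par w) w \<in> outer x S"
    and "\<lbrakk>\<And>s. s \<in> S \<Longrightarrow> w \<notin> below s\<rbrakk> \<Longrightarrow> Convert w \<in> outer x S"
    using assms(2) down_subclocks[OF assms(1) w] down_subclocks[OF s w]
    by (auto simp: outer_def)
qed

lemma measurable_down1: "Spread1 (par w) w \<in> J \<Longrightarrow> (\<lambda>\<omega>. down1 \<omega> w) \<in> borel_measurable (coords J)"
  unfolding down1_def by (rule measurable_coord)

lemma measurable_down2: "Spread2 (par w) w \<in> J \<Longrightarrow> (\<lambda>\<omega>. down2 \<omega> w) \<in> borel_measurable (coords J)"
  unfolding down2_def by (rule measurable_coord)

lemma measurable_up2: "Spread2 w (par w) \<in> J \<Longrightarrow> (\<lambda>\<omega>. up2 \<omega> w) \<in> borel_measurable (coords J)"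
  unfolding up2_def by (rule measurable_coord)

text \<open>The race to \<open>y\<close> consults \<open>down2\<close> only strictly above
  \<open>y\<close>, up to and including \<open>x\<close>. At \<open>y\<close> itself it consults
  only the two clocks that \<open>subclocks y\<close> leaves out. Hence no clock of a subtree below
  \<open>S\<close> is read, whether or not \<open>y\<close> belongs to \<open>S\<close>.\<close>

lemma sets_sel:
  assumes x: "x \<noteq> root" and y: "y \<in> desc (2 * n) x" and S: "S \<subseteq> desc (2 * n) x" and n: "0 < n"
  shows "{\<omega>. sel N n M \<omega> y} \<in> sets (coords (outer x S))"
proof -
  let ?C = "coords (outer x S)"
  have rS: "root \<notin> S" using S x desc_not_root by blast
  have yj: "(par ^^ j) y \<in> desc (2 * n - j) x" if "j \<le> 2 * n" for j
    using par_funpow_desc[OF y that] .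
  have below_s: "j = 0 \<and> y = s" if "j \<le> 2 * n" "s \<in> S" "(par ^^ j) y \<in> below s" for j s
  proof -
    have s: "s \<in> desc (2 * n) x" using that(2) S by auto
    have "level s \<le> level ((par ^^ j) y)" using that(3) by (rule level_below)
    then have "j = 0" using yj[OF that(1)] s that(1) by (auto simp: desc_def)
    then show ?thesis using below_unique[OF self_below _ y s] that(3) by simp
  qed
  have d1 [measurable]: "(\<lambda>\<omega>. down1 \<omega> ((par ^^ j) y)) \<in> borel_measurable ?C" if "j < 2 * n" for j
  proof (intro measurable_down1 in_outer x rS)
    show "(par ^^ j) y \<in> below x" using yj[of j] that desc_below by auto
    show "(par ^^ j) y \<noteq> x" using yj[of j] that by (auto simp: desc_def)
    show "(par ^^ j) y = s" if "s \<in> S" "(par ^^ j) y \<in> below s" for s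
      using below_s[OF _ that] \<open>j < 2 * n\<close> by auto
  qed
  have d2: "(\<lambda>\<omega>. down2 \<omega> ((par ^^ j) y)) \<in> borel_measurable ?C" if "0 < j" "j \<le> 2 * n" for j
  proof (intro measurable_down2 in_outer x rS)
    show "(par ^^ j) y \<in> below x" using yj[of j] that desc_below by auto
    show "(par ^^ j) y \<notin> below s" if "s \<in> S" for s
      using below_s[OF _ that] \<open>0 < j\<close> \<open>j \<le> 2 * n\<close> by auto
  qed
  have [measurable]: "(\<lambda>\<omega>. up2 \<omega> y) \<in> borel_measurable ?C"
  proof (intro measurable_up2 in_outer x rS)
    show "y \<in> below x" using y desc_below by auto
    show "y \<noteq> x" using y n by (auto simp: desc_def)
  qed (use below_s[of 0] in auto)
  have block: "{\<omega> \<in> space ?C. block N \<omega> ((par ^^ (2 * i)) y)} \<in> sets ?C" if "i < n" for i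
  proof -
    have [measurable]: "(\<lambda>\<omega>. down1 \<omega> ((par ^^ (2 * i)) y)) \<in> borel_measurable ?C"
      "(\<lambda>\<omega>. down1 \<omega> (par ((par ^^ (2 * i)) y))) \<in> borel_measurable ?C"
      "(\<lambda>\<omega>. down2 \<omega> (par ((par ^^ (2 * i)) y))) \<in> borel_measurable ?C"
      "(\<lambda>\<omega>. down2 \<omega> (par (par ((par ^^ (2 * i)) y)))) \<in> borel_measurable ?C"
      using d1[of "2 * i"] d1[of "Suc (2 * i)"] d2[of "Suc (2 * i)"] d2[of "Suc (Suc (2 * i))"] that
      by auto
    show ?thesis unfolding block_def by measurable
  qed
  have [measurable]: "(\<lambda>\<omega>. psum (down1 \<omega>) (2 * n) y) \<in> borel_measurable ?C"
    unfolding psum_def by (intro borel_measurable_sum d1) auto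
  have [measurable]: "{\<omega> \<in> space ?C. good N n \<omega> y} \<in> sets ?C"
  proof -
    have "{\<omega> \<in> space ?C. good N n \<omega> y} = {\<omega> \<in> space ?C. \<forall>i\<in>{..<n}. block N \<omega> ((par ^^ (2 * i)) y)}"
      by (auto simp: good_def)
    also have "\<dots> \<in> sets ?C" by (intro sets.sets_Collect_finite_All block) auto
    finally show ?thesis .
  qed
  have "{\<omega>. sel N n M \<omega> y} = {\<omega> \<in> space ?C. sel N n M \<omega> y}" by simp
  also have "\<dots> \<in> sets ?C" unfolding sel_def by measurable
  finally show ?thesis .
qed

lemma sets_selset:
  assumes x: "x \<noteq> root" and S: "S \<subseteq> desc (2 * n) x" and n: "0 < n"
  shows "{\<omega>. selset N n M x \<omega> = S} \<in> sets (coords (outer x S))"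
proof -
  let ?C = "coords (outer x S)"
  have "{\<omega>. selset N n M x \<omega> = S} = {\<omega> \<in> space ?C. \<forall>y\<in>desc (2 * n) x. sel N n M \<omega> y \<longleftrightarrow> y \<in> S}"
    using S by (auto simp: selset_def)
  also have "\<dots> \<in> sets ?C"
  proof (intro sets.sets_Collect_finite_All finite_desc)
    fix y assume "y \<in> desc (2 * n) x"
    then have [measurable]: "{\<omega> \<in> space ?C. sel N n M \<omega> y} \<in> sets ?C" using sets_sel[OF x _ S n] by simp
    show "{\<omega> \<in> space ?C. sel N n M \<omega> y \<longleftrightarrow> y \<in> S} \<in> sets ?C" by measurable
  qed
  finally show ?thesis .
qed

lemma sets_bad:
  assumes x: "x \<noteq> root" and S: "root \<notin> S"
  shows "{\<omega>. bad M x S \<omega>} \<in> sets (coords (outer x S))"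
proof -
  let ?C = "coords (outer x S)"
  have "{\<omega>. bad M x S \<omega>} = (\<Union>k. \<Union>w\<in>{w \<in> desc k x. \<forall>s\<in>S. w \<notin> below s}.
      {\<omega> \<in> space ?C. psum (fast \<omega>) k w + \<omega> (Convert w) \<le> real M})"
    by (auto simp: bad_def)
  also have "\<dots> \<in> sets ?C"
  proof (intro sets.countable_UN'' sets.finite_UN)
    fix k w assume "w \<in> {w \<in> desc k x. \<forall>s\<in>S. w \<notin> below s}"
    then have w: "w \<in> desc k x" "\<And>s. s \<in> S \<Longrightarrow> w \<notin> below s" by auto
    have [measurable]: "(\<lambda>\<omega>. \<omega> (Convert w)) \<in> borel_measurable ?C"
      using desc_below w by (intro measurable_coord in_outer x S) auto
    have f: "(\<lambda>\<omega>. fast \<omega> ((par ^^ j) w)) \<in> borel_measurable ?C" if j: "j < k" for j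
    proof -
      have d: "(par ^^ j) w \<in> desc (k - j) x" using par_funpow_desc[OF w(1)] j by simp
      then have b: "(par ^^ j) w \<in> below x" by (rule desc_below)
      have ne: "(par ^^ j) w \<noteq> x" using d j by (auto simp: desc_def)
      have ns: "(par ^^ j) w \<notin> below s" if "s \<in> S" for s
      proof
        assume "(par ^^ j) w \<in> below s"
        moreover have "w \<in> below ((par ^^ j) w)"
        proof -
          have "level w = level ((par ^^ j) w) + j" using w(1) d j by (auto simp: desc_def)
          then have "w \<in> desc j ((par ^^ j) w)" by (simp add: desc_def)
          then show ?thesis by (rule desc_below)
        qed
        ultimately show False using w(2)[OF that] below_trans by blast
      qed
      have [measurable]: "(\<lambda>\<omega>. down1 \<omega> ((par ^^ j) w)) \<in> borel_measurable ?C"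
        "(\<lambda>\<omega>. down2 \<omega> ((par ^^ j) w)) \<in> borel_measurable ?C"
        using b ne ns by (auto intro!: measurable_down1 measurable_down2 in_outer x S)
      show ?thesis unfolding fast_def by measurable
    qed
    have [measurable]: "(\<lambda>\<omega>. psum (fast \<omega>) k w) \<in> borel_measurable ?C"
      unfolding psum_def by (intro borel_measurable_sum f) auto
    show "{\<omega> \<in> space ?C. psum (fast \<omega>) k w + \<omega> (Convert w) \<le> real M} \<in> sets ?C" by measurable
  qed (simp_all add: countable_finite finite_desc)
  finally show ?thesis .
qed

lemma bad_antimono: "S' \<subseteq> S \<Longrightarrow> bad M x S \<omega> \<Longrightarrow> bad M x S' \<omega>"
  unfolding bad_def by blast

text \<open>Splitting by the value of the kept set makes \<open>S\<close> deterministic: each piece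
  is an event of the outer clocks intersected with events of the subtrees below
  \<open>S\<close>.\<close>

lemma breeds_Suc_eq:
  "{\<omega>. breeds N n M (Suc j) x \<omega>} = (\<Union>S\<in>Pow (desc (2 * n) x).
     ({\<omega>. selset N n (M x) x \<omega> = S} - {\<omega>. bad (M x) x S \<omega>}) \<inter> (\<Union>y\<in>S. {\<omega>. breeds N n M j y \<omega>}))"
proof -
  have "selset N n (M x) x \<omega> \<in> Pow (desc (2 * n) x)" for \<omega>
    by (auto simp: selset_def)
  then show ?thesis by auto
qed

lemma sets_breeds:
  "\<lbrakk>x \<noteq> root; 0 < n\<rbrakk> \<Longrightarrow> {\<omega>. breeds N n M j x \<omega>} \<in> sets (coords (subclocks x))"
proof (induction j arbitrary: x)
  case 0
  show ?case using sets.top[of "coords (subclocks x)"] by simp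
next
  case (Suc j)
  show ?case
    unfolding breeds_Suc_eq
  proof (intro sets.finite_UN sets.Int sets.Diff)
    fix S assume S: "S \<in> Pow (desc (2 * n) x)"
    then have rS: "root \<notin> S" using Suc.prems desc_not_root by blast
    show "{\<omega>. selset N n (M x) x \<omega> = S} \<in> sets (coords (subclocks x))"
      using sets_selset[OF Suc.prems(1) _ Suc.prems(2), of S] S sets_coords_mono[OF outer_subset] by blast
    show "{\<omega>. bad (M x) x S \<omega>} \<in> sets (coords (subclocks x))"
      using sets_bad[OF Suc.prems(1) rS] sets_coords_mono[OF outer_subset] by blast
    show "finite S" using S finite_desc finite_subset by blast
    fix y assume "y \<in> S"
    then have "y \<in> below x" "y \<noteq> root" using S rS desc_below by auto
    then show "{\<omega>. breeds N n M j y \<omega>} \<in> sets (coords (subclocks x))"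
      using Suc.IH Suc.prems(2) sets_coords_mono[OF subclocks_mono[OF _ Suc.prems(1)]] by blast
  qed (simp add: finite_desc)
qed

end

section \<open>The branching recursion\<close>

locale tree_clock_space = rooted_tree adj root par level m
  for adj :: "'v \<Rightarrow> 'v \<Rightarrow> bool" and root par level m +
  fixes lam rho :: real
  assumes lam_pos: "0 < lam" and rho_pos: "0 < rho"
begin

sublocale exponential_clocks "clock_rate lam rho :: 'v clock \<Rightarrow> real"
proof
  show "0 < clock_rate lam rho c" for c :: "'v clock"
    using lam_pos rho_pos by (cases c) auto
qed

lemma events_coords: "A \<in> sets (coords J) \<Longrightarrow> A \<in> events"
  by (rule subsetD[OF sets_coords_P])

text \<open>Independence is applied to complements, since failure in all subtrees is an
  intersection.\<close>

lemma prob_survivor_within: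
  assumes x: "x \<noteq> root" and S: "S \<subseteq> desc k x" and E: "E \<in> sets (coords (outer x S))"
    and B: "\<And>y. y \<in> S \<Longrightarrow> B y \<in> sets (coords (subclocks y))"
  shows "prob (E \<inter> (\<Union>y\<in>S. B y)) = prob E * (1 - (\<Prod>y\<in>S. 1 - prob (B y)))"
proof -
  have fin: "finite S" using S finite_desc finite_subset by blast
  \<comment> \<open>Index \<open>None\<close> stands for the outer clocks, \<open>Some y\<close> for
    the subtree of \<open>y\<close>.\<close>
  define A where "A i = (case i of None \<Rightarrow> E | Some y \<Rightarrow> - B y)" for i
  define J where "J i = (case i of None \<Rightarrow> outer x S | Some y \<Rightarrow> subclocks y)" for i
  have compl: "- B y \<in> sets (coords (subclocks y))" if "y \<in> S" for y
    using sets.compl_sets[OF B[OF that]] by (simp add: Compl_eq_Diff_UNIV)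
  have Bev: "B y \<in> events" if "y \<in> S" for y using B[OF that] by (rule events_coords)
  have "disjoint_family_on J (insert None (Some ` S))"
    unfolding disjoint_family_on_def
    using outer_disjoint[of _ S x] subclocks_disjoint[OF _ _ x] S
    by (auto simp: J_def Int_commute) blast+
  then have "prob (\<Inter>i\<in>insert None (Some ` S). A i) = (\<Prod>i\<in>insert None (Some ` S). prob (A i))"
    by (rule prob_INT[rotated]) (use E compl fin in \<open>auto simp: A_def J_def\<close>)
  also have "(\<Inter>i\<in>insert None (Some ` S). A i) = E - E \<inter> (\<Union>y\<in>S. B y)"
    by (auto simp: A_def)
  also have "(\<Prod>i\<in>insert None (Some ` S). prob (A i)) = prob E * (\<Prod>y\<in>S. prob (- B y))"
    using fin by (simp add: A_def prod.reindex)
  also have "(\<Prod>y\<in>S. prob (- B y)) = (\<Prod>y\<in>S. 1 - prob (B y))"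
    using prob_compl[OF Bev] by (intro prod.cong) (auto simp: Compl_eq_Diff_UNIV)
  also have "prob (E - E \<inter> (\<Union>y\<in>S. B y)) = prob E - prob (E \<inter> (\<Union>y\<in>S. B y))"
    using events_coords[OF E] Bev fin by (intro finite_measure_Diff) auto
  finally show ?thesis by (simp add: algebra_simps)
qed

text \<open>The chance of a success in \<open>s\<close> trials is at least 2/3 of the expected
  number of successes while the latter is at most 1/3. The factor 2/3 is what a mean offspring of
  3/2 can compensate.\<close>

lemma power_one_minus_le:
  fixes q :: real
  assumes "0 \<le> q" "q * real s \<le> 1 / 3"
  shows "(1 - q) ^ s \<le> 1 - 2 / 3 * q * real s"
  using assms(2)
proof (induction s)
  case (Suc s)
  have qs: "q * real s \<le> 1 / 3" "q \<le> 1"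
  proof -
    have "0 \<le> q * real s" using assms(1) by simp
    moreover have "q * real s + q \<le> 1 / 3" using Suc.prems by (simp add: algebra_simps)
    ultimately show "q * real s \<le> 1 / 3" "q \<le> 1" using assms(1) by linarith+
  qed
  have "(1 - q) ^ Suc s \<le> (1 - q) * (1 - 2 / 3 * q * real s)"
    using Suc.IH[OF qs(1)] qs(2) by (simp add: mult_left_mono)
  also have "\<dots> = 1 - 2 / 3 * q * real (Suc s) - q * (1 / 3 - 2 / 3 * (q * real s))"
    by (simp add: field_simps)
  also have "\<dots> \<le> 1 - 2 / 3 * q * real (Suc s)"
    using assms(1) qs(1) by simp
  finally show ?case .
qed simp

text \<open>Mean 2 kept endpoints, less 1/2 for early conversions, leaves 3/2; by
  \<open>power_one_minus_le\<close> the chance that one of them breeds is at least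
  \<open>2 / 3 * q * (3 / 2) = q\<close>, which closes the induction.\<close>

lemma breeds_recursion:
  fixes q :: real
  assumes x: "x \<noteq> root" and n: "0 < n"
    and sel: "2 \<le> (\<Sum>y\<in>desc (2 * n) x. prob {\<omega>. sel N n (M x) \<omega> y})"
    and calm: "prob {\<omega>. bad (M x) x {} \<omega>} * card (desc (2 * n) x) \<le> 1 / 2"
    and q: "0 \<le> q" "q * card (desc (2 * n) x) \<le> 1 / 3"
    and IH: "\<And>y. y \<in> desc (2 * n) x \<Longrightarrow> q \<le> prob {\<omega>. breeds N n M j y \<omega>}"
  shows "q \<le> prob {\<omega>. breeds N n M (Suc j) x \<omega>}"
proof -
  let ?D = "desc (2 * n) x"
  define Sel where "Sel S = {\<omega>. selset N n (M x) x \<omega> = S}" for S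
  define Bad where "Bad S = {\<omega>. bad (M x) x S \<omega>}" for S
  define Br where "Br y = {\<omega>. breeds N n M j y \<omega>}" for y
  have fD: "finite ?D" by (rule finite_desc)
  have rS: "root \<notin> S" if "S \<in> Pow ?D" for S using that x desc_not_root by blast
  have Sel: "Sel S \<in> sets (coords (outer x S))" if "S \<in> Pow ?D" for S
    unfolding Sel_def using sets_selset[OF x _ n] that by blast
  have Bad: "Bad S \<in> sets (coords (outer x S))" if "S \<in> Pow ?D" for S
    unfolding Bad_def using sets_bad[OF x rS[OF that]] .
  have Br: "Br y \<in> sets (coords (subclocks y))" if "y \<in> ?D" for y
    unfolding Br_def using that x desc_not_root n by (intro sets_breeds) auto
  have ev: "Sel S \<in> events" "Bad S \<in> events" if "S \<in> Pow ?D" for S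
    using Sel[OF that] Bad[OF that] by (auto intro: events_coords)
  have Brev: "Br y \<in> events" if "y \<in> ?D" for y using Br[OF that] by (rule events_coords)
  have Bad0: "Bad {} \<in> events" by (rule ev) simp
  have disj: "disjoint_family_on Sel A" for A
    by (auto simp: disjoint_family_on_def Sel_def)
  have each: "prob (Sel S - Bad S) * (2 / 3 * q * card S) \<le> prob ((Sel S - Bad S) \<inter> (\<Union>y\<in>S. Br y))"
    if S: "S \<in> Pow ?D" for S
  proof -
    have fS: "finite S" using S fD finite_subset by auto
    have "(\<Prod>y\<in>S. 1 - prob (Br y)) \<le> (\<Prod>y\<in>S. 1 - q)"
      using IH S by (intro prod_mono) (auto simp: Br_def)
    also have "\<dots> = (1 - q) ^ card S" by simp
    also have "\<dots> \<le> 1 - 2 / 3 * q * card S"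
    proof (rule power_one_minus_le[OF q(1)])
      have "q * real (card S) \<le> q * real (card ?D)"
        using S q(1) card_mono[OF fD, of S] by (intro mult_left_mono) auto
      with q(2) show "q * real (card S) \<le> 1 / 3" by simp
    qed
    finally have "2 / 3 * q * card S \<le> 1 - (\<Prod>y\<in>S. 1 - prob (Br y))" by simp
    moreover have "prob ((Sel S - Bad S) \<inter> (\<Union>y\<in>S. Br y))
        = prob (Sel S - Bad S) * (1 - (\<Prod>y\<in>S. 1 - prob (Br y)))"
      by (rule prob_survivor_within[OF x, of S "2 * n"]) (use S Sel[OF S] Bad[OF S] Br in auto)
    ultimately show ?thesis by (metis mult_left_mono measure_nonneg)
  qed
  have mean: "(\<Sum>S\<in>Pow ?D. card S * prob (Sel S)) = (\<Sum>y\<in>?D. prob {\<omega>. sel N n (M x) \<omega> y})"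
  proof -
    have "(\<Sum>S\<in>Pow ?D. card S * prob (Sel S)) = (\<Sum>S\<in>Pow ?D. \<Sum>y\<in>?D. if y \<in> S then prob (Sel S) else 0)"
    proof (intro sum.cong refl)
      fix S assume "S \<in> Pow ?D"
      then have "?D \<inter> S = S" by auto
      then show "card S * prob (Sel S) = (\<Sum>y\<in>?D. if y \<in> S then prob (Sel S) else 0)"
        using fD by (simp add: sum.inter_restrict[symmetric])
    qed
    also have "\<dots> = (\<Sum>y\<in>?D. \<Sum>S\<in>Pow ?D. if y \<in> S then prob (Sel S) else 0)"
      by (rule sum.swap)
    also have "\<dots> = (\<Sum>y\<in>?D. prob {\<omega>. sel N n (M x) \<omega> y})"
    proof (intro sum.cong refl)
      fix y assume y: "y \<in> ?D"
      have "(\<Sum>S\<in>Pow ?D. if y \<in> S then prob (Sel S) else 0) = (\<Sum>S\<in>{S \<in> Pow ?D. y \<in> S}. prob (Sel S))"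
        using fD by (intro sum.mono_neutral_cong_right) auto
      also have "\<dots> = prob (\<Union>S\<in>{S \<in> Pow ?D. y \<in> S}. Sel S)"
        using fD disj ev by (intro finite_measure_finite_Union[symmetric]) auto
      also have "(\<Union>S\<in>{S \<in> Pow ?D. y \<in> S}. Sel S) = {\<omega>. sel N n (M x) \<omega> y}"
      proof -
        have "selset N n (M x) x \<omega> \<in> Pow ?D" for \<omega> by (auto simp: selset_def)
        then have "(\<Union>S\<in>{S \<in> Pow ?D. y \<in> S}. Sel S) = {\<omega>. y \<in> selset N n (M x) x \<omega>}"
          unfolding Sel_def by auto
        then show ?thesis using y by (simp add: selset_def)
      qed
      finally show "(\<Sum>S\<in>Pow ?D. if y \<in> S then prob (Sel S) else 0) = prob {\<omega>. sel N n (M x) \<omega> y}" .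
    qed
    finally show ?thesis .
  qed
  \<comment> \<open>Crude bound: whenever some conversion is early, all of \<open>?D\<close> is
    counted as lost.\<close>
  have loss: "(\<Sum>S\<in>Pow ?D. card S * prob (Sel S \<inter> Bad {})) \<le> 1 / 2"
  proof -
    have "(\<Sum>S\<in>Pow ?D. card S * prob (Sel S \<inter> Bad {})) \<le> (\<Sum>S\<in>Pow ?D. card ?D * prob (Sel S \<inter> Bad {}))"
    proof (intro sum_mono mult_right_mono)
      fix S assume "S \<in> Pow ?D"
      then show "real (card S) \<le> real (card ?D)" using card_mono[OF fD, of S] by simp
    qed simp
    also have "\<dots> = card ?D * (\<Sum>S\<in>Pow ?D. prob (Sel S \<inter> Bad {}))"
      by (simp add: sum_distrib_left)
    also have "(\<Sum>S\<in>Pow ?D. prob (Sel S \<inter> Bad {})) = prob (\<Union>S\<in>Pow ?D. Sel S \<inter> Bad {})"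
      using fD ev Bad0 by (intro finite_measure_finite_Union[symmetric]) (auto simp: disjoint_family_on_def Sel_def)
    also have "card ?D * \<dots> \<le> card ?D * prob (Bad {})"
      using Bad0 by (intro mult_left_mono finite_measure_mono) auto
    also have "\<dots> \<le> 1 / 2" using calm by (simp add: Bad_def mult.commute)
    finally show ?thesis .
  qed
  have "3 / 2 \<le> (\<Sum>S\<in>Pow ?D. card S * prob (Sel S)) - (\<Sum>S\<in>Pow ?D. card S * prob (Sel S \<inter> Bad {}))"
    using mean loss sel by simp
  also have "\<dots> = (\<Sum>S\<in>Pow ?D. card S * (prob (Sel S) - prob (Sel S \<inter> Bad {})))"
    by (simp add: sum_subtractf algebra_simps)
  \<comment> \<open>The mean is estimated with \<open>Bad {}\<close>, whose probability does not
    involve \<open>S\<close>. Independence, however, needs the smaller event \<open>Bad S\<close>,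
    which reads no clock of the subtrees below \<open>S\<close>.\<close>
  also have "\<dots> \<le> (\<Sum>S\<in>Pow ?D. card S * prob (Sel S - Bad S))"
  proof (intro sum_mono mult_left_mono)
    fix S assume S: "S \<in> Pow ?D"
    have "prob (Sel S) - prob (Sel S \<inter> Bad {}) = prob (Sel S - Bad {})"
      using ev(1)[OF S] Bad0 by (simp add: finite_measure_Diff')
    also have "\<dots> \<le> prob (Sel S - Bad S)"
      using ev[OF S] bad_antimono[of "{}" S] by (intro finite_measure_mono) (auto simp: Bad_def)
    finally show "prob (Sel S) - prob (Sel S \<inter> Bad {}) \<le> prob (Sel S - Bad S)" .
  qed simp
  finally have "q * 1 \<le> q * (2 / 3 * (\<Sum>S\<in>Pow ?D. card S * prob (Sel S - Bad S)))"
    using q(1) by (intro mult_left_mono) auto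
  then have "q \<le> (\<Sum>S\<in>Pow ?D. prob (Sel S - Bad S) * (2 / 3 * q * card S))"
    by (simp add: sum_distrib_left algebra_simps)
  also have "\<dots> \<le> (\<Sum>S\<in>Pow ?D. prob ((Sel S - Bad S) \<inter> (\<Union>y\<in>S. Br y)))"
    by (intro sum_mono each)
  also have "\<dots> = prob (\<Union>S\<in>Pow ?D. (Sel S - Bad S) \<inter> (\<Union>y\<in>S. Br y))"
  proof (intro finite_measure_finite_Union[symmetric])
    show "(\<lambda>S. (Sel S - Bad S) \<inter> (\<Union>y\<in>S. Br y)) ` Pow ?D \<subseteq> events"
    proof
      fix A assume "A \<in> (\<lambda>S. (Sel S - Bad S) \<inter> (\<Union>y\<in>S. Br y)) ` Pow ?D"
      then obtain S where S: "S \<in> Pow ?D" and A: "A = (Sel S - Bad S) \<inter> (\<Union>y\<in>S. Br y)" by blast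
      have "finite S" using S fD finite_subset by auto
      then have "(\<Union>y\<in>S. Br y) \<in> events" using S Brev by (intro sets.finite_UN) auto
      then show "A \<in> events" unfolding A using ev[OF S] by blast
    qed
  qed (use fD in \<open>auto simp: disjoint_family_on_def Sel_def\<close>)
  also have "(\<Union>S\<in>Pow ?D. (Sel S - Bad S) \<inter> (\<Union>y\<in>S. Br y)) = {\<omega>. breeds N n M (Suc j) x \<omega>}"
    unfolding breeds_Suc_eq Sel_def Bad_def Br_def ..
  finally show ?thesis .
qed

section \<open>Early conversions are unlikely\<close>

lemma sum_one_div_le:
  assumes "0 < \<theta>"
  shows "1 / (1 + \<theta>) + lam / (lam + \<theta>) \<le> (1 + lam) / \<theta>"
proof -
  have "1 / (1 + \<theta>) \<le> 1 / \<theta>" "lam / (lam + \<theta>) \<le> lam / \<theta>"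
    using assms lam_pos by (auto intro!: divide_left_mono)
  then show ?thesis by (simp add: add_divide_distrib)
qed

text \<open>Exponential Markov inequality. For each edge the exponential of the minimum is bounded
  by the sum of the two exponentials, whose mean is at most \<open>(1 + lam) / \<theta>\<close>; the
  conversion clock contributes \<open>rho / \<theta>\<close>.\<close>

lemma prob_fast_conversion:
  assumes x: "x \<noteq> root" and w: "w \<in> desc k x" and \<theta>: "0 < \<theta>"
  shows "prob {\<omega>. psum (fast \<omega>) k w + \<omega> (Convert w) \<le> t}
    \<le> exp (\<theta> * t) * ((1 + lam) / \<theta>) ^ k * (rho / \<theta>)"
proof -
  let ?z = "\<lambda>j. (par ^^ j) w"
  \<comment> \<open>Indices below \<open>k\<close> are the edges of the path; index \<open>k\<close>
    is the conversion clock.\<close>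
  define F where "F j \<omega> = (if j < k then exp (- \<theta> * down1 \<omega> (?z j)) + exp (- \<theta> * down2 \<omega> (?z j))
    else exp (- \<theta> * \<omega> (Convert w)))" for j \<omega>
  define J where "J j = (if j < k then {Spread1 (par (?z j)) (?z j), Spread2 (par (?z j)) (?z j)} else {Convert w})" for j
  have Fpos: "0 \<le> F j \<omega>" for j \<omega> by (simp add: F_def)
  have mF: "(\<lambda>\<omega>. ennreal (F j \<omega>)) \<in> borel_measurable (coords (J j))" for j
  proof (cases "j < k")
    case True
    have [measurable]: "(\<lambda>\<omega>. down1 \<omega> (?z j)) \<in> borel_measurable (coords (J j))"
      "(\<lambda>\<omega>. down2 \<omega> (?z j)) \<in> borel_measurable (coords (J j))"
      using True by (auto intro!: measurable_down1 measurable_down2 simp: J_def)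
    show ?thesis using True unfolding F_def by simp
  next
    case False
    have [measurable]: "(\<lambda>\<omega>. \<omega> (Convert w)) \<in> borel_measurable (coords (J j))"
      using False by (auto intro!: measurable_coord simp: J_def)
    show ?thesis using False unfolding F_def by simp
  qed
  have lev: "level (?z j) = level x + (k - j)" if "j \<le> k" for j
    using par_funpow_desc[OF w that] by (simp add: desc_def)
  have disj: "disjoint_family_on J {..<Suc k}"
  proof (unfold disjoint_family_on_def, intro ballI impI)
    fix i j assume ij: "i \<in> {..<Suc k}" "j \<in> {..<Suc k}" "i \<noteq> j"
    have "?z i \<noteq> ?z j" if "i < k" "j < k"
      using lev[of i] lev[of j] that ij by auto
    then show "J i \<inter> J j = {}" using ij by (auto simp: J_def)
  qed
  have m: "{\<omega>. psum (fast \<omega>) k w + \<omega> (Convert w) \<le> t} \<in> events"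
  proof -
    have [measurable]: "(\<lambda>\<omega>. \<omega> c) \<in> borel_measurable P" for c by (rule measurable_P)
    have [measurable]: "(\<lambda>\<omega>. psum (fast \<omega>) k w) \<in> borel_measurable P"
      unfolding psum_def fast_def down1_def down2_def by measurable
    have "{\<omega> \<in> space P. psum (fast \<omega>) k w + \<omega> (Convert w) \<le> t} \<in> events" by measurable
    then show ?thesis by simp
  qed
  have point: "indicator {\<omega>. psum (fast \<omega>) k w + \<omega> (Convert w) \<le> t} \<omega>
      \<le> ennreal (exp (\<theta> * t)) * (\<Prod>j<Suc k. ennreal (F j \<omega>))" for \<omega>
  proof (cases "psum (fast \<omega>) k w + \<omega> (Convert w) \<le> t")
    case True
    have "1 \<le> exp (\<theta> * (t - (psum (fast \<omega>) k w + \<omega> (Convert w))))"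
      using True \<theta> by simp
    also have "\<dots> = exp (\<theta> * t) * ((\<Prod>j<k. exp (- \<theta> * fast \<omega> (?z j))) * exp (- \<theta> * \<omega> (Convert w)))"
      by (simp add: psum_def exp_sum[symmetric] exp_add[symmetric] sum_distrib_left sum_negf algebra_simps)
    also have "\<dots> \<le> exp (\<theta> * t) * ((\<Prod>j<k. F j \<omega>) * exp (- \<theta> * \<omega> (Convert w)))"
    proof (intro mult_left_mono mult_right_mono prod_mono conjI)
      fix j assume "j \<in> {..<k}"
      then show "exp (- \<theta> * fast \<omega> (?z j)) \<le> F j \<omega>"
        by (auto simp: F_def fast_def min_def)
    qed auto
    also have "\<dots> = exp (\<theta> * t) * (\<Prod>j<Suc k. F j \<omega>)" by (simp add: F_def)
    finally have "ennreal 1 \<le> ennreal (exp (\<theta> * t) * (\<Prod>j<Suc k. F j \<omega>))"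
      by (rule ennreal_leI)
    also have "\<dots> = ennreal (exp (\<theta> * t)) * (\<Prod>j<Suc k. ennreal (F j \<omega>))"
      using Fpos by (subst prod_ennreal) (auto simp: ennreal_mult prod_nonneg simp del: prod.lessThan_Suc)
    finally show ?thesis using True by simp
  qed simp
  have int: "(\<integral>\<^sup>+\<omega>. ennreal (exp (- \<theta> * \<omega> c)) \<partial>P) = ennreal (clock_rate lam rho c / (clock_rate lam rho c + \<theta>))" for c
    using nn_integral_coord[of "\<lambda>u. ennreal (exp (- \<theta> * u))" c] laplace_expo[OF rate_pos, of \<theta> c] \<theta> by simp
  have mP: "(\<lambda>\<omega>. ennreal (exp (- \<theta> * \<omega> c))) \<in> borel_measurable P" for c
  proof -
    have [measurable]: "(\<lambda>\<omega>. \<omega> c) \<in> borel_measurable P" by (rule measurable_P)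
    show ?thesis by measurable
  qed
  have intF: "(\<integral>\<^sup>+\<omega>. ennreal (F j \<omega>) \<partial>P) \<le> ennreal ((1 + lam) / \<theta>)" if "j < k" for j
  proof -
    have "(\<integral>\<^sup>+\<omega>. ennreal (F j \<omega>) \<partial>P)
        = (\<integral>\<^sup>+\<omega>. ennreal (exp (- \<theta> * \<omega> (Spread1 (par (?z j)) (?z j)))) + ennreal (exp (- \<theta> * \<omega> (Spread2 (par (?z j)) (?z j)))) \<partial>P)"
      using that by (simp add: F_def down1_def down2_def)
    also have "\<dots> = ennreal (1 / (1 + \<theta>)) + ennreal (lam / (lam + \<theta>))"
      by (subst nn_integral_add[OF mP mP]) (simp only: int clock_rate.simps)
    also have "\<dots> = ennreal (1 / (1 + \<theta>) + lam / (lam + \<theta>))"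
      using \<theta> lam_pos by (intro ennreal_plus[symmetric]) auto
    also have "\<dots> \<le> ennreal ((1 + lam) / \<theta>)"
      using sum_one_div_le[OF \<theta>] by (rule ennreal_leI)
    finally show ?thesis .
  qed
  have intk: "(\<integral>\<^sup>+\<omega>. ennreal (F k \<omega>) \<partial>P) \<le> ennreal (rho / \<theta>)"
  proof -
    have "(\<integral>\<^sup>+\<omega>. ennreal (F k \<omega>) \<partial>P) = ennreal (rho / (rho + \<theta>))"
      using int[of "Convert w"] by (simp add: F_def)
    also have "\<dots> \<le> ennreal (rho / \<theta>)"
      using \<theta> rho_pos by (intro ennreal_leI divide_left_mono) auto
    finally show ?thesis .
  qed
  have "ennreal (prob {\<omega>. psum (fast \<omega>) k w + \<omega> (Convert w) \<le> t})
      = (\<integral>\<^sup>+\<omega>. indicator {\<omega>. psum (fast \<omega>) k w + \<omega> (Convert w) \<le> t} \<omega> \<partial>P)"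
    using m by (simp add: emeasure_eq_measure)
  also have "\<dots> \<le> (\<integral>\<^sup>+\<omega>. ennreal (exp (\<theta> * t)) * (\<Prod>j<Suc k. ennreal (F j \<omega>)) \<partial>P)"
    by (intro nn_integral_mono point)
  also have "\<dots> = ennreal (exp (\<theta> * t)) * (\<integral>\<^sup>+\<omega>. (\<Prod>j<Suc k. ennreal (F j \<omega>)) \<partial>P)"
  proof (rule nn_integral_cmult)
    have "(\<lambda>\<omega>. ennreal (F j \<omega>)) \<in> borel_measurable P" for j
      using mF[of j] sets_coords_P[of "J j"] by (auto simp: measurable_def)
    then show "(\<lambda>\<omega>. \<Prod>j<Suc k. ennreal (F j \<omega>)) \<in> borel_measurable P"
      by (intro borel_measurable_prod_ennreal)
  qed
  also have "(\<integral>\<^sup>+\<omega>. (\<Prod>j<Suc k. ennreal (F j \<omega>)) \<partial>P) = (\<Prod>j<Suc k. \<integral>\<^sup>+\<omega>. ennreal (F j \<omega>) \<partial>P)"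
    by (rule nn_integral_prod_coords[OF _ disj mF]) simp
  also have "\<dots> \<le> (\<Prod>j<k. ennreal ((1 + lam) / \<theta>)) * ennreal (rho / \<theta>)"
    unfolding prod.lessThan_Suc by (intro mult_mono prod_mono_ennreal intF intk) auto
  also have "\<dots> = ennreal (((1 + lam) / \<theta>) ^ k * (rho / \<theta>))"
    using \<theta> lam_pos rho_pos by (simp add: ennreal_power ennreal_mult[symmetric])
  also have "ennreal (exp (\<theta> * t)) * \<dots> = ennreal (exp (\<theta> * t) * (((1 + lam) / \<theta>) ^ k * (rho / \<theta>)))"
    using \<theta> lam_pos rho_pos by (intro ennreal_mult[symmetric]) auto
  finally have "ennreal (prob {\<omega>. psum (fast \<omega>) k w + \<omega> (Convert w) \<le> t})
      \<le> ennreal (exp (\<theta> * t) * (((1 + lam) / \<theta>) ^ k * (rho / \<theta>)))"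
    by (simp add: mult_left_mono)
  then show ?thesis
    using \<theta> lam_pos rho_pos by (subst (asm) ennreal_le_iff) (auto simp: mult.assoc)
qed

text \<open>Union bound over the \<open>m ^ k\<close> descendants at each depth.
  \<open>\<theta>\<close> is chosen to make \<open>m * (1 + lam) / \<theta>\<close> equal to 1/2, so
  the sum over depths is geometric with value 2.\<close>

lemma prob_bad:
  assumes x: "x \<noteq> root"
  defines "\<theta> \<equiv> 2 * real m * (1 + lam)"
  shows "prob {\<omega>. bad M x {} \<omega>} \<le> 2 * exp (\<theta> * real M) * (rho / \<theta>)"
proof -
  let ?A = "\<lambda>k w. {\<omega>. psum (fast \<omega>) k w + \<omega> (Convert w) \<le> real M}"
  define B where "B k = (\<Union>w\<in>desc k x. ?A k w)" for k
  have \<theta>: "0 < \<theta>" using two_le_m lam_pos by (simp add: \<theta>_def)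
  have A: "?A k w \<in> events" for k w
  proof -
    have [measurable]: "(\<lambda>\<omega>. \<omega> c) \<in> borel_measurable P" for c by (rule measurable_P)
    have [measurable]: "(\<lambda>\<omega>. psum (fast \<omega>) k w) \<in> borel_measurable P"
      unfolding psum_def fast_def down1_def down2_def by measurable
    have "{\<omega> \<in> space P. psum (fast \<omega>) k w + \<omega> (Convert w) \<le> real M} \<in> events" by measurable
    then show ?thesis by simp
  qed
  have B: "B k \<in> events" for k unfolding B_def using A finite_desc by (intro sets.finite_UN) auto
  let ?c = "exp (\<theta> * real M) * (rho / \<theta>)"
  have le: "prob (B k) \<le> ?c * (1 / 2) ^ k" for k
  proof -
    have "prob (B k) \<le> (\<Sum>w\<in>desc k x. prob (?A k w))"
      unfolding B_def using A finite_desc by (intro finite_measure_subadditive_finite) auto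
    also have "\<dots> \<le> (\<Sum>w\<in>desc k x. exp (\<theta> * real M) * ((1 + lam) / \<theta>) ^ k * (rho / \<theta>))"
      by (intro sum_mono prob_fast_conversion[OF x _ \<theta>])
    also have "\<dots> = real m ^ k * (exp (\<theta> * real M) * ((1 + lam) / \<theta>) ^ k * (rho / \<theta>))"
      using card_desc[OF x] by simp
    also have "\<dots> = ?c * (real m * ((1 + lam) / \<theta>)) ^ k"
      by (simp only: power_mult_distrib mult_ac)
    also have "real m * ((1 + lam) / \<theta>) = 1 / 2"
      using two_le_m lam_pos by (simp add: \<theta>_def)
    finally show ?thesis .
  qed
  have summ: "summable (\<lambda>k. ?c * (1 / 2) ^ k)"
    by (intro summable_mult summable_geometric) simp
  have sB: "summable (\<lambda>k. prob (B k))"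
    by (rule summable_comparison_test'[OF summ, of 0]) (use le in simp)
  have "{\<omega>. bad M x {} \<omega>} = (\<Union>k. B k)" by (auto simp: bad_def B_def)
  also have "prob \<dots> \<le> (\<Sum>k. prob (B k))"
    using B sB by (intro finite_measure_subadditive_countably) auto
  also have "\<dots> \<le> (\<Sum>k. ?c * (1 / 2) ^ k)"
    by (intro suminf_le le sB summ)
  also have "\<dots> = ?c * 2"
    by (subst suminf_mult) (auto simp: suminf_geometric summable_geometric)
  finally show ?thesis by (simp add: mult_ac)
qed

end

section \<open>Choosing the parameters\<close>

context rooted_tree
begin

lemma good_nonneg: "\<lbrakk>good N n \<omega> y; 0 < N\<rbrakk> \<Longrightarrow> 0 \<le> psum (down1 \<omega>) (2 * n) y"
proof (induction n arbitrary: y)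
  case (Suc n)
  have "0 < 1 / N" using Suc.prems(2) by simp
  moreover have "0 \<le> psum (down1 \<omega>) (2 * n) (par (par y))" using Suc by (simp add: good_Suc)
  ultimately show ?case
    using Suc.prems(1) by (auto simp: good_Suc block_def psum_Suc simp del: zero_less_divide_iff zero_less_divide_1_iff)
qed simp

end

context tree_clock_space
begin

lemma prob_block_vertex:
  assumes "u \<noteq> root" "par u \<noteq> root" "par (par u) \<noteq> root" "4 \<le> N" "0 \<le> trunc lam N"
  shows "(trunc lam N)\<^sup>2 + extra lam \<le> prob {\<omega>. block N \<omega> u}"
proof -
  let ?v = "par u" and ?t = "par (par u)"
  have l: "level ?v < level u" "level ?t < level ?v" "level (par ?t) < level ?t"
    using assms level_less by auto
  have "distinct [Spread1 ?t ?v, Spread1 ?v u, Spread2 (par ?t) ?t, Spread2 ?t ?v]"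
    using l by auto
  from prob_block[OF this assms(4)] assms(5) show ?thesis
    by (simp add: block_def down1_def down2_def)
qed

lemma sets_block:
  assumes "Spread1 (par u) u \<in> J" "Spread1 (par (par u)) (par u) \<in> J"
    "Spread2 (par (par u)) (par u) \<in> J" "Spread2 (par (par (par u))) (par (par u)) \<in> J"
  shows "{\<omega>. block N \<omega> u} \<in> sets (coords J)"
proof -
  note [measurable] = measurable_down1[OF assms(1)] measurable_down1[OF assms(2)]
    measurable_down2[OF assms(3)] measurable_down2[OF assms(4)]
  have "{\<omega>. block N \<omega> u} = {\<omega> \<in> space (coords J). block N \<omega> u}" by simp
  also have "\<dots> \<in> sets (coords J)" unfolding block_def by measurable
  finally show ?thesis .
qed

text \<open>The type 2 clocks of a block sit one edge above its type 1 clocks, so different blocks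
  on the path read disjoint sets of clocks, and none reads the upward clock at \<open>y\<close>. The
  factor \<open>exp (- lam)\<close> is the probability that this upward clock exceeds 1.\<close>

lemma prob_good:
  assumes x: "x \<noteq> root" and y: "y \<in> desc (2 * n) x" and N: "4 \<le> N" "0 \<le> trunc lam N"
  shows "((trunc lam N)\<^sup>2 + extra lam) ^ n * exp (- lam) \<le> prob {\<omega>. good N n \<omega> y \<and> 1 < up2 \<omega> y}"
proof -
  let ?r = "(trunc lam N)\<^sup>2 + extra lam"
  define z where "z j = (par ^^ j) y" for j
  have lev: "level (z j) + j = level x + 2 * n" if "j \<le> 2 * n" for j
    using par_funpow_desc[OF y that] that by (simp add: desc_def z_def)
  have znr: "z j \<noteq> root" if "j \<le> 2 * n" for j
    unfolding z_def using par_funpow_desc[OF y that] x by (rule desc_not_root)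
  have inj: "z i = z j \<longleftrightarrow> i = j" if "i \<le> 2 * n" "j \<le> 2 * n" for i j
    using lev[OF that(1)] lev[OF that(2)] by auto
  have zS: "z (Suc j) = par (z j)" for j by (simp add: z_def)
  define J where "J i = (if i < n then {Spread1 (z (2 * i + 1)) (z (2 * i)), Spread1 (z (2 * i + 2)) (z (2 * i + 1)),
      Spread2 (z (2 * i + 2)) (z (2 * i + 1)), Spread2 (z (2 * i + 3)) (z (2 * i + 2))}
    else {Spread2 (z 0) (z 1)})" for i
  define A where "A i = (if i < n then {\<omega>. block N \<omega> (z (2 * i))} else {\<omega>. 1 < up2 \<omega> y})" for i
  have disj: "disjoint_family_on J {..<Suc n}"
  proof -
    have 1: "J i \<inter> J j = {}" if "i < n" "j < n" "i \<noteq> j" for i j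
    proof -
      have "2 * i \<noteq> Suc (2 * j)" "2 * j \<noteq> Suc (2 * i)" by presburger+
      then show ?thesis using that by (auto simp: J_def inj)
    qed
    have 2: "J i \<inter> J n = {}" if "i < n" for i
    proof -
      \<comment> \<open>For the top block \<open>z (2 * i + 3)\<close> is the parent of
        \<open>x\<close>, outside the range of \<open>inj\<close>; that clock is therefore told
        apart by its target.\<close>
      have "z (2 * i + 2) \<noteq> z 0" "z (2 * i + 2) \<noteq> z 1"
        using inj[of "2 * i + 2" 0] inj[of "2 * i + 2" 1] that by auto
      then show ?thesis using that by (simp add: J_def)
    qed
    show ?thesis
      unfolding disjoint_family_on_def
    proof (intro ballI impI)
      fix i j assume "i \<in> {..<Suc n}" "j \<in> {..<Suc n}" "i \<noteq> j"
      then consider "i < n" "j < n" | "i < n" "j = n" | "j < n" "i = n" by (auto simp: less_Suc_eq)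
      then show "J i \<inter> J j = {}"
        using 1[of i j] 2[of i] 2[of j] \<open>i \<noteq> j\<close> by cases (simp_all add: Int_commute[of "J n"])
    qed
  qed
  have A: "A i \<in> sets (coords (J i))" if "i < Suc n" for i
  proof (cases "i < n")
    case True
    have "{\<omega>. block N \<omega> (z (2 * i))} \<in> sets (coords (J i))"
      by (rule sets_block) (use True in \<open>simp_all add: J_def zS[symmetric] numeral_3_eq_3 numeral_2_eq_2\<close>)
    then show ?thesis using True by (simp add: A_def)
  next
    case False
    then have [measurable]: "(\<lambda>\<omega>. up2 \<omega> y) \<in> borel_measurable (coords (J i))"
      by (intro measurable_up2) (simp add: J_def z_def)
    have "{\<omega>. 1 < up2 \<omega> y} = {\<omega> \<in> space (coords (J i)). 1 < up2 \<omega> y}" by simp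
    also have "\<dots> \<in> sets (coords (J i))" by measurable
    finally show ?thesis using False by (simp add: A_def)
  qed
  have "prob (A n) = exp (- lam)"
    using prob_coord[of "{1<..}" "Spread2 y (par y)"] measure_expo_gt[OF lam_pos, of 1]
    by (simp add: A_def up2_def)
  moreover have "?r ^ n \<le> (\<Prod>i<n. prob (A i))"
  proof -
    have "(\<Prod>i<n. ?r) \<le> (\<Prod>i<n. prob (A i))"
    proof (intro prod_mono conjI)
      fix i assume "i \<in> {..<n}"
      then have i: "i < n" by simp
      show "0 \<le> ?r" using extra_pos[OF lam_pos] by simp
      show "?r \<le> prob (A i)"
        using prob_block_vertex[of "z (2 * i)" N] znr[of "2 * i"] znr[of "2 * i + 1"] znr[of "2 * i + 2"] i N
        by (simp add: A_def zS)
    qed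
    then show ?thesis by simp
  qed
  moreover have "prob (\<Inter>i<Suc n. A i) = (\<Prod>i<Suc n. prob (A i))"
    by (rule prob_INT[OF _ disj]) (use A in auto)
  moreover have "(\<Inter>i<Suc n. A i) = {\<omega>. good N n \<omega> y \<and> 1 < up2 \<omega> y}"
  proof (rule set_eqI)
    fix \<omega>
    have "\<omega> \<in> A i \<longleftrightarrow> (if i < n then block N \<omega> ((par ^^ (2 * i)) y) else 1 < up2 \<omega> y)" for i
      by (simp add: A_def z_def)
    then show "\<omega> \<in> (\<Inter>i<Suc n. A i) \<longleftrightarrow> \<omega> \<in> {\<omega>. good N n \<omega> y \<and> 1 < up2 \<omega> y}"
      by (auto simp: good_def less_Suc_eq)
  qed
  ultimately show ?thesis by (simp add: mult_right_mono)
qed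

text \<open>The purpose of the upper bound \<open>N\<close> in \<open>block\<close>: only linearly
  many windows of length 1 are possible.\<close>

lemma good_window:
  assumes "good N n \<omega> y" "1 < up2 \<omega> y" "0 < N"
  shows "\<exists>M\<in>{1..nat \<lfloor>2 * real n * N\<rfloor> + 1}. sel N n M \<omega> y"
proof -
  let ?A = "psum (down1 \<omega>) (2 * n) y"
  have "0 \<le> ?A" "?A \<le> 2 * real n * N" using good_nonneg[OF assms(1,3)] good_le[OF assms(1)] by auto
  then have "sel N n (nat \<lfloor>?A\<rfloor> + 1) \<omega> y" "nat \<lfloor>?A\<rfloor> \<le> nat \<lfloor>2 * real n * N\<rfloor>"
    using assms by (auto simp: sel_def intro!: nat_mono floor_mono) linarith+
  then show ?thesis by (intro bexI[of _ "nat \<lfloor>?A\<rfloor> + 1"]) auto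
qed

text \<open>Pigeonhole over the possible windows.\<close>

lemma window_exists:
  assumes x: "x \<noteq> root" and n: "0 < n" and N: "4 \<le> N" "0 \<le> trunc lam N"
    and big: "2 * (2 * real n * N + 1) \<le> (4 * ((trunc lam N)\<^sup>2 + extra lam)) ^ n * exp (- lam)"
  shows "\<exists>M\<in>{1..nat \<lfloor>2 * real n * N\<rfloor> + 1}. 2 \<le> (\<Sum>y\<in>desc (2 * n) x. prob {\<omega>. sel N n M \<omega> y})"
proof (rule ccontr)
  let ?D = "desc (2 * n) x" and ?W = "{1..nat \<lfloor>2 * real n * N\<rfloor> + 1}"
  let ?r = "(trunc lam N)\<^sup>2 + extra lam"
  assume "\<not> ?thesis"
  then have lt: "(\<Sum>y\<in>?D. prob {\<omega>. sel N n M \<omega> y}) < 2" if "M \<in> ?W" for M using that by (auto simp: not_le)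
  have ev: "{\<omega>. sel N n M \<omega> y} \<in> events" if "y \<in> ?D" for M y
    using sets_sel[OF x that, of "{}"] n by (auto intro: events_coords)
  have each: "?r ^ n * exp (- lam) \<le> (\<Sum>M\<in>?W. prob {\<omega>. sel N n M \<omega> y})" if y: "y \<in> ?D" for y
  proof -
    have "?r ^ n * exp (- lam) \<le> prob {\<omega>. good N n \<omega> y \<and> 1 < up2 \<omega> y}"
      by (rule prob_good[OF x y N])
    also have "\<dots> \<le> prob (\<Union>M\<in>?W. {\<omega>. sel N n M \<omega> y})"
    proof (rule finite_measure_mono)
      show "{\<omega>. good N n \<omega> y \<and> 1 < up2 \<omega> y} \<subseteq> (\<Union>M\<in>?W. {\<omega>. sel N n M \<omega> y})"
        using good_window[of N n _ y] N by fastforce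
    qed (use ev[OF y] in auto)
    also have "\<dots> \<le> (\<Sum>M\<in>?W. prob {\<omega>. sel N n M \<omega> y})"
      by (rule finite_measure_subadditive_finite) (use ev[OF y] in auto)
    finally show ?thesis .
  qed
  \<comment> \<open>Here the degree enters: at least four grandchildren.\<close>
  have m4: "4 \<le> (real m)\<^sup>2" using power_mono[of 2 "real m" 2] two_le_m by simp
  have r0: "0 \<le> ?r" using extra_pos[OF lam_pos] by simp
  have "2 * (2 * real n * N + 1) \<le> (4 * ?r) ^ n * exp (- lam)" by (rule big)
  also have "\<dots> \<le> ((real m)\<^sup>2 * ?r) ^ n * exp (- lam)"
    using m4 r0 by (intro mult_right_mono power_mono) auto
  also have "\<dots> = real (card ?D) * (?r ^ n * exp (- lam))"
    using card_desc[OF x] by (simp add: power_mult_distrib power_mult)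
  also have "\<dots> = (\<Sum>y\<in>?D. ?r ^ n * exp (- lam))" by simp
  also have "\<dots> \<le> (\<Sum>y\<in>?D. \<Sum>M\<in>?W. prob {\<omega>. sel N n M \<omega> y})"
    by (rule sum_mono[OF each])
  also have "\<dots> = (\<Sum>M\<in>?W. \<Sum>y\<in>?D. prob {\<omega>. sel N n M \<omega> y})" by (rule sum.swap)
  also have "\<dots> < (\<Sum>M\<in>?W. 2)"
    by (rule sum_strict_mono) (use lt in auto)
  also have "\<dots> = 2 * (real (nat \<lfloor>2 * real n * N\<rfloor>) + 1)" by simp
  also have "real (nat \<lfloor>2 * real n * N\<rfloor>) \<le> 2 * real n * N" using N(1) by (intro of_nat_floor) simp
  finally show False by simp
qed

lemma prob_breeds:
  assumes n: "0 < n" and N: "4 \<le> N" "0 \<le> trunc lam N"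
    and big: "2 * (2 * real n * N + 1) \<le> (4 * ((trunc lam N)\<^sup>2 + extra lam)) ^ n * exp (- lam)"
  defines "\<theta> \<equiv> 2 * real m * (1 + lam)"
  assumes rho: "2 * exp (\<theta> * (real (nat \<lfloor>2 * real n * N\<rfloor>) + 1)) * (rho / \<theta>) * real m ^ (2 * n) \<le> 1 / 2"
  shows "\<exists>M q. 0 < q \<and> (\<forall>j x. x \<noteq> root \<longrightarrow> q \<le> prob {\<omega>. breeds N n M j x \<omega>})"
proof -
  let ?W = "{1..nat \<lfloor>2 * real n * N\<rfloor> + 1}"
  obtain M where M: "\<And>x. x \<noteq> root \<Longrightarrow> M x \<in> ?W \<and>
      2 \<le> (\<Sum>y\<in>desc (2 * n) x. prob {\<omega>. sel N n (M x) \<omega> y})"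
    using window_exists[OF _ n N big] by metis
  \<comment> \<open>The largest \<open>q\<close> satisfying the smallness condition of
    \<open>breeds_recursion\<close>, as there are \<open>m ^ (2 * n)\<close> endpoints.\<close>
  define q where "q = 1 / (3 * real m ^ (2 * n))"
  have m: "0 < real m ^ (2 * n)" "1 \<le> real m ^ (2 * n)" using two_le_m by auto
  have \<theta>: "0 < \<theta>" using two_le_m lam_pos by (simp add: \<theta>_def)
  have "q \<le> prob {\<omega>. breeds N n M j x \<omega>}" if "x \<noteq> root" for j x
    using that
  proof (induction j arbitrary: x)
    case 0
    have "q \<le> 1" using m by (simp add: q_def field_simps)
    then show ?case using prob_space by simp
  next
    case (Suc j)
    show ?case
    proof (rule breeds_recursion[OF Suc.prems n])
      have "prob {\<omega>. bad (M x) x {} \<omega>} \<le> 2 * exp (\<theta> * real (M x)) * (rho / \<theta>)"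
        unfolding \<theta>_def by (rule prob_bad[OF Suc.prems])
      also have "\<dots> \<le> 2 * exp (\<theta> * (real (nat \<lfloor>2 * real n * N\<rfloor>) + 1)) * (rho / \<theta>)"
        using M[OF Suc.prems] \<theta> rho_pos by (intro mult_right_mono mult_left_mono) auto
      finally have "prob {\<omega>. bad (M x) x {} \<omega>} * real m ^ (2 * n)
          \<le> 2 * exp (\<theta> * (real (nat \<lfloor>2 * real n * N\<rfloor>) + 1)) * (rho / \<theta>) * real m ^ (2 * n)"
        by (rule mult_right_mono) simp
      with rho card_desc[OF Suc.prems] show "prob {\<omega>. bad (M x) x {} \<omega>} * card (desc (2 * n) x) \<le> 1 / 2"
        by simp
      show "q * card (desc (2 * n) x) \<le> 1 / 3"
        using m card_desc[OF Suc.prems] by (simp add: q_def)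
      show "q \<le> prob {\<omega>. breeds N n M j y \<omega>}" if "y \<in> desc (2 * n) x" for y
        using Suc.IH desc_not_root[OF that Suc.prems] by blast
    qed (use M[OF Suc.prems] in \<open>auto simp: q_def\<close>)
  qed
  moreover have "0 < q" using m by (simp add: q_def)
  ultimately show ?thesis by blast
qed

end

lemma exponential_beats_linear:
  fixes r e c :: real
  assumes "1 < r" "0 < e" "0 \<le> c"
  shows "\<exists>n>0. 2 * (2 * real n * c + 1) \<le> r ^ n * e"
proof -
  let ?x = "1 / r"
  have x: "norm ?x < 1" using assms by simp
  have "(\<lambda>n. 4 * c * (real n * ?x ^ n) + 2 * ?x ^ n) \<longlonglongrightarrow> 4 * c * 0 + 2 * 0"
    by (intro tendsto_intros powser_times_n_limit_0[OF x] LIMSEQ_power_zero[OF x])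
  then have "eventually (\<lambda>n. 4 * c * (real n * ?x ^ n) + 2 * ?x ^ n < e) sequentially"
    by (rule order_tendstoD(2)) (use assms in simp)
  then have "eventually (\<lambda>n. 0 < n \<and> 4 * c * (real n * ?x ^ n) + 2 * ?x ^ n < e) sequentially"
    using eventually_gt_at_top[of 0] by eventually_elim auto
  then obtain n where n: "0 < n" "4 * c * (real n * ?x ^ n) + 2 * ?x ^ n < e"
    using eventually_happens'[OF sequentially_bot] by blast
  then have "(4 * c * (real n * ?x ^ n) + 2 * ?x ^ n) * r ^ n \<le> e * r ^ n"
    using assms by (intro mult_right_mono) auto
  moreover have "?x ^ n * r ^ n = 1" using assms by (simp add: power_one_over)
  then have "(4 * c * (real n * ?x ^ n) + 2 * ?x ^ n) * r ^ n = 4 * c * real n + 2"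
    by (simp add: algebra_simps)
  ultimately show ?thesis using n(1) by (intro exI[of _ n]) (simp add: algebra_simps)
qed

section \<open>Measurability and conclusion\<close>

lemma measurable_history:
  fixes adj :: "'v \<Rightarrow> 'v \<Rightarrow> bool" and Q :: "('v clock \<Rightarrow> real) measure"
  assumes c: "countable (UNIV :: 'v set)" and Q: "\<And>c. (\<lambda>\<omega>. \<omega> c) \<in> borel_measurable Q"
  shows "(\<lambda>\<omega>. time1 (history adj v0 \<omega> n) y) \<in> borel_measurable Q \<and>
    (\<lambda>\<omega>. time2 (history adj v0 \<omega> n) y) \<in> borel_measurable Q"
proof (induction n arbitrary: y)
  case 0
  show ?case by (simp add: history_def initial_history_def)
next
  case (Suc n)
  let ?h = "\<lambda>\<omega>. history adj v0 \<omega> n"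
  note [measurable] = Q
  have cA: "countable A" for A :: "'v set" by (rule countable_subset[OF subset_UNIV c])
  have [measurable]: "(\<lambda>\<omega>. time1 (?h \<omega>) y) \<in> borel_measurable Q"
    "(\<lambda>\<omega>. time2 (?h \<omega>) y) \<in> borel_measurable Q" for y
    using Suc.IH by auto
  have p1 [measurable]: "(\<lambda>\<omega>. pending1 adj \<omega> (?h \<omega>) y) \<in> borel_measurable Q" for y
  proof -
    \<comment> \<open>The index set varies with the clocks through \<open>time2\<close>. Giving
      excluded neighbours the value \<infinity> makes it deterministic, so that measurability of
      countable infima applies.\<close>
    have eq: "(INF x\<in>{x. adj x y \<and> time2 h x = \<infinity>}. time1 h x + ereal (\<omega> (Spread1 x y)))
        = (INF x\<in>{x. adj x y}. if time2 h x = \<infinity> then time1 h x + ereal (\<omega> (Spread1 x y)) else \<infinity>)"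
      (is "(INF x\<in>_. ?f x) = (INF x\<in>?A. ?g x)") for h :: "'v history" and \<omega>
    proof (rule antisym)
      show "(INF x\<in>{x. adj x y \<and> time2 h x = \<infinity>}. ?f x) \<le> (INF x\<in>?A. ?g x)"
      proof (rule INF_greatest)
        fix x assume "x \<in> ?A"
        then show "(INF x\<in>{x. adj x y \<and> time2 h x = \<infinity>}. ?f x) \<le> ?g x"
          by (cases "time2 h x = \<infinity>") (auto intro: INF_lower)
      qed
      show "(INF x\<in>?A. ?g x) \<le> (INF x\<in>{x. adj x y \<and> time2 h x = \<infinity>}. ?f x)"
      proof (rule INF_greatest)
        fix x assume x: "x \<in> {x. adj x y \<and> time2 h x = \<infinity>}"
        then have "(INF x\<in>?A. ?g x) \<le> ?g x" by (intro INF_lower) simp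
        with x show "(INF x\<in>?A. ?g x) \<le> ?f x" by simp
      qed
    qed
    show ?thesis
      unfolding pending1_def eq
      by (intro measurable_If borel_measurable_INF cA) (measurable; simp)+
  qed
  have p2 [measurable]: "(\<lambda>\<omega>. pending2 adj \<omega> (?h \<omega>) y) \<in> borel_measurable Q" for y
  proof -
    have [measurable]: "(\<lambda>\<omega>. INF x\<in>{x. adj x y}. time2 (?h \<omega>) x + ereal (\<omega> (Spread2 x y))) \<in> borel_measurable Q"
      by (intro borel_measurable_INF cA) measurable
    show ?thesis unfolding pending2_def by measurable
  qed
  have ne [measurable]: "(\<lambda>\<omega>. next_event adj \<omega> (?h \<omega>)) \<in> borel_measurable Q"
    unfolding next_event_def by (intro borel_measurable_INF c) measurable
  have eq: "Measurable.pred Q (\<lambda>\<omega>. f \<omega> = g \<omega>)"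
    if [measurable]: "f \<in> borel_measurable Q" "g \<in> borel_measurable Q"
    for f g :: "('v clock \<Rightarrow> real) \<Rightarrow> ereal"
  proof -
    have "(\<lambda>\<omega>. f \<omega> = g \<omega>) = (\<lambda>\<omega>. \<not> f \<omega> < g \<omega> \<and> \<not> g \<omega> < f \<omega>)" by auto
    then show ?thesis by simp
  qed
  note [measurable] = eq[OF p1 ne] eq[OF p2 ne] borel_measurable_pred_less[OF p1 p2]
    borel_measurable_pred_less[OF p2 borel_measurable_const]
  have h: "history adj v0 \<omega> (Suc n) = step adj \<omega> (?h \<omega>)" for \<omega> by (simp add: history_def)
  show ?case
    unfolding h step_def history.simps by (intro conjI; measurable)
qed

context tree_clock_space
begin

lemma clock_space_eq: "clock_space lam rho = completion P"
  by (simp add: clock_space_def P_def expo_def)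

lemma countable_clocks: "countable (UNIV :: 'v clock set)"
proof -
  have vv: "countable (UNIV :: ('v \<times> 'v) set)"
    using countable_SIGMA[OF countable_vertices, of "\<lambda>_. UNIV"] countable_vertices by simp
  have "(UNIV :: 'v clock set) \<subseteq> range Convert \<union> range (case_prod Spread1) \<union> range (case_prod Spread2)"
  proof
    fix c :: "'v clock"
    show "c \<in> range Convert \<union> range (case_prod Spread1) \<union> range (case_prod Spread2)"
      by (cases c) (force simp: image_iff)+
  qed
  then show ?thesis
    by (rule countable_subset) (intro countable_Un countable_image countable_vertices vv)
qed

text \<open>The events of breeding for \<open>j\<close> generations decrease in \<open>j\<close>, so
  their intersection has probability at least \<open>q\<close>. Survival quantifies over real times;
  on positive clocks it agrees with the measurable event \<open>W\<close> of integer times, and the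
  remaining null set is why the space is completed.\<close>

lemma survival_positive:
  assumes v0: "v0 \<noteq> root" and n: "0 < n" and N: "0 < N" and q: "0 < q"
    and breeds: "\<And>j. q \<le> prob {\<omega>. breeds N n M j v0 \<omega>}"
  shows "0 < measure (clock_space lam rho) {\<omega> \<in> space (clock_space lam rho). type1_survives adj v0 \<omega>}"
proof -
  define Pos :: "('v clock \<Rightarrow> real) set" where "Pos = {\<omega>. \<forall>c. 0 < \<omega> c}"
  define G where "G j = {\<omega>. breeds N n M j v0 \<omega>}" for j
  define W where "W = {\<omega>. \<forall>i::nat. \<exists>x. type1_time adj v0 \<omega> x \<le> ereal (real i) \<and> ereal (real i) < type2_time adj v0 \<omega> x}"
  define V where "V = {\<omega>. type1_survives adj v0 \<omega>}"
  have tp: "tree_process adj root par level m v0 \<omega>" if "\<omega> \<in> Pos" for \<omega>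
    using that v0 finite_neighbours
    by (auto simp: Pos_def tree_process_def tree_process_axioms_def positive_clocks_def rooted_tree_axioms)
  have VW: "V \<inter> Pos = W \<inter> Pos"
  proof -
    have "type1_survives adj v0 \<omega> \<longleftrightarrow> \<omega> \<in> W" if "\<omega> \<in> Pos" for \<omega>
    proof -
      interpret tree_process adj root par level m v0 \<omega> using tp[OF that] .
      show ?thesis using survives_iff_nat by (simp add: W_def)
    qed
    then show ?thesis by (auto simp: V_def)
  qed
  have GV: "(\<Inter>j. G j) \<inter> Pos \<subseteq> V"
  proof
    fix \<omega> assume "\<omega> \<in> (\<Inter>j. G j) \<inter> Pos"
    then have "\<omega> \<in> Pos" and b: "\<And>j. breeds N n M j v0 \<omega>" by (auto simp: G_def)
    interpret tree_process adj root par level m v0 \<omega> using tp[OF \<open>\<omega> \<in> Pos\<close>] .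
    show "\<omega> \<in> V" using survives_if_breeds[OF b n N] by (simp add: V_def)
  qed
  have Gev: "G j \<in> events" for j
    unfolding G_def using sets_breeds[OF v0 n] by (rule events_coords)
  have Pos: "Pos \<in> events"
  proof -
    have "Pos = (\<Inter>c. {\<omega> \<in> space P. 0 < \<omega> c})" by (auto simp: Pos_def)
    also have "\<dots> \<in> events"
    proof (rule sets.countable_INT'[OF countable_clocks])
      note [measurable] = measurable_P
      have "{\<omega> \<in> space P. 0 < \<omega> c} \<in> events" for c by measurable
      then show "range (\<lambda>c. {\<omega> \<in> space P. 0 < \<omega> c}) \<subseteq> events" by auto
    qed simp
    finally show ?thesis .
  qed
  have Wev: "W \<in> events"
  proof -
    have [measurable]: "(\<lambda>\<omega>. type1_time adj v0 \<omega> x) \<in> borel_measurable P"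
      "(\<lambda>\<omega>. type2_time adj v0 \<omega> x) \<in> borel_measurable P" for x
      unfolding type1_time_def type2_time_def
      using measurable_history[OF countable_vertices measurable_P]
      by (auto intro!: borel_measurable_INF)
    have "W = (\<Inter>i::nat. \<Union>x. {\<omega> \<in> space P. type1_time adj v0 \<omega> x \<le> ereal (real i) \<and> ereal (real i) < type2_time adj v0 \<omega> x})"
      by (auto simp: W_def)
    also have "\<dots> \<in> events"
    proof (rule sets.countable_INT'')
      show "(\<Union>x. {\<omega> \<in> space P. type1_time adj v0 \<omega> x \<le> ereal (real i) \<and> ereal (real i) < type2_time adj v0 \<omega> x}) \<in> events" for i
        by (intro sets.countable_UN''[OF countable_vertices]) measurable
    qed (use sets.top[of P] in simp_all)
    finally show ?thesis .
  qed
  have AEPos: "AE \<omega> in P. \<omega> \<in> Pos"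
    using AE_pos[OF countable_clocks] by (simp add: Pos_def)
  then have null: "- Pos \<in> null_sets P"
    using AE_iff_null_sets[of "- Pos" P] sets.compl_sets[OF Pos]
    by (simp add: Compl_eq_Diff_UNIV)
  have "(\<lambda>j. prob (G j)) \<longlonglongrightarrow> prob (\<Inter>j. G j)"
  proof (rule finite_Lim_measure_decseq)
    show "decseq G" unfolding decseq_Suc_iff G_def using breeds_antimono by blast
  qed (use Gev in auto)
  then have "q \<le> prob (\<Inter>j. G j)"
    by (rule LIMSEQ_le_const) (use breeds in \<open>auto simp: G_def\<close>)
  also have "\<dots> \<le> prob (W \<inter> Pos)"
  proof (rule finite_measure_mono_AE)
    show "AE \<omega> in P. \<omega> \<in> (\<Inter>j. G j) \<longrightarrow> \<omega> \<in> W \<inter> Pos"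
      using AEPos by eventually_elim (use GV VW in blast)
  qed (use Wev Pos in auto)
  finally have qW: "q \<le> prob (W \<inter> Pos)" .
  interpret C: prob_space "completion P" by (rule prob_space_completion)
  have "V = (W \<inter> Pos) \<union> (V - Pos)" using VW by auto
  moreover have "(W \<inter> Pos) \<union> (V - Pos) \<in> sets (completion P)"
    by (rule sets_completionI[OF refl _ null]) (use Wev Pos in auto)
  ultimately have V: "V \<in> sets (completion P)" by simp
  have "q \<le> measure (completion P) (W \<inter> Pos)" using qW Wev Pos by simp
  also have "\<dots> \<le> measure (completion P) V"
    using VW V by (intro C.finite_measure_mono) auto
  finally show ?thesis using q by (simp add: clock_space_eq V_def)
qed

end

theorem theorem1p1:
  fixes d :: nat
  assumes "d \<ge> 3"
  shows "\<exists>lam0 > 1. \<forall>lam. 0 < lam \<and> lam < lam0 \<longrightarrow>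
           (\<exists>\<rho>0 > 0. \<forall>\<rho>. 0 < \<rho> \<and> \<rho> < \<rho>0 \<longrightarrow>
             (\<forall>(adj :: 'v \<Rightarrow> 'v \<Rightarrow> bool) v0. regular_tree d adj \<longrightarrow>
               measure (clock_space lam \<rho>)
                 {\<omega> \<in> space (clock_space lam \<rho>). type1_survives adj v0 \<omega>} > 0))"
proof -
  obtain lam0 :: real where lam0: "1 < lam0"
    "\<And>lam. 0 < lam \<and> lam < lam0 \<Longrightarrow> \<exists>N\<ge>4. 0 \<le> trunc lam N \<and> 1 / 4 < (trunc lam N)\<^sup>2 + extra lam"
    using supercritical_rate by blast
  show ?thesis
  proof (rule exI[of _ lam0], intro conjI lam0(1) allI impI)
    fix lam :: real assume lam: "0 < lam \<and> lam < lam0"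
    obtain N where N: "4 \<le> N" "0 \<le> trunc lam N" "1 / 4 < (trunc lam N)\<^sup>2 + extra lam"
      using lam0(2)[OF lam] by blast
    obtain n where n: "0 < n"
      "2 * (2 * real n * N + 1) \<le> (4 * ((trunc lam N)\<^sup>2 + extra lam)) ^ n * exp (- lam)"
      using exponential_beats_linear[of "4 * ((trunc lam N)\<^sup>2 + extra lam)" "exp (- lam)" N] N by auto
    define \<theta> where "\<theta> = 2 * real (d - 1) * (1 + lam)"
    have \<theta>: "0 < \<theta>" using assms lam by (simp add: \<theta>_def)
    \<comment> \<open>\<open>K * \<rho>\<close> is the bound of \<open>prob_bad\<close> for the last
      window times the number of endpoints. The threshold \<open>1 / (2 * K)\<close> makes it at
      most 1/2, and it is fixed before the tree is given.\<close>
    define K where "K = 2 * exp (\<theta> * (real (nat \<lfloor>2 * real n * N\<rfloor>) + 1)) / \<theta> * real (d - 1) ^ (2 * n)"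
    have K: "0 < K" using \<theta> assms by (simp add: K_def)
    show "\<exists>\<rho>0>0. \<forall>\<rho>. 0 < \<rho> \<and> \<rho> < \<rho>0 \<longrightarrow>
        (\<forall>(adj :: 'v \<Rightarrow> 'v \<Rightarrow> bool) v0. regular_tree d adj \<longrightarrow>
          0 < measure (clock_space lam \<rho>) {\<omega> \<in> space (clock_space lam \<rho>). type1_survives adj v0 \<omega>})"
    proof (rule exI[of _ "1 / (2 * K)"], intro conjI allI impI)
      show "0 < 1 / (2 * K)" using K by simp
    next
      fix \<rho> and adj :: "'v \<Rightarrow> 'v \<Rightarrow> bool" and v0 :: 'v
      assume \<rho>: "0 < \<rho> \<and> \<rho> < 1 / (2 * K)" and tree: "regular_tree d adj"
      have "K * \<rho> \<le> K * (1 / (2 * K))" using \<rho> K by (intro mult_left_mono) auto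
      also have "\<dots> = 1 / 2" using K by (simp add: field_simps)
      finally have small: "2 * exp (\<theta> * (real (nat \<lfloor>2 * real n * N\<rfloor>) + 1)) * (\<rho> / \<theta>) * real (d - 1) ^ (2 * n) \<le> 1 / 2"
        by (simp add: K_def field_simps)
      have "card {y. adj v0 y} = d" using tree by (simp add: regular_tree_def)
      then have "{y. adj v0 y} \<noteq> {}" using assms by (metis card.empty not_numeral_le_zero)
      \<comment> \<open>Any neighbour of \<open>v0\<close> will serve as the root.\<close>
      then obtain p where p: "adj v0 p" by blast
      have "v0 \<noteq> p" using p tree by (auto simp: regular_tree_def irreflp_def)
      obtain par level where "rooted_tree adj p par level (d - 1)"
        using regular_tree_rooted[OF tree assms] by metis
      then interpret tree_clock_space adj p par level "d - 1" lam \<rho>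
        using lam \<rho> by (auto simp: tree_clock_space_def tree_clock_space_axioms_def)
      obtain M q where "0 < q" "\<And>j x. x \<noteq> p \<Longrightarrow> q \<le> prob {\<omega>. breeds N n M j x \<omega>}"
        using prob_breeds[OF n(1) N(1,2) n(2)] small unfolding \<theta>_def by metis
      then show "0 < measure (clock_space lam \<rho>) {\<omega> \<in> space (clock_space lam \<rho>). type1_survives adj v0 \<omega>}"
        using survival_positive[OF \<open>v0 \<noteq> p\<close> n(1), of N q M] N(1) \<open>v0 \<noteq> p\<close> by auto
    qed
  qed
qed

end
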